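(* Let $n$ be a positive integer with $4\mid n$. Then $$\chi(\mathrm{S}\mathcal{G}_n)=\chi(G(4,n))=\chi(\mathrm{P}\mathcal{G}_n)=-\frac{1}{12}+\frac{1}{2n}.$$
   Context: $\chi$ denotes the (rational, virtual) Euler–Poincaré characteristic of a group in the sense of Wall/Serre/Brown: for $\Gamma$ with a finite-index torsion-free subgroup $\Gamma'$ of suitable finiteness type, $\chi(\Gamma)=\chi(\Gamma')/[\Gamma:\Gamma']$; in particular $\chi(\Gamma)=1/\#\Gamma$ for $\Gamma$ finite. Let $\zeta_n=e^{2\pi i/n}$, $R_n=\mathbb{Z}[\zeta_n,1/2]$. For a subring $R\subseteq\mathbb{C}$: $\mathrm{U}_2(R)=\{g\in \mathrm{GL}_2(R): gg^\dagger=1\}$, $\mathrm{SU}_2(R)$ its subgroup of determinant $1$, $\mathrm{PU}_2(R)$ the quotient of $\mathrm{U}_2(R)$ by its scalar matrices. The Clifford group is $\mathcal{C}=\mathrm{U}_2(\mathbb{Z}[i,1/2])$. With $T_n=\begin{bmatrix}1&0\\0&\zeta_n\end{bmatrix}$, set $\mathcal{G}_n=\langle\mathcal{C},T_n\rangle\leq\mathrm{U}_2(R_n)$, $\mathrm{S}\mathcal{G}_n=\mathcal{G}_n\cap\mathrm{SU}_2(R_n)$, and let $\mathrm{P}\mathcal{G}_n$ be the image of $\mathcal{G}_n$ in $\mathrm{PU}_2(R_n)$. $G(4,n)$ is the subgroup of $\mathrm{SO}_3(\mathbb{R})$ generated by a rotation of order $4$ and a rotation of order $n$ about perpendicular axes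 (concretely, by $\pi/2$ about the $y$-axis and by $2\pi/n$ about the $z$-axis). *)

theory Defs
  imports
    "HOL-Analysis.Analysis"
    "HOL-Algebra.Algebra"
    "HOL-Algebra.Free_Abelian_Groups"
begin

section \<open>The Euler-Poincare characteristic of a group\<close>

text \<open>
  We follow Serre: a group has type (FL) if the trivial module \<open>\<int>\<close> has a finite resolution
  \<open>0 \<rightarrow> L N \<rightarrow> \<dots> \<rightarrow> L 0 \<rightarrow> \<int> \<rightarrow> 0\<close> by free \<open>\<int>[G]\<close>-modules of finite rank, and then its
  characteristic is the alternating sum of the ranks.

  The free left \<open>\<int>[G]\<close>-module of rank \<open>k\<close> is rendered as the free abelian group on the
  \<open>G\<close>-set \<open>G \<times> {..<k}\<close>: the basis element \<open>(h, j)\<close> stands for \<open>h\<close> times the \<open>j\<close>-th basis vector of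
  \<open>\<int>[G]\<^sup>k\<close>. Its \<open>\<int>[G]\<close>-linear maps are the additive maps that commute with the action of \<open>G\<close>.
\<close>

definition free_module :: "('a, 'm) monoid_scheme \<Rightarrow> nat \<Rightarrow> (('a \<times> nat) \<Rightarrow>\<^sub>0 int) monoid" where
  "free_module G k = free_Abelian_group (carrier G \<times> {..<k})"

definition free_module_act ::
  "('a, 'm) monoid_scheme \<Rightarrow> 'a \<Rightarrow> (('a \<times> nat) \<Rightarrow>\<^sub>0 int) \<Rightarrow> (('a \<times> nat) \<Rightarrow>\<^sub>0 int)" where
  "free_module_act G g = frag_extend (\<lambda>(h, j). frag_of (g \<otimes>\<^bsub>G\<^esub> h, j))"

text \<open>
  The ranks are \<open>r 0, \<dots>, r N\<close>; the modules beyond degree \<open>N\<close> are required to be zero, so that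
  exactness at \<open>L N\<close> says that \<open>d (N - 1)\<close> is injective (and, for \<open>N = 0\<close>, that \<open>\<epsilon>\<close> is).
\<close>

definition finite_free_resolution :: "('a, 'm) monoid_scheme \<Rightarrow> nat \<Rightarrow> (nat \<Rightarrow> nat) \<Rightarrow> bool" where
  "finite_free_resolution G N r \<longleftrightarrow>
     (\<forall>i>N. r i = 0) \<and>
     (\<exists>(\<epsilon> :: (('a \<times> nat) \<Rightarrow>\<^sub>0 int) \<Rightarrow> int)
       (d :: nat \<Rightarrow> (('a \<times> nat) \<Rightarrow>\<^sub>0 int) \<Rightarrow> (('a \<times> nat) \<Rightarrow>\<^sub>0 int)).
        \<epsilon> \<in> hom (free_module G (r 0)) integer_group \<and>
        (\<forall>g\<in>carrier G. \<forall>x\<in>carrier (free_module G (r 0)). \<epsilon> (free_module_act G g x) = \<epsilon> x) \<and>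
        \<epsilon> ` carrier (free_module G (r 0)) = carrier integer_group \<and>
        (\<forall>i. d i \<in> hom (free_module G (r (Suc i))) (free_module G (r i)) \<and>
             (\<forall>g\<in>carrier G. \<forall>x\<in>carrier (free_module G (r (Suc i))).
                d i (free_module_act G g x) = free_module_act G g (d i x))) \<and>
        kernel (free_module G (r 0)) integer_group \<epsilon>
          = d 0 ` carrier (free_module G (r (Suc 0))) \<and>
        (\<forall>i. kernel (free_module G (r (Suc i))) (free_module G (r i)) (d i)
               = d (Suc i) ` carrier (free_module G (r (Suc (Suc i))))))"

definition type_FL :: "('a, 'm) monoid_scheme \<Rightarrow> bool" where
  "type_FL G \<longleftrightarrow> (\<exists>N r. finite_free_resolution G N r)"

definition euler_char_FL :: "('a, 'm) monoid_scheme \<Rightarrow> int" where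
  "euler_char_FL G =
     (THE e. \<exists>N r. finite_free_resolution G N r \<and> e = (\<Sum>i\<le>N. (- 1) ^ i * int (r i)))"

definition torsion_free :: "('a, 'm) monoid_scheme \<Rightarrow> bool" where
  "torsion_free G \<longleftrightarrow>
     (\<forall>x\<in>carrier G. \<forall>k::nat. k > 0 \<and> x [^]\<^bsub>G\<^esub> k = \<one>\<^bsub>G\<^esub> \<longrightarrow> x = \<one>\<^bsub>G\<^esub>)"

text \<open>
  The subgroups that compute the rational characteristic. (A group of type (FL) has finite
  cohomological dimension, hence is automatically torsion-free.)
\<close>

definition euler_subgroup :: "'a set \<Rightarrow> ('a, 'm) monoid_scheme \<Rightarrow> bool" where
  "euler_subgroup H G \<longleftrightarrow>
     subgroup H G \<and> finite (rcosets\<^bsub>G\<^esub> H) \<and>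
     torsion_free (G\<lparr>carrier := H\<rparr>) \<and> type_FL (G\<lparr>carrier := H\<rparr>)"

definition virtually_FL :: "('a, 'm) monoid_scheme \<Rightarrow> bool" where
  "virtually_FL G \<longleftrightarrow> group G \<and> (\<exists>H. euler_subgroup H G)"

text \<open>
  The value is meaningful only for \<open>virtually_FL G\<close>; the description operator makes it independent
  of the chosen subgroup, as it has to be.
\<close>

definition euler_char :: "('a, 'm) monoid_scheme \<Rightarrow> rat" where
  "euler_char G =
     (THE c. \<exists>H. euler_subgroup H G \<and>
        c = of_int (euler_char_FL (G\<lparr>carrier := H\<rparr>)) / of_nat (card (rcosets\<^bsub>G\<^esub> H)))"

section \<open>Unitary groups\<close>

definition complex_ring :: "complex ring" where
  "complex_ring = \<lparr>carrier = UNIV, monoid.mult = (*), one = 1, ring.zero = 0, add = (+)\<rparr>"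

definition subring_gen :: "complex set \<Rightarrow> complex set" where
  "subring_gen S = generate_ring complex_ring S"

definition \<zeta> :: "nat \<Rightarrow> complex" where
  "\<zeta> n = exp (2 * of_real pi * \<i> / of_nat n)"

definition Rn :: "nat \<Rightarrow> complex set" where
  "Rn n = subring_gen {\<zeta> n, 1 / 2}"

definition entries_in :: "complex set \<Rightarrow> complex^2^2 \<Rightarrow> bool" where
  "entries_in R A \<longleftrightarrow> (\<forall>i j. A $ i $ j \<in> R)"

definition GL2 :: "complex set \<Rightarrow> (complex^2^2) set" where
  "GL2 R = {A. entries_in R A \<and> (\<exists>B. entries_in R B \<and> A ** B = mat 1 \<and> B ** A = mat 1)}"

definition dagger :: "complex^2^2 \<Rightarrow> complex^2^2" where
  "dagger A = (\<chi> i j. cnj (A $ j $ i))"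

definition U2 :: "complex set \<Rightarrow> (complex^2^2) monoid" where
  "U2 R = \<lparr>carrier = {g \<in> GL2 R. g ** dagger g = mat 1}, monoid.mult = (**), one = mat 1\<rparr>"

definition SU2_carrier :: "complex set \<Rightarrow> (complex^2^2) set" where
  "SU2_carrier R = {g \<in> carrier (U2 R). det g = 1}"

definition U2_scalars :: "complex set \<Rightarrow> (complex^2^2) set" where
  "U2_scalars R = {g \<in> carrier (U2 R). \<exists>c. g = mat c}"

definition PU2 :: "complex set \<Rightarrow> (complex^2^2) set monoid" where
  "PU2 R = U2 R Mod U2_scalars R"

definition Clifford :: "(complex^2^2) set" where
  "Clifford = carrier (U2 (subring_gen {\<i>, 1 / 2}))"

definition T_gate :: "nat \<Rightarrow> complex^2^2" where
  "T_gate n = vector [vector [1, 0], vector [0, \<zeta> n]]"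

text \<open>
  For \<open>4 dvd n\<close> the generators lie in \<open>U2 (Rn n)\<close>, and so the three definitions below yield groups.
\<close>

definition Gn :: "nat \<Rightarrow> (complex^2^2) set" where
  "Gn n = generate (U2 (Rn n)) (Clifford \<union> {T_gate n})"

definition SG :: "nat \<Rightarrow> (complex^2^2) monoid" where
  "SG n = (U2 (Rn n))\<lparr>carrier := Gn n \<inter> SU2_carrier (Rn n)\<rparr>"

definition PG :: "nat \<Rightarrow> (complex^2^2) set monoid" where
  "PG n = (PU2 (Rn n))\<lparr>carrier := (\<lambda>g. U2_scalars (Rn n) #>\<^bsub>U2 (Rn n)\<^esub> g) ` Gn n\<rparr>"

section \<open>Groups generated by two rotations about perpendicular axes\<close>

definition SO3 :: "(real^3^3) monoid" where
  "SO3 = \<lparr>carrier = {A. rotation_matrix A}, monoid.mult = (**), one = mat 1\<rparr>"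

definition rot_y :: "real \<Rightarrow> real^3^3" where
  "rot_y t = vector [vector [cos t, 0, sin t],
                     vector [0, 1, 0],
                     vector [- sin t, 0, cos t]]"

definition rot_z :: "real \<Rightarrow> real^3^3" where
  "rot_z t = vector [vector [cos t, - sin t, 0],
                     vector [sin t, cos t, 0],
                     vector [0, 0, 1]]"

definition Grot :: "nat \<Rightarrow> nat \<Rightarrow> (real^3^3) monoid" where
  "Grot p q =
     SO3\<lparr>carrier := generate SO3 {rot_y (2 * pi / of_nat p), rot_z (2 * pi / of_nat q)}\<rparr>"

end

theory Submission
  imports Defs
begin

text \<open>
  The group \<open>Gn n\<close> is the amalgam of two finite groups: the preimage of the octahedral group, of
  order \<open>24 n\<close>, and the group of monomial matrices with entries in the \<open>n\<close>-th roots of unity, of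
  order \<open>2 n^2\<close>, which meet in a group of order \<open>8 n\<close>. That alternating words are nontrivial
  is a ping-pong argument on the Pauli coordinates of the conjugates of the third Pauli matrix,
  measured with a valuation of the complex numbers above 2: for an angle that is a multiple of \<open>2 pi / n\<close>
  but not of \<open>pi / 2\<close>, cosine and sine have the same absolute value, which exceeds 1.

  The cellular chain complex of the Bass--Serre tree is a finite free resolution over every torsion-free
  subgroup of finite index, for instance the one that is congruent to the identity modulo 3. Hence the
  characteristic of \<open>Gn n\<close> is \<open>1/(24 n) + 1/(2 n^2) - 1/(8 n)\<close>. Finally \<open>SG n\<close>, the kernel of the
  determinant, has index \<open>n\<close>, while \<open>PG n\<close> and \<open>Grot 4 n\<close> are quotients by the \<open>n\<close> scalar matrices; both
  multiply the characteristic by \<open>n\<close>. That no further scalars occur follows from ping-pong again.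

  The characteristic does not depend on the resolution because a chain homotopy equivalence of
  free resolutions, passed to coinvariants, has equal Lefschetz numbers in both directions.
\<close>

section \<open>Free resolutions and traces\<close>

text \<open>The amalgam is formed in \<open>Gn n\<close>, although the statement concerns
  \<open>SG n\<close>, \<open>PG n\<close> and \<open>Grot 4 n\<close>: in \<open>Gn n\<close> both
  factors contain all scalars from \<open>mu n\<close> and consist of explicitly parametrized
  matrices, so that orders and intersection are simply counted. For \<open>n = 4\<close> one factor
  contains the other, and the same argument covers this finite group.

  Primes of the cyclotomic field above 2 never enter. Zorn's lemma provides some valuation ring of
  the complex numbers without 1/2, and roots of unity are units in it. The congruence subgroup uses
  the modulus 3 because 2 is inverted in \<open>Rn n\<close>. One lemma serves both primes: a root
  of unity congruent to 1 modulo 3, or modulo 4, equals 1. The first case gives torsion-freeness,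
  the second the size of cosines and sines.

  Since \<open>euler_char\<close> and \<open>euler_char_FL\<close> are definite descriptions,
  independence of all choices has to be proved before a value can be computed. Resolutions are
  treated as complexes of permutation modules, a notion that contains both free modules and the
  chains of a tree.\<close>

abbreviation frags :: "'x set \<Rightarrow> ('x \<Rightarrow>\<^sub>0 int) set" where
  "frags E \<equiv> {c. Poly_Mapping.keys c \<subseteq> E}"

text \<open>Functions are total, so additivity is asked for only on chains supported in
  \<open>E\<close>. The target is any abelian group, which includes the integers as target of the
  augmentation.\<close>

definition additive_on :: "'x set \<Rightarrow> (('x \<Rightarrow>\<^sub>0 int) \<Rightarrow> 'b::ab_group_add) \<Rightarrow> bool" where
  "additive_on E f \<longleftrightarrow> (\<forall>x\<in>frags E. \<forall>y\<in>frags E. f (x + y) = f x + f y)"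

lemma Fr_0 [simp]: "0 \<in> frags E" by simp

lemma Fr_add: "x \<in> frags E \<Longrightarrow> y \<in> frags E \<Longrightarrow> x + y \<in> frags E"
  using keys_add[of x y] by auto

lemma Fr_diff: "x \<in> frags E \<Longrightarrow> y \<in> frags E \<Longrightarrow> x - y \<in> frags E"
  using keys_diff[of x y] by auto

lemma Fr_frag_extend:
  assumes "\<And>x. x \<in> E \<Longrightarrow> f x \<in> frags Y" and "c \<in> frags E"
  shows "frag_extend f c \<in> frags Y"
  using keys_frag_extend[of f c] assms by fastforce

lemma lin_add: "additive_on E f \<Longrightarrow> x \<in> frags E \<Longrightarrow> y \<in> frags E \<Longrightarrow> f (x + y) = f x + f y"
  unfolding additive_on_def by blast

lemma lin_0: "additive_on E f \<Longrightarrow> f 0 = 0"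
  using lin_add[of E f 0 0] by simp

lemma lin_diff: "additive_on E f \<Longrightarrow> x \<in> frags E \<Longrightarrow> y \<in> frags E \<Longrightarrow> f (x - y) = f x - f y"
  using lin_add[of E f "x - y" y] Fr_diff[of x E y] by (simp add: algebra_simps)

lemma lin_frag_extend: "additive_on E (frag_extend f)"
  by (simp add: additive_on_def frag_extend_add)

lemma lin_ext:
  assumes "additive_on E f" "additive_on E g" "\<And>x. x \<in> E \<Longrightarrow> f (frag_of x) = g (frag_of x)" "c \<in> frags E"
  shows "f c = g c"
  using assms(4)[simplified]
proof (rule free_Abelian_group_induct)
  show "f 0 = g 0" using assms(1,2) by (simp add: lin_0)
next
  fix x y assume "Poly_Mapping.keys x \<subseteq> E" "Poly_Mapping.keys y \<subseteq> E" "f x = g x" "f y = g y"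
  then show "f (x - y) = g (x - y)" using assms(1,2) by (simp add: lin_diff)
qed (use assms in auto)

lemma lin_comp:
  assumes "additive_on E f" "f ` frags E \<subseteq> frags Y" "additive_on Y g"
  shows "additive_on E (\<lambda>x. g (f x))"
  unfolding additive_on_def
proof (intro ballI)
  fix x y assume xy: "x \<in> frags E" "y \<in> frags E"
  then have "f x \<in> frags Y" "f y \<in> frags Y" using assms(2) by blast+
  then show "g (f (x + y)) = g (f x) + g (f y)"
    using xy assms(1,3) by (simp only: lin_add)
qed

lemma lin_minus: "additive_on E f \<Longrightarrow> additive_on E g \<Longrightarrow> additive_on E (\<lambda>x. f x - g x)"
  unfolding additive_on_def by (simp add: algebra_simps)

lemma lin_id: "additive_on E (\<lambda>x. x)"
  unfolding additive_on_def by simp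

section \<open>Resolutions by permutation modules\<close>

definition perm_act :: "('g \<Rightarrow> 'x \<Rightarrow> 'x) \<Rightarrow> 'g \<Rightarrow> ('x \<Rightarrow>\<^sub>0 int) \<Rightarrow> ('x \<Rightarrow>\<^sub>0 int)" where
  "perm_act \<alpha> g = frag_extend (\<lambda>x. frag_of (\<alpha> g x))"

text \<open>Common form of a resolution by free modules, where \<open>E i\<close> is a set of pairs,
  and of the chain complex of a tree, where \<open>E i\<close> is a set of cosets. The index is
  shifted: \<open>d i\<close> goes from degree \<open>i + 1\<close> to degree
  \<open>i\<close>.\<close>

definition perm_resolution ::
  "'g set \<Rightarrow> ('g \<Rightarrow> 'x \<Rightarrow> 'x) \<Rightarrow> (nat \<Rightarrow> 'x set) \<Rightarrow> (('x \<Rightarrow>\<^sub>0 int) \<Rightarrow> int) \<Rightarrow>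
    (nat \<Rightarrow> ('x \<Rightarrow>\<^sub>0 int) \<Rightarrow> ('x \<Rightarrow>\<^sub>0 int)) \<Rightarrow> bool" where
  "perm_resolution S \<alpha> E \<epsilon> d \<longleftrightarrow>
     additive_on (E 0) \<epsilon> \<and>
     (\<forall>g\<in>S. \<forall>x\<in>frags (E 0). \<epsilon> (perm_act \<alpha> g x) = \<epsilon> x) \<and>
     \<epsilon> ` frags (E 0) = UNIV \<and>
     (\<forall>i. additive_on (E (Suc i)) (d i) \<and> d i ` frags (E (Suc i)) \<subseteq> frags (E i) \<and>
        (\<forall>g\<in>S. \<forall>x\<in>frags (E (Suc i)). d i (perm_act \<alpha> g x) = perm_act \<alpha> g (d i x))) \<and>
     {x \<in> frags (E 0). \<epsilon> x = 0} = d 0 ` frags (E (Suc 0)) \<and>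
     (\<forall>i. {x \<in> frags (E (Suc i)). d i x = 0} = d (Suc i) ` frags (E (Suc (Suc i))))"

definition translate :: "('a, 'm) monoid_scheme \<Rightarrow> 'a \<Rightarrow> 'a \<times> nat \<Rightarrow> 'a \<times> nat" where
  "translate G g = (\<lambda>(h, j). (g \<otimes>\<^bsub>G\<^esub> h, j))"

lemma free_module_act_eq: "free_module_act G g = perm_act (translate G) g"
  unfolding free_module_act_def perm_act_def translate_def
  by (rule arg_cong[where f = frag_extend]) auto

lemma hom_free_Abelian_iff:
  "f \<in> hom (free_Abelian_group E) (free_Abelian_group Y) \<longleftrightarrow> additive_on E f \<and> f ` frags E \<subseteq> frags Y"
  unfolding hom_def additive_on_def by (auto simp: free_Abelian_group_def Pi_def)

lemma hom_integer_group_iff: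
  "f \<in> hom (free_Abelian_group E) integer_group \<longleftrightarrow> additive_on E f"
  unfolding hom_def additive_on_def by (auto simp: free_Abelian_group_def)

text \<open>From here on the homomorphisms and kernels of \<open>free_Abelian_group\<close> give way
  to additive maps on chains.\<close>

lemma finite_free_resolution_iff:
  "finite_free_resolution G N r \<longleftrightarrow> (\<forall>i>N. r i = 0) \<and>
     (\<exists>\<epsilon> d. perm_resolution (carrier G) (translate G) (\<lambda>i. carrier G \<times> {..<r i}) \<epsilon> d)"
proof -
  have carr: "carrier (free_Abelian_group E) = frags E" for E :: "('a \<times> nat) set"
    by (simp add: free_Abelian_group_def)
  have ker: "kernel (free_Abelian_group E) (free_Abelian_group Y) f = {x \<in> frags E. f x = 0}"
    for E Y :: "('a \<times> nat) set" and f
    unfolding kernel_def carr one_free_Abelian_group by auto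
  have ker0: "kernel (free_Abelian_group E) integer_group f = {x \<in> frags E. f x = 0}"
    for E :: "('a \<times> nat) set" and f
    unfolding kernel_def carr by auto
  show ?thesis
    unfolding finite_free_resolution_def perm_resolution_def free_module_def free_module_act_eq
      hom_free_Abelian_iff hom_integer_group_iff ker ker0 carr
    by (simp only: carrier_integer_group conj_assoc)
qed

section \<open>Equivariant maps between free modules and their lifts\<close>

definition modmap :: "('a, 'm) monoid_scheme \<Rightarrow> nat \<Rightarrow> nat \<Rightarrow>
    (('a \<times> nat \<Rightarrow>\<^sub>0 int) \<Rightarrow> ('a \<times> nat \<Rightarrow>\<^sub>0 int)) \<Rightarrow> bool" where
  "modmap G a b f \<longleftrightarrow> additive_on (carrier G \<times> {..<a}) f \<and>
     f ` frags (carrier G \<times> {..<a}) \<subseteq> frags (carrier G \<times> {..<b}) \<and>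
     (\<forall>g\<in>carrier G. \<forall>x\<in>frags (carrier G \<times> {..<a}).
        f (perm_act (translate G) g x) = perm_act (translate G) g (f x))"

lemma modmap_lin: "modmap G a b f \<Longrightarrow> additive_on (carrier G \<times> {..<a}) f"
  and modmap_in: "modmap G a b f \<Longrightarrow> x \<in> frags (carrier G \<times> {..<a}) \<Longrightarrow> f x \<in> frags (carrier G \<times> {..<b})"
  and modmap_act: "modmap G a b f \<Longrightarrow> g \<in> carrier G \<Longrightarrow> x \<in> frags (carrier G \<times> {..<a}) \<Longrightarrow>
        f (perm_act (translate G) g x) = perm_act (translate G) g (f x)"
  unfolding modmap_def by blast+

lemma modmapI:
  assumes "additive_on (carrier G \<times> {..<a}) f"
    and "\<And>x. x \<in> frags (carrier G \<times> {..<a}) \<Longrightarrow> f x \<in> frags (carrier G \<times> {..<b})"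
    and "\<And>g x. g \<in> carrier G \<Longrightarrow> x \<in> frags (carrier G \<times> {..<a}) \<Longrightarrow>
        f (perm_act (translate G) g x) = perm_act (translate G) g (f x)"
  shows "modmap G a b f"
  unfolding modmap_def by (intro conjI ballI image_subsetI assms)

lemma perm_act_in:
  assumes "\<And>x. x \<in> E \<Longrightarrow> \<alpha> g x \<in> E" "c \<in> frags E"
  shows "perm_act \<alpha> g c \<in> frags E"
  unfolding perm_act_def by (rule Fr_frag_extend[OF _ assms(2)]) (use assms(1) in auto)

lemma perm_act_diff: "perm_act \<alpha> g (x - y) = perm_act \<alpha> g x - perm_act \<alpha> g y"
  by (simp add: perm_act_def frag_extend_diff)

lemma perm_act_add: "perm_act \<alpha> g (x + y) = perm_act \<alpha> g x + perm_act \<alpha> g y"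
  by (simp add: perm_act_def frag_extend_add)

lemma lin_perm_act: "additive_on E (perm_act \<alpha> g)"
  unfolding perm_act_def by (rule lin_frag_extend)

lemma modmap_comp:
  assumes f: "modmap G a b f" and g: "modmap G b c g"
  shows "modmap G a c (\<lambda>x. g (f x))"
proof (rule modmapI)
  show "additive_on (carrier G \<times> {..<a}) (\<lambda>x. g (f x))"
    by (rule lin_comp[OF modmap_lin[OF f] image_subsetI modmap_lin[OF g]]) (rule modmap_in[OF f])
  show "g (f x) \<in> frags (carrier G \<times> {..<c})" if "x \<in> frags (carrier G \<times> {..<a})" for x
    by (rule modmap_in[OF g modmap_in[OF f that]])
  show "g (f (perm_act (translate G) h x)) = perm_act (translate G) h (g (f x))"
    if "h \<in> carrier G" "x \<in> frags (carrier G \<times> {..<a})" for h x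
    by (simp only: modmap_act[OF f that] modmap_act[OF g that(1) modmap_in[OF f that(2)]])
qed

lemma modmap_minus:
  assumes f: "modmap G a b f" and g: "modmap G a b g"
  shows "modmap G a b (\<lambda>x. f x - g x)"
proof (rule modmapI)
  show "f x - g x \<in> frags (carrier G \<times> {..<b})" if "x \<in> frags (carrier G \<times> {..<a})" for x
    by (rule Fr_diff[OF modmap_in[OF f that] modmap_in[OF g that]])
  show "f (perm_act (translate G) h x) - g (perm_act (translate G) h x)
      = perm_act (translate G) h (f x - g x)"
    if "h \<in> carrier G" "x \<in> frags (carrier G \<times> {..<a})" for h x
    by (simp only: modmap_act[OF f that] modmap_act[OF g that] perm_act_diff)
qed (rule lin_minus[OF modmap_lin[OF f] modmap_lin[OF g]])

lemma modmap_id: "modmap G a a (\<lambda>x. x)"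
  by (rule modmapI) (auto simp: lin_id)

lemma (in group) translate_in: "g \<in> carrier G \<Longrightarrow> x \<in> carrier G \<times> {..<k} \<Longrightarrow>
    translate G g x \<in> carrier G \<times> {..<k}"
  by (auto simp: translate_def)

lemma (in group) perm_act_translate:
  assumes "g \<in> carrier G" "h \<in> carrier G" "x \<in> frags (carrier G \<times> {..<k})"
  shows "perm_act (translate G) g (perm_act (translate G) h x) = perm_act (translate G) (g \<otimes> h) x"
proof (rule lin_ext[OF _ lin_perm_act _ assms(3)])
  show "additive_on (carrier G \<times> {..<k}) (\<lambda>x. perm_act (translate G) g (perm_act (translate G) h x))"
    by (simp add: additive_on_def perm_act_add)
qed (use assms in \<open>auto simp: perm_act_def translate_def m_assoc\<close>)

text \<open>A lift is determined by its values on the basis, so it exists because the module is free.\<close>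

lemma (in group) modmap_lift:
  fixes d :: "('a \<times> nat \<Rightarrow>\<^sub>0 int) \<Rightarrow> 'm::ab_group_add"
  assumes d: "additive_on (carrier G \<times> {..<b}) d"
      "\<And>g x. g \<in> carrier G \<Longrightarrow> x \<in> frags (carrier G \<times> {..<b}) \<Longrightarrow> d (perm_act (translate G) g x) = \<alpha> g (d x)"
    and \<phi>: "additive_on (carrier G \<times> {..<a}) \<phi>"
      "\<And>g x. g \<in> carrier G \<Longrightarrow> x \<in> frags (carrier G \<times> {..<a}) \<Longrightarrow> \<phi> (perm_act (translate G) g x) = \<alpha> g (\<phi> x)"
    and im: "\<And>x. x \<in> frags (carrier G \<times> {..<a}) \<Longrightarrow> \<phi> x \<in> d ` frags (carrier G \<times> {..<b})"
  obtains \<psi> where "modmap G a b \<psi>" "\<And>x. x \<in> frags (carrier G \<times> {..<a}) \<Longrightarrow> d (\<psi> x) = \<phi> x"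
proof -
  \<comment> \<open>\<open>frag_of (\<one>, j)\<close> is the \<open>j\<close>-th basis vector of
    the free module.\<close>
  have "\<exists>y. y \<in> frags (carrier G \<times> {..<b}) \<and> d y = \<phi> (frag_of (\<one>, j))" if "j < a" for j
  proof -
    have "frag_of (\<one>, j) \<in> frags (carrier G \<times> {..<a})" using that by auto
    from im[OF this] show ?thesis by auto
  qed
  then obtain y where y: "\<And>j. j < a \<Longrightarrow> y j \<in> frags (carrier G \<times> {..<b}) \<and> d (y j) = \<phi> (frag_of (\<one>, j))"
    by metis
  \<comment> \<open>Forced by equivariance, since \<open>(h, j)\<close> is \<open>h\<close> times
    the \<open>j\<close>-th basis vector.\<close>
  define \<psi> where "\<psi> = frag_extend (\<lambda>(h, j). perm_act (translate G) h (y j))"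
  have pin: "perm_act (translate G) h (y j) \<in> frags (carrier G \<times> {..<b})" if "h \<in> carrier G" "j < a" for h j
    by (rule perm_act_in) (use that y translate_in in blast)+
  have inn: "\<psi> x \<in> frags (carrier G \<times> {..<b})" if "x \<in> frags (carrier G \<times> {..<a})" for x
    unfolding \<psi>_def by (rule Fr_frag_extend[OF _ that]) (use pin in auto)
  have act: "\<psi> (perm_act (translate G) g x) = perm_act (translate G) g (\<psi> x)"
    if g: "g \<in> carrier G" and "x \<in> frags (carrier G \<times> {..<a})" for g x
  proof (rule lin_ext[OF _ _ _ that(2)])
    show "additive_on (carrier G \<times> {..<a}) (\<lambda>x. \<psi> (perm_act (translate G) g x))"
      "additive_on (carrier G \<times> {..<a}) (\<lambda>x. perm_act (translate G) g (\<psi> x))"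
      by (simp_all add: additive_on_def perm_act_add \<psi>_def frag_extend_add)
    fix x assume "x \<in> carrier G \<times> {..<a}"
    then obtain h j where x: "x = (h, j)" "h \<in> carrier G" "j < a" by auto
    show "\<psi> (perm_act (translate G) g (frag_of x)) = perm_act (translate G) g (\<psi> (frag_of x))"
    proof -
      have 1: "perm_act (translate G) g (frag_of x) = frag_of (g \<otimes> h, j)"
        using x by (simp add: perm_act_def translate_def)
      have "\<psi> (frag_of (k, j)) = perm_act (translate G) k (y j)" for k
        by (simp add: \<psi>_def)
      then show ?thesis
        unfolding 1 using perm_act_translate[OF g x(2), of "y j" b] y[OF x(3)] x by simp
    qed
  qed
  have 2: "d (\<psi> x) = \<phi> x" if "x \<in> frags (carrier G \<times> {..<a})" for x
  proof (rule lin_ext[OF _ \<phi>(1) _ that])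
    show "additive_on (carrier G \<times> {..<a}) (\<lambda>x. d (\<psi> x))"
      by (rule lin_comp[OF _ _ d(1)]) (use inn in \<open>auto simp: \<psi>_def lin_frag_extend\<close>)
    fix x assume "x \<in> carrier G \<times> {..<a}"
    then obtain h j where x: "x = (h, j)" "h \<in> carrier G" "j < a" by auto
    have "perm_act (translate G) h (frag_of (\<one>, j)) = frag_of (h, j)"
      using x by (simp add: perm_act_def translate_def)
    then have "\<phi> (frag_of (h, j)) = \<alpha> h (\<phi> (frag_of (\<one>, j)))"
      using \<phi>(2)[OF x(2), of "frag_of (\<one>, j)"] x by auto
    also have "\<dots> = d (perm_act (translate G) h (y j))"
      using d(2)[OF x(2), of "y j"] y[OF x(3)] by simp
    finally show "d (\<psi> (frag_of x)) = \<phi> (frag_of x)"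
      using x by (simp add: \<psi>_def)
  qed
  have "modmap G a b \<psi>"
    by (rule modmapI[OF _ inn act]) (simp_all only: \<psi>_def lin_frag_extend)
  from that[OF this 2] show ?thesis .
qed

text \<open>Passing to coinvariants turns module maps into integer matrices.\<close>

definition coinv :: "('a \<times> nat \<Rightarrow>\<^sub>0 int) \<Rightarrow> nat \<Rightarrow> int" where
  "coinv x = Poly_Mapping.lookup (frag_extend (\<lambda>(h, j). frag_of j) x)"

definition matr :: "('a, 'm) monoid_scheme \<Rightarrow> (('a \<times> nat \<Rightarrow>\<^sub>0 int) \<Rightarrow> ('a \<times> nat \<Rightarrow>\<^sub>0 int)) \<Rightarrow> nat \<Rightarrow> nat \<Rightarrow> int" where
  "matr G f j k = coinv (f (frag_of (\<one>\<^bsub>G\<^esub>, k))) j"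

definition trac :: "('a, 'm) monoid_scheme \<Rightarrow> nat \<Rightarrow> (('a \<times> nat \<Rightarrow>\<^sub>0 int) \<Rightarrow> ('a \<times> nat \<Rightarrow>\<^sub>0 int)) \<Rightarrow> int" where
  "trac G a f = (\<Sum>k<a. matr G f k k)"

lemma coinv_add: "coinv (x + y) j = coinv x j + coinv y j"
  and coinv_diff: "coinv (x - y) j = coinv x j - coinv y j"
  by (simp_all add: coinv_def frag_extend_add frag_extend_diff lookup_add lookup_minus)

lemma coinv_of: "coinv (frag_of (h, k)) j = (if j = k then 1 else 0)"
  by (simp add: coinv_def)

lemma coinv_act: "coinv (perm_act (translate G) g x) = coinv x"
proof -
  have "additive_on UNIV (\<lambda>x. frag_extend (\<lambda>(h, j). frag_of j) (perm_act (translate G) g x))"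
    by (simp add: additive_on_def perm_act_add frag_extend_add)
  then have "frag_extend (\<lambda>(h, j). frag_of j) (perm_act (translate G) g x) = frag_extend (\<lambda>(h, j). frag_of j) x"
    by (rule lin_ext[OF _ lin_frag_extend]) (auto simp: perm_act_def translate_def)
  then show ?thesis by (simp add: coinv_def)
qed

text \<open>On \<open>(h, k)\<close> equivariance moves \<open>h\<close> in front of
  \<open>f\<close>, where coinvariants do not see it; so \<open>f\<close> acts on coinvariants
  through the integer matrix \<open>matr G f\<close>.\<close>

lemma (in group) coinv_modmap:
  assumes f: "modmap G a b f" and x: "x \<in> frags (carrier G \<times> {..<a})"
  shows "coinv (f x) j = (\<Sum>k<a. coinv x k * matr G f j k)"
proof (rule lin_ext[OF _ _ _ x])
  show "additive_on (carrier G \<times> {..<a}) (\<lambda>x. coinv (f x) j)"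
    using modmap_lin[OF f] by (simp add: additive_on_def coinv_add)
  show "additive_on (carrier G \<times> {..<a}) (\<lambda>x. \<Sum>k<a. coinv x k * matr G f j k)"
    by (simp add: additive_on_def coinv_add algebra_simps sum.distrib)
  fix x assume "x \<in> carrier G \<times> {..<a}"
  then obtain h k where x: "x = (h, k)" "h \<in> carrier G" "k < a" by auto
  have "f (frag_of (h, k)) = perm_act (translate G) h (f (frag_of (\<one>, k)))"
    using modmap_act[OF f x(2), of "frag_of (\<one>, k)"] x by (simp add: perm_act_def translate_def)
  then have "coinv (f (frag_of x)) j = matr G f j k"
    using x by (simp add: coinv_act matr_def)
  moreover have "(\<Sum>i<a. coinv (frag_of x) i * matr G f j i) = (\<Sum>i<a. if i = k then matr G f j i else 0)"
    by (rule sum.cong) (auto simp: x(1) coinv_of)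
  ultimately show "coinv (f (frag_of x)) j = (\<Sum>i<a. coinv (frag_of x) i * matr G f j i)"
    using x by simp
qed

text \<open>The rule tr (PQ) = tr (QP) for integer matrices. The ranks \<open>a\<close> and
  \<open>b\<close> may differ, as both the homotopy argument and the comparison of two resolutions
  require.\<close>

lemma (in group) trac_comm:
  assumes f: "modmap G a b f" and g: "modmap G b a g"
  shows "trac G a (\<lambda>x. g (f x)) = trac G b (\<lambda>x. f (g x))"
proof -
  have 1: "matr G (\<lambda>x. g (f x)) k k = (\<Sum>l<b. matr G f l k * matr G g k l)" if "k < a" for k
    unfolding matr_def[of G "\<lambda>x. g (f x)"]
    using coinv_modmap[OF g modmap_in[OF f], of "frag_of (\<one>, k)" k] that by (simp add: matr_def)
  have 2: "matr G (\<lambda>x. f (g x)) l l = (\<Sum>k<a. matr G g k l * matr G f l k)" if "l < b" for l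
    unfolding matr_def[of G "\<lambda>x. f (g x)"]
    using coinv_modmap[OF f modmap_in[OF g], of "frag_of (\<one>, l)" l] that by (simp add: matr_def)
  have "trac G a (\<lambda>x. g (f x)) = (\<Sum>k<a. \<Sum>l<b. matr G f l k * matr G g k l)"
    unfolding trac_def using 1 by simp
  also have "\<dots> = (\<Sum>l<b. \<Sum>k<a. matr G f l k * matr G g k l)" by (rule sum.swap)
  also have "\<dots> = trac G b (\<lambda>x. f (g x))"
    unfolding trac_def using 2 by (simp add: mult.commute)
  finally show ?thesis .
qed

lemma (in group) trac_cong:
  assumes "\<And>x. x \<in> frags (carrier G \<times> {..<a}) \<Longrightarrow> f x = g x"
  shows "trac G a f = trac G a g"
  unfolding trac_def matr_def by (intro sum.cong refl) (use assms in auto)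

lemma trac_diff: "trac G a (\<lambda>x. f x - g x) = trac G a f - trac G a g"
  and trac_add: "trac G a (\<lambda>x. f x + g x) = trac G a f + trac G a g"
  by (simp_all add: trac_def matr_def coinv_diff coinv_add sum_subtractf sum.distrib)

lemma trac_id: "trac G a (\<lambda>x. x) = int a"
  by (simp add: trac_def matr_def coinv_of)

section \<open>Comparison of free resolutions up to homotopy\<close>

lemma perm_resolutionD:
  assumes "perm_resolution S \<alpha> E \<epsilon> d"
  shows "additive_on (E 0) \<epsilon>" "\<And>g x. g \<in> S \<Longrightarrow> x \<in> frags (E 0) \<Longrightarrow> \<epsilon> (perm_act \<alpha> g x) = \<epsilon> x"
    "\<epsilon> ` frags (E 0) = UNIV"
    "\<And>i. additive_on (E (Suc i)) (d i)"
    "\<And>i x. x \<in> frags (E (Suc i)) \<Longrightarrow> d i x \<in> frags (E i)"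
    "\<And>i g x. g \<in> S \<Longrightarrow> x \<in> frags (E (Suc i)) \<Longrightarrow> d i (perm_act \<alpha> g x) = perm_act \<alpha> g (d i x)"
    "\<And>x. x \<in> frags (E (Suc 0)) \<Longrightarrow> \<epsilon> (d 0 x) = 0"
    "\<And>i x. x \<in> frags (E (Suc (Suc i))) \<Longrightarrow> d i (d (Suc i) x) = 0"
    "\<And>x. x \<in> frags (E 0) \<Longrightarrow> \<epsilon> x = 0 \<Longrightarrow> x \<in> d 0 ` frags (E (Suc 0))"
    "\<And>i x. x \<in> frags (E (Suc i)) \<Longrightarrow> d i x = 0 \<Longrightarrow> x \<in> d (Suc i) ` frags (E (Suc (Suc i)))"
proof -
  note R = assms[unfolded perm_resolution_def]
  note d = R[THEN conjunct2, THEN conjunct2, THEN conjunct2, THEN conjunct1, rule_format]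
  note k0 = R[THEN conjunct2, THEN conjunct2, THEN conjunct2, THEN conjunct2, THEN conjunct1]
  note k = R[THEN conjunct2, THEN conjunct2, THEN conjunct2, THEN conjunct2, THEN conjunct2, rule_format]
  show "additive_on (E 0) \<epsilon>" by (rule R[THEN conjunct1])
  show "\<epsilon> (perm_act \<alpha> g x) = \<epsilon> x" if "g \<in> S" "x \<in> frags (E 0)" for g x
    using R[THEN conjunct2, THEN conjunct1] that by (simp only: Ball_def simp_thms)
  show "\<epsilon> ` frags (E 0) = UNIV" by (rule R[THEN conjunct2, THEN conjunct2, THEN conjunct1])
  show "additive_on (E (Suc i)) (d i)" for i by (rule d[THEN conjunct1])
  show "d i x \<in> frags (E i)" if "x \<in> frags (E (Suc i))" for i x
    by (rule subsetD[OF d[THEN conjunct2, THEN conjunct1] imageI[OF that]])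
  show "d i (perm_act \<alpha> g x) = perm_act \<alpha> g (d i x)" if "g \<in> S" "x \<in> frags (E (Suc i))" for g x i
    by (rule d[THEN conjunct2, THEN conjunct2, THEN bspec, THEN bspec, OF that])
  show "\<epsilon> (d 0 x) = 0" if "x \<in> frags (E (Suc 0))" for x
    using imageI[OF that, of "d 0"] unfolding k0[symmetric] by simp
  show "d i (d (Suc i) x) = 0" if "x \<in> frags (E (Suc (Suc i)))" for i x
    using imageI[OF that, of "d (Suc i)"] unfolding k[symmetric] by simp
  show "x \<in> d 0 ` frags (E (Suc 0))" if "x \<in> frags (E 0)" "\<epsilon> x = 0" for x
    unfolding k0[symmetric] using that by simp
  show "x \<in> d (Suc i) ` frags (E (Suc (Suc i)))" if "x \<in> frags (E (Suc i))" "d i x = 0" for i x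
    unfolding k[symmetric] using that by simp
qed

abbreviation free_resolution where
  "free_resolution G r \<equiv> perm_resolution (carrier G) (translate G) (\<lambda>i. carrier G \<times> {..<r i})"

lemma free_resolution_d:
  assumes R: "free_resolution G r \<epsilon> d"
  shows "modmap G (r (Suc i)) (r i) (d i)"
  by (rule modmapI[OF perm_resolutionD(4)[OF R] perm_resolutionD(5)[OF R] perm_resolutionD(6)[OF R]])

text \<open>The comparison theorem, degree by degree: exactness of the target puts the values to be
  lifted into the image of the differential, and freeness of the source provides the lift.\<close>

lemma (in group) chain_map_exists:
  assumes R: "free_resolution G r \<epsilon> d" and R': "free_resolution G r' \<epsilon>' d'"
  obtains f where "\<And>i. modmap G (r i) (r' i) (f i)"
      "\<And>x. x \<in> frags (carrier G \<times> {..<r 0}) \<Longrightarrow> \<epsilon>' (f 0 x) = \<epsilon> x"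
      "\<And>i x. x \<in> frags (carrier G \<times> {..<r (Suc i)}) \<Longrightarrow> d' i (f (Suc i) x) = f i (d i x)"
proof -
  note D = perm_resolutionD[OF R] and D' = perm_resolutionD[OF R']
  \<comment> \<open>The last clause of \<open>P\<close> records that the lifting problem in the next
    degree is solvable, so that the recursive choice can continue.\<close>
  define P where "P i f \<longleftrightarrow> modmap G (r i) (r' i) f \<and>
      (i = 0 \<longrightarrow> (\<forall>x\<in>frags (carrier G \<times> {..<r 0}). \<epsilon>' (f x) = \<epsilon> x)) \<and>
      (\<forall>x\<in>frags (carrier G \<times> {..<r (Suc i)}). f (d i x) \<in> d' i ` frags (carrier G \<times> {..<r' (Suc i)}))" for i f
  define Q where "Q i f f' \<longleftrightarrow> (\<forall>x\<in>frags (carrier G \<times> {..<r (Suc i)}). d' i (f' x) = f (d i x))" for i f f'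
  have "\<exists>f. \<forall>i. P i (f i) \<and> Q i (f i) (f (Suc i))"
  proof (rule dependent_nat_choice)
    obtain f where f: "modmap G (r 0) (r' 0) f"
      "\<And>x. x \<in> frags (carrier G \<times> {..<r 0}) \<Longrightarrow> \<epsilon>' (f x) = \<epsilon> x"
      by (rule modmap_lift[where \<alpha> = "\<lambda>g x. x", OF D'(1) D'(2) D(1) D(2)]) (simp_all only: D'(3) UNIV_I)
    have im: "f (d 0 x) \<in> d' 0 ` frags (carrier G \<times> {..<r' (Suc 0)})" if x: "x \<in> frags (carrier G \<times> {..<r (Suc 0)})" for x
      by (rule D'(9)[OF modmap_in[OF f(1) D(5)[OF x]]]) (simp only: f(2)[OF D(5)[OF x]] D(7)[OF x])
    have "P 0 f" unfolding P_def by (intro conjI impI ballI f im)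
    then show "\<exists>f. P 0 f" by (intro exI[where x = f])
  next
    fix f i assume P: "P i f"
    note f = P[unfolded P_def, THEN conjunct1]
    note im = P[unfolded P_def, THEN conjunct2, THEN conjunct2, rule_format]
    note fd = modmap_comp[OF free_resolution_d[OF R] f]
    obtain f' where f': "modmap G (r (Suc i)) (r' (Suc i)) f'"
      "\<And>x. x \<in> frags (carrier G \<times> {..<r (Suc i)}) \<Longrightarrow> d' i (f' x) = f (d i x)"
      by (rule modmap_lift[where \<alpha> = "perm_act (translate G)", OF D'(4) D'(6) modmap_lin[OF fd] modmap_act[OF fd] im]) (assumption+, rule that, assumption, simp only:)
    have "f' (d (Suc i) x) \<in> d' (Suc i) ` frags (carrier G \<times> {..<r' (Suc (Suc i))})"
      if x: "x \<in> frags (carrier G \<times> {..<r (Suc (Suc i))})" for x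
      by (rule D'(10)[OF modmap_in[OF f'(1) D(5)[OF x]]])
        (simp only: f'(2)[OF D(5)[OF x]] D(8)[OF x] lin_0[OF modmap_lin[OF f]])
    note im' = this
    have "P (Suc i) f'"
      unfolding P_def by (intro conjI ballI impI f'(1) im') (simp_all only: nat.distinct)
    moreover have "Q i f f'"
      unfolding Q_def by (intro ballI f'(2))
    ultimately
    show "\<exists>f'. P (Suc i) f' \<and> Q i f f'" by blast
  qed
  then obtain f where f: "\<And>i. P i (f i)" "\<And>i. Q i (f i) (f (Suc i))" by metis
  show ?thesis
  proof (rule that)
    show "modmap G (r i) (r' i) (f i)" for i by (rule f(1)[unfolded P_def, THEN conjunct1])
    show "\<epsilon>' (f 0 x) = \<epsilon> x" if "x \<in> frags (carrier G \<times> {..<r 0})" for x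
      by (rule f(1)[of 0, unfolded P_def, THEN conjunct2, THEN conjunct1, rule_format, OF refl that])
    show "d' i (f (Suc i) x) = f i (d i x)" if "x \<in> frags (carrier G \<times> {..<r (Suc i)})" for i x
      by (rule f(2)[unfolded Q_def, rule_format, OF that])
  qed
qed

text \<open>A chain map inducing zero on the integers is null-homotopic; the sign convention is
  \<open>d h + h d = w\<close>.\<close>

lemma (in group) homotopy_exists:
  assumes R: "free_resolution G r \<epsilon> d" and w: "\<And>i. modmap G (r i) (r i) (w i)"
    and w0: "\<And>x. x\<in>frags (carrier G \<times> {..<r 0}) \<Longrightarrow> \<epsilon> (w 0 x) = 0"
    and wd: "\<And>i x. x\<in>frags (carrier G \<times> {..<r (Suc i)}) \<Longrightarrow> d i (w (Suc i) x) = w i (d i x)"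
  obtains h where "\<And>i. modmap G (r i) (r (Suc i)) (h i)"
      "\<And>x. x \<in> frags (carrier G \<times> {..<r 0}) \<Longrightarrow> d 0 (h 0 x) = w 0 x"
      "\<And>i x. x \<in> frags (carrier G \<times> {..<r (Suc i)}) \<Longrightarrow> d (Suc i) (h (Suc i) x) = w (Suc i) x - h i (d i x)"
proof -
  note D = perm_resolutionD[OF R] and dm = free_resolution_d[OF R]
  define P where "P i h \<longleftrightarrow> modmap G (r i) (r (Suc i)) h \<and>
      (i = 0 \<longrightarrow> (\<forall>x\<in>frags (carrier G \<times> {..<r 0}). d 0 (h x) = w 0 x)) \<and>
      (\<forall>x\<in>frags (carrier G \<times> {..<r (Suc i)}). w (Suc i) x - h (d i x) \<in> d (Suc i) ` frags (carrier G \<times> {..<r (Suc (Suc i))}))" for i h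
  define Q where "Q i h h' \<longleftrightarrow> (\<forall>x\<in>frags (carrier G \<times> {..<r (Suc i)}). d (Suc i) (h' x) = w (Suc i) x - h (d i x))" for i h h'
  \<comment> \<open>\<open>w - h d\<close> takes values in cycles, hence in boundaries by exactness;
    this is what the next lift needs.\<close>
  have in_im: "w (Suc i) x - h (d i x) \<in> d (Suc i) ` frags (carrier G \<times> {..<r (Suc (Suc i))})"
    if h: "modmap G (r i) (r (Suc i)) h" and x: "x \<in> frags (carrier G \<times> {..<r (Suc i)})"
      and dh: "d i (h (d i x)) = w i (d i x)" for i h x
  proof (rule D(10))
    note 1 = modmap_in[OF w x] modmap_in[OF h D(5)[OF x]]
    show "w (Suc i) x - h (d i x) \<in> frags (carrier G \<times> {..<r (Suc i)})" by (rule Fr_diff[OF 1])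
    show "d i (w (Suc i) x - h (d i x)) = 0"
      by (simp only: lin_diff[OF D(4) 1] wd[OF x] dh diff_self)
  qed
  have "\<exists>h. \<forall>i. P i (h i) \<and> Q i (h i) (h (Suc i))"
  proof (rule dependent_nat_choice)
    obtain h where h: "modmap G (r 0) (r (Suc 0)) h"
      "\<And>x. x \<in> frags (carrier G \<times> {..<r 0}) \<Longrightarrow> d 0 (h x) = w 0 x"
      by (rule modmap_lift[where \<alpha> = "perm_act (translate G)", OF D(4) D(6) modmap_lin[OF w] modmap_act[OF w]
            D(9)[OF modmap_in[OF w] w0]]) (assumption+, rule that, assumption, simp only:)
    have im: "w (Suc 0) x - h (d 0 x) \<in> d (Suc 0) ` frags (carrier G \<times> {..<r (Suc (Suc 0))})"
      if x: "x \<in> frags (carrier G \<times> {..<r (Suc 0)})" for x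
      by (rule in_im[OF h(1) x h(2)[OF D(5)[OF x]]])
    have "P 0 h" unfolding P_def by (intro conjI impI ballI h im)
    then show "\<exists>h. P 0 h" by (intro exI[where x = h])
  next
    fix h i assume P: "P i h"
    note h = P[unfolded P_def, THEN conjunct1]
    note im = P[unfolded P_def, THEN conjunct2, THEN conjunct2, rule_format]
    note fd = modmap_minus[OF w modmap_comp[OF dm h]]
    obtain h' where h': "modmap G (r (Suc i)) (r (Suc (Suc i))) h'"
      "\<And>x. x \<in> frags (carrier G \<times> {..<r (Suc i)}) \<Longrightarrow> d (Suc i) (h' x) = w (Suc i) x - h (d i x)"
      by (rule modmap_lift[where \<alpha> = "perm_act (translate G)", OF D(4) D(6) modmap_lin[OF fd] modmap_act[OF fd] im]) (assumption+, rule that, assumption, simp only:)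
    have "w (Suc (Suc i)) x - h' (d (Suc i) x) \<in> d (Suc (Suc i)) ` frags (carrier G \<times> {..<r (Suc (Suc (Suc i)))})"
      if x: "x \<in> frags (carrier G \<times> {..<r (Suc (Suc i))})" for x
      by (rule in_im[OF h'(1) x])
        (simp only: h'(2)[OF D(5)[OF x]] D(8)[OF x] lin_0[OF modmap_lin[OF h]] diff_zero)
    note im' = this
    have "P (Suc i) h'"
      unfolding P_def by (intro conjI ballI impI h'(1) im') (simp_all only: nat.distinct)
    moreover have "Q i h h'"
      unfolding Q_def by (intro ballI h'(2))
    ultimately
    show "\<exists>h'. P (Suc i) h' \<and> Q i h h'" by blast
  qed
  then obtain h where h: "\<And>i. P i (h i)" "\<And>i. Q i (h i) (h (Suc i))" by metis
  show ?thesis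
  proof (rule that)
    show "modmap G (r i) (r (Suc i)) (h i)" for i by (rule h(1)[unfolded P_def, THEN conjunct1])
    show "d 0 (h 0 x) = w 0 x" if "x \<in> frags (carrier G \<times> {..<r 0})" for x
      by (rule h(1)[of 0, unfolded P_def, THEN conjunct2, THEN conjunct1, rule_format, OF refl that])
    show "d (Suc i) (h (Suc i) x) = w (Suc i) x - h i (d i x)" if "x \<in> frags (carrier G \<times> {..<r (Suc i)})" for i x
      by (rule h(2)[unfolded Q_def, rule_format, OF that])
  qed
qed

text \<open>The trace of \<open>d h + h d\<close> telescopes in the alternating sum, so self-maps homotopic to the
  identity have the Euler characteristic as their Lefschetz number.\<close>

lemma (in group) trac_chain_map:
  assumes R: "free_resolution G r \<epsilon> d" and u: "\<And>i. modmap G (r i) (r i) (u i)"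
    and u0: "\<And>x. x\<in>frags (carrier G \<times> {..<r 0}) \<Longrightarrow> \<epsilon> (u 0 x) = \<epsilon> x"
    and ud: "\<And>i x. x\<in>frags (carrier G \<times> {..<r (Suc i)}) \<Longrightarrow> d i (u (Suc i) x) = u i (d i x)"
    and rM: "r (Suc M) = 0"
  shows "(\<Sum>i\<le>M. (- 1) ^ i * trac G (r i) (u i)) = (\<Sum>i\<le>M. (- 1) ^ i * int (r i))"
proof -
  note D = perm_resolutionD[OF R] and dm = free_resolution_d[OF R]
  define w where "w i x = u i x - x" for i x
  have w: "modmap G (r i) (r i) (w i)" for i
    using modmap_minus[OF u modmap_id] unfolding w_def .
  have w0: "\<epsilon> (w 0 x) = 0" if "x\<in>frags (carrier G \<times> {..<r 0})" for x
    unfolding w_def by (simp only: lin_diff[OF D(1) modmap_in[OF u that] that] u0[OF that] diff_self)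
  have wd: "d i (w (Suc i) x) = w i (d i x)" if "x\<in>frags (carrier G \<times> {..<r (Suc i)})" for i x
    unfolding w_def by (simp only: lin_diff[OF D(4) modmap_in[OF u that] that] ud[OF that])
  obtain h where h: "\<And>i. modmap G (r i) (r (Suc i)) (h i)"
    and h0: "\<And>x. x\<in>frags (carrier G \<times> {..<r 0}) \<Longrightarrow> d 0 (h 0 x) = w 0 x"
    and hd: "\<And>i x. x\<in>frags (carrier G \<times> {..<r (Suc i)}) \<Longrightarrow> d (Suc i) (h (Suc i) x) = w (Suc i) x - h i (d i x)"
    by (rule homotopy_exists[OF R w w0 wd]) (assumption | rule that | blast)+
  \<comment> \<open>Since the trace is commutative, \<open>t i\<close> is also the trace of
    \<open>h i\<close> after \<open>d i\<close> in degree \<open>i + 1\<close>. Each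
    \<open>t i\<close> thus enters two neighbouring degrees, with opposite signs.\<close>
  define t where "t i = trac G (r i) (\<lambda>x. d i (h i x))" for i
  have tw: "trac G (r i) (w i) = trac G (r i) (u i) - int (r i)" for i
    unfolding w_def using trac_diff[of G "r i" "u i" "\<lambda>x. x"] by (simp add: trac_id)
  have t0: "trac G (r 0) (w 0) = t 0"
    unfolding t_def by (rule trac_cong) (simp only: h0)
  have tS: "trac G (r (Suc i)) (w (Suc i)) = t (Suc i) + t i" for i
  proof -
    have "trac G (r (Suc i)) (w (Suc i)) = trac G (r (Suc i)) (\<lambda>x. d (Suc i) (h (Suc i) x) + h i (d i x))"
      by (rule trac_cong) (simp only: hd diff_add_cancel)
    then show ?thesis using trac_comm[OF h[of i] dm[of i]]
      unfolding t_def trac_add by simp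
  qed
  have "(\<Sum>i\<le>m. (- 1) ^ i * trac G (r i) (w i)) = (- 1) ^ m * t m" for m
    by (induction m) (simp_all add: t0 tS algebra_simps)
  \<comment> \<open>The one term that survives the telescoping can be computed on the module of rank
    \<open>r (Suc M) = 0\<close>.\<close>
  moreover have "t M = 0"
    using trac_comm[OF h[of M] dm[of M]] rM by (simp add: t_def trac_def)
  ultimately have "(\<Sum>i\<le>M. (- 1) ^ i * trac G (r i) (w i)) = 0" by simp
  then show ?thesis by (simp add: tw algebra_simps sum_subtractf)
qed

lemma alternating_sum_pad:
  assumes "\<forall>i>N. r i = 0" "N \<le> M"
  shows "(\<Sum>i\<le>M. (- 1) ^ i * int (r i)) = (\<Sum>i\<le>N. (- 1) ^ i * int (r i))"
  by (rule sum.mono_neutral_right) (use assms in auto)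

lemma (in group) euler_char_unique:
  assumes "finite_free_resolution G N r" "finite_free_resolution G N' r'"
  shows "(\<Sum>i\<le>N. (- 1) ^ i * int (r i)) = (\<Sum>i\<le>N'. (- 1) ^ i * int (r' i))"
proof -
  obtain \<epsilon> d \<epsilon>' d' where R: "free_resolution G r \<epsilon> d" and R': "free_resolution G r' \<epsilon>' d'"
    and N: "\<forall>i>N. r i = 0" "\<forall>i>N'. r' i = 0"
    using assms unfolding finite_free_resolution_iff by blast
  note D = perm_resolutionD[OF R] and D' = perm_resolutionD[OF R']
  obtain f where f: "\<And>i. modmap G (r i) (r' i) (f i)"
      "\<And>x. x\<in>frags (carrier G \<times> {..<r 0}) \<Longrightarrow> \<epsilon>' (f 0 x) = \<epsilon> x"
      "\<And>i x. x\<in>frags (carrier G \<times> {..<r (Suc i)}) \<Longrightarrow> d' i (f (Suc i) x) = f i (d i x)"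
    by (rule chain_map_exists[OF R R']) (rule that | blast)+
  obtain g where g: "\<And>i. modmap G (r' i) (r i) (g i)"
      "\<And>x. x\<in>frags (carrier G \<times> {..<r' 0}) \<Longrightarrow> \<epsilon> (g 0 x) = \<epsilon>' x"
      "\<And>i x. x\<in>frags (carrier G \<times> {..<r' (Suc i)}) \<Longrightarrow> d i (g (Suc i) x) = g i (d' i x)"
    by (rule chain_map_exists[OF R' R]) (rule that | blast)+
  \<comment> \<open>A common length, beyond which both resolutions vanish.\<close>
  define M where "M = max N N'"
  have rM: "r (Suc M) = 0" "r' (Suc M) = 0" using N unfolding M_def by auto
  have "(\<Sum>i\<le>N. (- 1) ^ i * int (r i)) = (\<Sum>i\<le>M. (- 1) ^ i * int (r i))"
    using alternating_sum_pad[OF N(1), of M] by (simp add: M_def)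
  also have "\<dots> = (\<Sum>i\<le>M. (- 1) ^ i * trac G (r i) (\<lambda>x. g i (f i x)))"
    by (rule trac_chain_map[OF R modmap_comp[OF f(1) g(1)] _ _ rM(1), symmetric])
      (simp_all only: f(2,3) g(2,3) modmap_in[OF f(1)])
  also have "\<dots> = (\<Sum>i\<le>M. (- 1) ^ i * trac G (r' i) (\<lambda>x. f i (g i x)))"
    by (simp only: trac_comm[OF f(1) g(1)])
  also have "\<dots> = (\<Sum>i\<le>M. (- 1) ^ i * int (r' i))"
    by (rule trac_chain_map[OF R' modmap_comp[OF g(1) f(1)] _ _ rM(2)])
      (simp_all only: f(2,3) g(2,3) modmap_in[OF g(1)])
  also have "\<dots> = (\<Sum>i\<le>N'. (- 1) ^ i * int (r' i))"
    using alternating_sum_pad[OF N(2), of M] by (simp add: M_def)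
  finally show ?thesis .
qed

lemma (in group) euler_char_FL_eq:
  assumes "finite_free_resolution G N r"
  shows "euler_char_FL G = (\<Sum>i\<le>N. (- 1) ^ i * int (r i))"
  unfolding euler_char_FL_def by (rule the_equality) (use assms euler_char_unique in blast)+

section \<open>Change of group\<close>

lemma perm_resolutionI:
  assumes "additive_on (E 0) \<epsilon>"
    "\<And>g x. g \<in> S \<Longrightarrow> x \<in> frags (E 0) \<Longrightarrow> \<epsilon> (perm_act \<alpha> g x) = \<epsilon> x"
    "\<epsilon> ` frags (E 0) = UNIV"
    "\<And>i. additive_on (E (Suc i)) (d i)"
    "\<And>i x. x \<in> frags (E (Suc i)) \<Longrightarrow> d i x \<in> frags (E i)"
    "\<And>i g x. g \<in> S \<Longrightarrow> x \<in> frags (E (Suc i)) \<Longrightarrow> d i (perm_act \<alpha> g x) = perm_act \<alpha> g (d i x)"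
    "\<And>x. x \<in> frags (E (Suc 0)) \<Longrightarrow> \<epsilon> (d 0 x) = 0"
    "\<And>i x. x \<in> frags (E (Suc (Suc i))) \<Longrightarrow> d i (d (Suc i) x) = 0"
    "\<And>x. x \<in> frags (E 0) \<Longrightarrow> \<epsilon> x = 0 \<Longrightarrow> x \<in> d 0 ` frags (E (Suc 0))"
    "\<And>i x. x \<in> frags (E (Suc i)) \<Longrightarrow> d i x = 0 \<Longrightarrow> x \<in> d (Suc i) ` frags (E (Suc (Suc i)))"
  shows "perm_resolution S \<alpha> E \<epsilon> d"
  unfolding perm_resolution_def
proof (intro conjI allI ballI)
  show "{x \<in> frags (E 0). \<epsilon> x = 0} = d 0 ` frags (E (Suc 0))"
    using assms(5,7,9) by (intro equalityI subsetI) (simp_all only: mem_Collect_eq, auto)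
  show "{x \<in> frags (E (Suc i)). d i x = 0} = d (Suc i) ` frags (E (Suc (Suc i)))" for i
    using assms(5,8,10) by (intro equalityI subsetI) (simp_all only: mem_Collect_eq, auto)
  show "d i ` frags (E (Suc i)) \<subseteq> frags (E i)" for i
    by (rule image_subsetI) (rule assms(5))
qed (fact assms)+

text \<open>The differentials are conjugated by the bijections of bases. The group may change along
  \<open>\<psi>\<close>, which covers restriction to a subgroup as well as transport along an
  isomorphism.\<close>

lemma perm_resolution_transport:
  assumes R: "perm_resolution S \<alpha> E \<epsilon> d"
    and \<beta>: "\<And>i. bij_betw (\<beta> i) (E' i) (E i)"
    and \<psi>: "\<And>g. g \<in> S' \<Longrightarrow> \<psi> g \<in> S"
    and act: "\<And>g i y. g \<in> S' \<Longrightarrow> y \<in> E' i \<Longrightarrow> \<alpha>' g y \<in> E' i"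
    and eqv: "\<And>g i y. g \<in> S' \<Longrightarrow> y \<in> E' i \<Longrightarrow> \<beta> i (\<alpha>' g y) = \<alpha> (\<psi> g) (\<beta> i y)"
  shows "\<exists>\<epsilon>' d'. perm_resolution S' \<alpha>' E' \<epsilon>' d'"
proof -
  note D = perm_resolutionD[OF R]
  define B where "B i = frag_extend (\<lambda>y. frag_of (\<beta> i y))" for i
  define C where "C i = frag_extend (\<lambda>x. frag_of (inv_into (E' i) (\<beta> i) x))" for i
  have bin: "\<beta> i y \<in> E i" if "y \<in> E' i" for i y using \<beta>[of i] that by (auto simp: bij_betw_def)
  have cin: "inv_into (E' i) (\<beta> i) x \<in> E' i" if "x \<in> E i" for i x
    using \<beta>[of i] that by (metis bij_betw_def inv_into_into)
  have Bin: "B i y \<in> frags (E i)" if "y \<in> frags (E' i)" for i y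
    unfolding B_def by (rule Fr_frag_extend[OF _ that]) (use bin in auto)
  have Cin: "C i y \<in> frags (E' i)" if "y \<in> frags (E i)" for i y
    unfolding C_def by (rule Fr_frag_extend[OF _ that]) (use cin in auto)
  have BC: "B i (C i x) = x" if "x \<in> frags (E i)" for i x
    by (rule lin_ext[OF _ lin_id _ that])
      (use \<beta>[of i] in \<open>auto simp: additive_on_def B_def C_def frag_extend_add bij_betw_inv_into_right\<close>)
  have CB: "C i (B i x) = x" if "x \<in> frags (E' i)" for i x
    by (rule lin_ext[OF _ lin_id _ that])
      (use \<beta>[of i] in \<open>auto simp: additive_on_def B_def C_def frag_extend_add bij_betw_inv_into_left\<close>)
  have linB: "additive_on T (B i)" and linC: "additive_on T' (C i)" for i T T'
    unfolding B_def C_def by (rule lin_frag_extend)+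
  have ain: "perm_act \<alpha>' g y \<in> frags (E' i)" if "g \<in> S'" "y \<in> frags (E' i)" for g y i
    by (rule perm_act_in[of "E' i"]) (use act that in auto)
  have Bact: "B i (perm_act \<alpha>' g y) = perm_act \<alpha> (\<psi> g) (B i y)" if "g \<in> S'" "y \<in> frags (E' i)" for g y i
    by (rule lin_ext[OF _ _ _ that(2)])
      (use eqv that in \<open>auto simp: additive_on_def B_def perm_act_def frag_extend_add\<close>)
  have Cact: "C i (perm_act \<alpha> (\<psi> g) x) = perm_act \<alpha>' g (C i x)" if g: "g \<in> S'" and x: "x \<in> frags (E i)" for g x i
    using CB[OF ain[OF g Cin[OF x]]] unfolding Bact[OF g Cin[OF x]] BC[OF x] .
  have im: "B i ` frags (E' i) = frags (E i)" for i
  proof (rule equalityI)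
    show "B i ` frags (E' i) \<subseteq> frags (E i)" by (rule image_subsetI) (rule Bin)
    show "frags (E i) \<subseteq> B i ` frags (E' i)"
    proof
      fix x assume x: "x \<in> frags (E i)"
      show "x \<in> B i ` frags (E' i)" by (rule image_eqI[of x "B i" "C i x"]) (simp_all only: BC[OF x] Cin[OF x])
    qed
  qed
  let ?e = "\<lambda>x. \<epsilon> (B 0 x)" and ?d = "\<lambda>i x. C i (d i (B (Suc i) x))"
  have "perm_resolution S' \<alpha>' E' ?e ?d"
  proof (rule perm_resolutionI)
    show "additive_on (E' 0) ?e" by (rule lin_comp[OF linB _ D(1)]) (simp only: im)
    show "\<epsilon> (B 0 (perm_act \<alpha>' g x)) = \<epsilon> (B 0 x)" if "g \<in> S'" "x \<in> frags (E' 0)" for g x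
      unfolding Bact[OF that] by (rule D(2)[OF \<psi>[OF that(1)] Bin[OF that(2)]])
    show "?e ` frags (E' 0) = UNIV"
      using D(3) unfolding im[of 0, symmetric] image_image .
    show "additive_on (E' (Suc i)) (?d i)" for i
      by (rule lin_comp[OF lin_comp[OF linB _ D(4)] _ linC]) (simp_all only: im order_refl, rule image_subsetI, rule D(5), rule Bin)
    show "?d i x \<in> frags (E' i)" if "x \<in> frags (E' (Suc i))" for i x by (rule Cin[OF D(5)[OF Bin[OF that]]])
    show "?d i (perm_act \<alpha>' g x) = perm_act \<alpha>' g (?d i x)" if "g \<in> S'" "x \<in> frags (E' (Suc i))" for i g x
      unfolding Bact[OF that] D(6)[OF \<psi>[OF that(1)] Bin[OF that(2)]]
      by (rule Cact[OF that(1) D(5)[OF Bin[OF that(2)]]])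
    show "?e (?d 0 x) = 0" if "x \<in> frags (E' (Suc 0))" for x
      unfolding BC[OF D(5)[OF Bin[OF that]]] by (rule D(7)[OF Bin[OF that]])
    show "?d i (?d (Suc i) x) = 0" if "x \<in> frags (E' (Suc (Suc i)))" for i x
      unfolding BC[OF D(5)[OF Bin[OF that]]] D(8)[OF Bin[OF that]] by (rule lin_0[OF linC])
    show "x \<in> ?d 0 ` frags (E' (Suc 0))" if x: "x \<in> frags (E' 0)" "?e x = 0" for x
    proof -
      obtain z where z: "z \<in> frags (E (Suc 0))" "B 0 x = d 0 z" using D(9)[OF Bin[OF x(1)] x(2)] by (elim imageE)
      have "?d 0 (C (Suc 0) z) = x" unfolding BC[OF z(1)] z(2)[symmetric] by (rule CB[OF x(1)])
      then show ?thesis using Cin[OF z(1)] by (metis imageI)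
    qed
    show "x \<in> ?d (Suc i) ` frags (E' (Suc (Suc i)))" if x: "x \<in> frags (E' (Suc i))" "?d i x = 0" for x i
    proof -
      have "d i (B (Suc i) x) = 0"
        using BC[OF D(5)[OF Bin[OF x(1)]]] unfolding x(2) by (simp add: lin_0[OF linB])
      from D(10)[OF Bin[OF x(1)] this]
      obtain z where z: "z \<in> frags (E (Suc (Suc i)))" "B (Suc i) x = d (Suc i) z" by (elim imageE)
      have "?d (Suc i) (C (Suc (Suc i)) z) = x" unfolding BC[OF z(1)] z(2)[symmetric] by (rule CB[OF x(1)])
      then show ?thesis using Cin[OF z(1)] by (metis imageI)
    qed
  qed
  then show ?thesis by (intro exI)
qed

text \<open>The bijection says that \<open>H\<close> acts freely on the cells and that
  \<open>R i\<close> represents the orbits; the permutation module on \<open>E i\<close> is then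
  free of rank \<open>card (R i)\<close>.\<close>

lemma finite_free_resolution_of_free_action:
  assumes H: "group H" and R: "perm_resolution S \<alpha> E \<epsilon> d"
    and \<psi>: "\<And>h. h \<in> carrier H \<Longrightarrow> \<psi> h \<in> S"
    and act: "\<And>h h' i x. h \<in> carrier H \<Longrightarrow> h' \<in> carrier H \<Longrightarrow> x \<in> E i \<Longrightarrow>
        \<alpha> (\<psi> (h \<otimes>\<^bsub>H\<^esub> h')) x = \<alpha> (\<psi> h) (\<alpha> (\<psi> h') x)"
    and R0: "\<And>i. finite (R i)" "\<And>i. R i \<subseteq> E i" "\<And>i. i > N \<Longrightarrow> R i = {}"
    and bij: "\<And>i. bij_betw (\<lambda>(h, x). \<alpha> (\<psi> h) x) (carrier H \<times> R i) (E i)"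
  shows "finite_free_resolution H N (\<lambda>i. card (R i))"
proof -
  interpret H: group H by fact
  obtain e where e: "\<And>i. bij_betw (e i) {..<card (R i)} (R i)"
    using ex_bij_betw_nat_finite[OF R0(1)] unfolding atLeast0LessThan by metis
  \<comment> \<open>The basis element \<open>(h, j)\<close> corresponds to the translate by
    \<open>h\<close> of the \<open>j\<close>-th orbit representative.\<close>
  define \<beta> where "\<beta> i = (\<lambda>(h, j). \<alpha> (\<psi> h) (e i j))" for i
  have "bij_betw ((\<lambda>(h, x). \<alpha> (\<psi> h) x) \<circ> map_prod id (e i)) (carrier H \<times> {..<card (R i)}) (E i)" for i
    by (rule bij_betw_trans[OF bij_betw_map_prod[OF bij_betw_id e] bij])
  moreover have "((\<lambda>(h, x). \<alpha> (\<psi> h) x) \<circ> map_prod id (e i)) = \<beta> i" for i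
    unfolding \<beta>_def by (rule ext) auto
  ultimately have \<beta>: "bij_betw (\<beta> i) (carrier H \<times> {..<card (R i)}) (E i)" for i by simp
  have "\<exists>\<epsilon>' d'. perm_resolution (carrier H) (translate H) (\<lambda>i. carrier H \<times> {..<card (R i)}) \<epsilon>' d'"
  proof (rule perm_resolution_transport[OF R \<beta> \<psi>])
    show "translate H g y \<in> carrier H \<times> {..<card (R i)}" if "g \<in> carrier H" "y \<in> carrier H \<times> {..<card (R i)}" for g i y
      using that by (rule H.translate_in)
    show "\<beta> i (translate H g y) = \<alpha> (\<psi> g) (\<beta> i y)" if gy: "g \<in> carrier H" "y \<in> carrier H \<times> {..<card (R i)}" for g i y
    proof -
      obtain h j where y: "y = (h, j)" "h \<in> carrier H" "j < card (R i)" using gy by auto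
      then have "e i j \<in> E i" using bij_betwE[OF e[of i]] R0(2)[of i] by auto
      then show ?thesis using act[OF that(1) y(2)] y by (simp add: \<beta>_def translate_def)
    qed
  qed
  then show ?thesis
    using R0(3) unfolding finite_free_resolution_iff by simp
qed

text \<open>Over \<open>H\<close> the group ring of \<open>G\<close> is free on \<open>T\<close>.
  The bijection contains the injectivity of \<open>\<psi>\<close>; the inclusion of a subgroup of
  finite index and an isomorphism, with \<open>T\<close> a single point, are both instances.\<close>

lemma finite_free_resolution_inj_hom:
  assumes H: "group H" and G: "group G" and \<psi>: "\<psi> \<in> hom H G"
    and T: "finite T" "T \<subseteq> carrier G"
      "bij_betw (\<lambda>(h, t). \<psi> h \<otimes>\<^bsub>G\<^esub> t) (carrier H \<times> T) (carrier G)"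
    and FL: "finite_free_resolution G N r"
  shows "finite_free_resolution H N (\<lambda>i. card T * r i)"
proof -
  interpret H: group H by fact
  interpret G: group G by fact
  obtain \<epsilon> d where R: "free_resolution G r \<epsilon> d" and N: "\<forall>i>N. r i = 0"
    using FL unfolding finite_free_resolution_iff by blast
  have \<psi>in: "\<psi> h \<in> carrier G" if "h \<in> carrier H" for h by (rule hom_in_carrier[OF \<psi> that])
  have "finite_free_resolution H N (\<lambda>i. card (T \<times> {..<r i}))"
  proof (rule finite_free_resolution_of_free_action[OF H R \<psi>in])
    fix h h' i x assume "h \<in> carrier H" "h' \<in> carrier H" "x \<in> carrier G \<times> {..<r i}"
    then show "translate G (\<psi> (h \<otimes>\<^bsub>H\<^esub> h')) x = translate G (\<psi> h) (translate G (\<psi> h') x)"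
      using \<psi>in by (auto simp: translate_def hom_mult[OF \<psi>] G.m_assoc)
  next
    fix i
    have inj: "h = h' \<and> t = t'"
      if "h \<in> carrier H" "t \<in> T" "h' \<in> carrier H" "t' \<in> T" "\<psi> h \<otimes>\<^bsub>G\<^esub> t = \<psi> h' \<otimes>\<^bsub>G\<^esub> t'" for h t h' t'
      using inj_onD[OF bij_betw_imp_inj_on[OF T(3)], of "(h, t)" "(h', t')"] that by simp
    have sur: "\<exists>h\<in>carrier H. \<exists>t\<in>T. g = \<psi> h \<otimes>\<^bsub>G\<^esub> t" if g: "g \<in> carrier G" for g
      using g unfolding bij_betw_imp_surj_on[OF T(3), symmetric] by auto
    show "bij_betw (\<lambda>(h, x). translate G (\<psi> h) x) (carrier H \<times> (T \<times> {..<r i})) (carrier G \<times> {..<r i})"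
      unfolding bij_betw_def
    proof
      show "inj_on (\<lambda>(h, x). translate G (\<psi> h) x) (carrier H \<times> (T \<times> {..<r i}))"
        by (rule inj_onI) (clarsimp simp: translate_def, rule inj)
      show "(\<lambda>(h, x). translate G (\<psi> h) x) ` (carrier H \<times> (T \<times> {..<r i})) = carrier G \<times> {..<r i}"
      proof (intro equalityI subsetI)
        fix p assume "p \<in> carrier G \<times> {..<r i}"
        then obtain g j where p: "p = (g, j)" "g \<in> carrier G" "j < r i" by auto
        from sur[OF p(2)] obtain h t where "h \<in> carrier H" "t \<in> T" "g = \<psi> h \<otimes>\<^bsub>G\<^esub> t" by auto
        then show "p \<in> (\<lambda>(h, x). translate G (\<psi> h) x) ` (carrier H \<times> (T \<times> {..<r i}))"
          using p by (intro image_eqI[of _ _ "(h, (t, j))"]) (auto simp: translate_def)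
      qed (use T(2) \<psi>in in \<open>auto simp: translate_def\<close>)
    qed
  qed (use T N in auto)
  then show ?thesis by (simp add: card_cartesian_product)
qed

lemma type_FL_inj_hom:
  assumes H: "group H" and G: "group G" and \<psi>: "\<psi> \<in> hom H G"
    and T: "finite T" "T \<subseteq> carrier G"
      "bij_betw (\<lambda>(h, t). \<psi> h \<otimes>\<^bsub>G\<^esub> t) (carrier H \<times> T) (carrier G)"
    and FL: "type_FL G"
  shows "type_FL H" "euler_char_FL H = int (card T) * euler_char_FL G"
proof -
  obtain N r where r: "finite_free_resolution G N r" using FL unfolding type_FL_def by blast
  note R = finite_free_resolution_inj_hom[OF H G \<psi> T r]
  then show "type_FL H" unfolding type_FL_def by blast
  show "euler_char_FL H = int (card T) * euler_char_FL G"
    unfolding group.euler_char_FL_eq[OF H R] group.euler_char_FL_eq[OF G r]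
    by (simp add: sum_distrib_left algebra_simps)
qed

section \<open>Indices of subgroups and independence of the rational characteristic\<close>

context group begin

lemma transversal_exists:
  assumes H: "subgroup H G" and fin: "finite (rcosets H)"
  obtains T where "T \<subseteq> carrier G" "finite T" "card T = card (rcosets H)"
    "bij_betw (\<lambda>(h, t). h \<otimes> t) (H \<times> T) (carrier G)"
proof -
  interpret H: subgroup H G by fact
  define s where "s c = (SOME g. g \<in> c)" for c :: "'a set"
  have s: "s c \<in> c" "s c \<in> carrier G" "H #> s c = c" if c: "c \<in> rcosets H" for c
  proof -
    show 1: "s c \<in> c" unfolding s_def using H.rcosets_non_empty[OF c] by (simp add: some_in_eq)
    show 2: "s c \<in> carrier G" using 1 H.rcosets_carrier[OF is_group c] by blast
    obtain g where g: "g \<in> carrier G" "c = H #> g" using c by (auto simp: RCOSETS_def)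
    show "H #> s c = c" using repr_independence[of "s c" H g] 1 g H by simp
  qed
  define T where "T = s ` (rcosets H)"
  have inj: "inj_on s (rcosets H)" by (rule inj_on_inverseI[of _ "\<lambda>g. H #> g"]) (use s in auto)
  show thesis
  proof (rule that)
    show "T \<subseteq> carrier G" "finite T" "card T = card (rcosets H)"
      unfolding T_def using s fin by (auto simp: card_image[OF inj])
    show "bij_betw (\<lambda>(h, t). h \<otimes> t) (H \<times> T) (carrier G)"
      unfolding bij_betw_def
    proof
      show "inj_on (\<lambda>(h, t). h \<otimes> t) (H \<times> T)"
      proof (rule inj_onI, clarify)
        fix h t h' t' assume h: "h \<in> H" "h' \<in> H" and t: "t \<in> T" "t' \<in> T" and e: "h \<otimes> t = h' \<otimes> t'"
        obtain c c' where c: "c \<in> rcosets H" "c' \<in> rcosets H" "t = s c" "t' = s c'"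
          using t unfolding T_def by blast
        have tc: "t \<in> carrier G" "t' \<in> carrier G" using c s by auto
        have "h \<otimes> t \<in> H #> t" "h' \<otimes> t' \<in> H #> t'" using h unfolding r_coset_def by auto
        then have "H #> t = H #> t'" using repr_independence[OF _ tc(1) H] repr_independence[OF _ tc(2) H] e by metis
        then have "c = c'" using c s by metis
        then have "t = t'" using c by simp
        then show "h = h' \<and> t = t'" using e h tc by simp
      qed
      show "(\<lambda>(h, t). h \<otimes> t) ` (H \<times> T) = carrier G"
      proof (intro equalityI subsetI)
        fix g assume g: "g \<in> carrier G"
        then have c: "H #> g \<in> rcosets H" using rcosetsI[OF H.subset] by blast
        have "g \<in> H #> s (H #> g)" using s(3)[OF c] rcos_self[OF g H] by simp
        then obtain h where "h \<in> H" "g = h \<otimes> s (H #> g)" unfolding r_coset_def by blast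
        then show "g \<in> (\<lambda>(h, t). h \<otimes> t) ` (H \<times> T)" using c unfolding T_def by force
      qed (use s in \<open>auto simp: T_def\<close>)
    qed
  qed
qed

text \<open>The representatives are indexed by \<open>I\<close>, so that a product of two
  transversals can be used with a product set as index set.\<close>

lemma index_of_transversal:
  assumes H: "subgroup H G" and "finite I" and \<tau>: "\<And>t. t \<in> I \<Longrightarrow> \<tau> t \<in> carrier G"
    and bij: "bij_betw (\<lambda>(h, t). h \<otimes> \<tau> t) (H \<times> I) (carrier G)"
  shows "finite (rcosets H)" "card (rcosets H) = card I"
proof -
  interpret H: subgroup H G by fact
  have "bij_betw (\<lambda>t. H #> \<tau> t) I (rcosets H)"
    unfolding bij_betw_def
  proof
    show "inj_on (\<lambda>t. H #> \<tau> t) I"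
    proof (rule inj_onI)
      fix t t' assume t: "t \<in> I" "t' \<in> I" "H #> \<tau> t = H #> \<tau> t'"
      then have "\<tau> t \<in> H #> \<tau> t'" using rcos_self[OF \<tau> H] by metis
      then obtain h where h: "h \<in> H" "\<tau> t = h \<otimes> \<tau> t'" unfolding r_coset_def by blast
      then have "(\<one>, t) = (h, t')"
        using t(1,2) \<tau> by (intro inj_onD[OF bij_betw_imp_inj_on[OF bij]]) (simp_all flip: h(2))
      then show "t = t'" by simp
    qed
    show "(\<lambda>t. H #> \<tau> t) ` I = rcosets H"
    proof (intro equalityI subsetI)
      fix c assume "c \<in> rcosets H"
      then obtain g where g: "g \<in> carrier G" "c = H #> g" by (auto simp: RCOSETS_def)
      then have "g \<in> (\<lambda>(h, t). h \<otimes> \<tau> t) ` (H \<times> I)" using bij by (simp add: bij_betw_def)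
      then obtain h t where ht: "h \<in> H" "t \<in> I" "g = h \<otimes> \<tau> t" by auto
      then have "g \<in> H #> \<tau> t" unfolding r_coset_def by blast
      then have "c = H #> \<tau> t" using repr_independence[OF _ \<tau>[OF ht(2)] H] g by simp
      then show "c \<in> (\<lambda>t. H #> \<tau> t) ` I" using ht by blast
    qed (use rcosetsI[OF H.subset] \<tau> in auto)
  qed
  then show "finite (rcosets H)" "card (rcosets H) = card I"
    using \<open>finite I\<close> by (auto simp: bij_betw_finite bij_betw_same_card)
qed

lemma index_trans:
  assumes H: "subgroup H G" and K: "subgroup K G" "K \<subseteq> H"
    and fin: "finite (rcosets H)" "finite (rcosets\<^bsub>G\<lparr>carrier := H\<rparr>\<^esub> K)"
  shows "finite (rcosets K)"
    "card (rcosets K) = card (rcosets\<^bsub>G\<lparr>carrier := H\<rparr>\<^esub> K) * card (rcosets H)"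
proof -
  let ?H = "G\<lparr>carrier := H\<rparr>"
  have gH: "group ?H" by (rule subgroup_imp_group[OF H])
  have KH: "subgroup K ?H" by (rule subgroup_incl[OF K(1) H K(2)])
  obtain T where T: "T \<subseteq> carrier G" "finite T" "card T = card (rcosets H)"
    "bij_betw (\<lambda>(h, t). h \<otimes> t) (H \<times> T) (carrier G)"
    using transversal_exists[OF H fin(1)] by blast
  obtain U where U: "U \<subseteq> H" "finite U" "card U = card (rcosets\<^bsub>?H\<^esub> K)"
    "bij_betw (\<lambda>(h, t). h \<otimes> t) (K \<times> U) H"
    using group.transversal_exists[OF gH KH fin(2)] by auto
  have HG: "H \<subseteq> carrier G" using H by (rule subgroup.subset)
  have b1: "bij_betw (map_prod (\<lambda>(h, t). h \<otimes> t) id) ((K \<times> U) \<times> T) (H \<times> T)"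
    by (rule bij_betw_map_prod[OF U(4) bij_betw_id])
  have b2: "bij_betw (\<lambda>(k, (u, t)). ((k, u), t)) (K \<times> (U \<times> T)) ((K \<times> U) \<times> T)"
    by (rule bij_betwI[of _ _ _ "\<lambda>((k, u), t). (k, (u, t))"]) auto
  have "bij_betw ((\<lambda>(h, t). h \<otimes> t) \<circ> (map_prod (\<lambda>(h, t). h \<otimes> t) id \<circ> (\<lambda>(k, (u, t)). ((k, u), t))))
      (K \<times> (U \<times> T)) (carrier G)"
    by (rule bij_betw_trans[OF bij_betw_trans[OF b2 b1] T(4)])
  then have "bij_betw (\<lambda>(k, p). k \<otimes> (fst p \<otimes> snd p)) (K \<times> (U \<times> T)) (carrier G)"
  proof (rule bij_betw_cong[THEN iffD1, rotated])
    fix x assume "x \<in> K \<times> (U \<times> T)"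
    then obtain k u t where x: "x = (k, (u, t))" "k \<in> K" "u \<in> U" "t \<in> T" by auto
    then have "k \<in> carrier G" "u \<in> carrier G" "t \<in> carrier G" using K(2) HG U(1) T(1) by blast+
    then show "((\<lambda>(h, t). h \<otimes> t) \<circ> (map_prod (\<lambda>(h, t). h \<otimes> t) id \<circ> (\<lambda>(k, (u, t)). ((k, u), t)))) x
        = (\<lambda>(k, p). k \<otimes> (fst p \<otimes> snd p)) x"
      using x(1) by (simp add: m_assoc)
  qed
  note b = this
  have *: "fst p \<otimes> snd p \<in> carrier G" if "p \<in> U \<times> T" for p
    using that U(1) HG T(1) by (intro m_closed) auto
  show "finite (rcosets K)"
    "card (rcosets K) = card (rcosets\<^bsub>G\<lparr>carrier := H\<rparr>\<^esub> K) * card (rcosets H)"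
    using index_of_transversal[OF K(1) _ * b] T U by (auto simp: card_cartesian_product)
qed

text \<open>The cosets of \<open>H \<inter> S\<close> in \<open>H\<close> embed into the cosets of
  \<open>S\<close> in the whole group by sending \<open>c\<close> to \<open>S <#> c\<close>.\<close>

lemma finite_index_Int:
  assumes H: "subgroup H G" and S: "subgroup S G" and fin: "finite (rcosets S)"
  shows "finite (rcosets\<^bsub>G\<lparr>carrier := H\<rparr>\<^esub> (H \<inter> S))"
proof -
  interpret H: subgroup H G by fact
  interpret S: subgroup S G by fact
  let ?R = "rcosets\<^bsub>G\<lparr>carrier := H\<rparr>\<^esub> (H \<inter> S)"
    have eq: "S <#> ((H \<inter> S) #> h) = S #> h" if "h \<in> H" for h
    proof (intro equalityI subsetI)
      fix x assume "x \<in> S <#> ((H \<inter> S) #> h)"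
      then obtain s s' where s: "s \<in> S" "s' \<in> S" "x = s \<otimes> (s' \<otimes> h)"
        unfolding set_mult_def r_coset_def by auto
      have "x = (s \<otimes> s') \<otimes> h" using that s by (simp add: m_assoc)
      then show "x \<in> S #> h" unfolding r_coset_def using S.m_closed[OF s(1,2)] by auto
    next
      fix x assume "x \<in> S #> h"
      then obtain s where s: "s \<in> S" "x = s \<otimes> h" unfolding r_coset_def by blast
      have "x = s \<otimes> (\<one> \<otimes> h)" using s that by simp
      moreover have "\<one> \<otimes> h \<in> (H \<inter> S) #> h"
        unfolding r_coset_def using H.one_closed S.one_closed by (intro UN_I[of \<one>]) simp_all
      ultimately show "x \<in> S <#> ((H \<inter> S) #> h)"
        unfolding set_mult_def using s(1) by (intro UN_I[of s] UN_I[of "\<one> \<otimes> h"]) simp_all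
    qed
    have inj: "(H \<inter> S) #> h = (H \<inter> S) #> h'" if h: "h \<in> H" "h' \<in> H" "S #> h = S #> h'" for h h'
    proof -
      have c: "h \<in> carrier G" "h' \<in> carrier G" using h(1,2) by simp_all
      have "h \<in> S #> h'" using rcos_self[OF c(1) S] h(3) by simp
      then obtain s where s: "s \<in> S" "h = s \<otimes> h'" unfolding r_coset_def by blast
      then have "s = h \<otimes> inv h'" using c by (simp add: m_assoc)
      then have "s \<in> H \<inter> S" using h(1,2) s(1) by simp
      then have "h \<in> (H \<inter> S) #> h'" using s(2) unfolding r_coset_def by blast
      from repr_independence[OF this c(2) subgroups_Inter_pair[OF H S]] show ?thesis by simp
    qed
    have rc: "\<exists>h\<in>H. c = (H \<inter> S) #> h" if "c \<in> ?R" for c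
      using that by (auto simp: RCOSETS_def r_coset_def)
    have sub: "(\<lambda>c. S <#> c) ` ?R \<subseteq> rcosets S"
    proof (rule image_subsetI)
      fix c assume "c \<in> ?R"
      from rc[OF this] obtain h where h: "h \<in> H" "c = (H \<inter> S) #> h" by blast
      show "S <#> c \<in> rcosets S" unfolding h(2) eq[OF h(1)] by (rule rcosetsI[OF S.subset H.mem_carrier[OF h(1)]])
    qed
    have "inj_on (\<lambda>c. S <#> c) ?R"
    proof (rule inj_onI)
      fix c c' assume c: "c \<in> ?R" "c' \<in> ?R" and e: "S <#> c = S <#> c'"
      obtain h where h: "h \<in> H" "c = (H \<inter> S) #> h" using rc[OF c(1)] by blast
      obtain h' where h': "h' \<in> H" "c' = (H \<inter> S) #> h'" using rc[OF c(2)] by blast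
      show "c = c'" using inj[OF h(1) h'(1)] e unfolding h(2) h'(2) eq[OF h(1)] eq[OF h'(1)] .
    qed
    then show ?thesis using finite_subset[OF sub fin] by (rule finite_imageD[rotated])
qed

lemma torsion_free_subset:
  assumes "torsion_free (G\<lparr>carrier := H\<rparr>)" "K \<subseteq> H"
  shows "torsion_free (G\<lparr>carrier := K\<rparr>)"
  using assms unfolding torsion_free_def by (auto simp: nat_pow_def)

lemma type_FL_finite_index:
  assumes K: "subgroup K G" and fin: "finite (rcosets K)" and FL: "type_FL G"
  shows "type_FL (G\<lparr>carrier := K\<rparr>)"
    "euler_char_FL (G\<lparr>carrier := K\<rparr>) = int (card (rcosets K)) * euler_char_FL G"
proof -
  obtain T where T: "T \<subseteq> carrier G" "finite T" "card T = card (rcosets K)"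
    "bij_betw (\<lambda>(h, t). h \<otimes> t) (K \<times> T) (carrier G)"
    using transversal_exists[OF K fin] by blast
  have hom: "id \<in> hom (G\<lparr>carrier := K\<rparr>) G"
    using subgroup.subset[OF K] by (auto simp: hom_def)
  have bij: "bij_betw (\<lambda>(h, t). id h \<otimes> t) (carrier (G\<lparr>carrier := K\<rparr>) \<times> T) (carrier G)"
    using T(4) by simp
  note R = type_FL_inj_hom[OF subgroup_imp_group[OF K] is_group hom T(2,1) bij FL]
  show "type_FL (G\<lparr>carrier := K\<rparr>)" by (rule R)
  show "euler_char_FL (G\<lparr>carrier := K\<rparr>) = int (card (rcosets K)) * euler_char_FL G"
    using R(2) T(3) by simp
qed

text \<open>Shrinking \<open>H\<close> to \<open>H \<inter> S\<close> multiplies characteristic and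
  index by the same factor, the index of \<open>H \<inter> S\<close> in \<open>H\<close>. Two
  subgroups that compute the rational characteristic are compared through their
  intersection.\<close>

lemma euler_subgroup_Int:
  assumes H: "euler_subgroup H G" and S: "subgroup S G" "finite (rcosets S)"
  shows "euler_subgroup (H \<inter> S) G"
    "of_int (euler_char_FL (G\<lparr>carrier := H \<inter> S\<rparr>)) / of_nat (card (rcosets (H \<inter> S))) =
     (of_int (euler_char_FL (G\<lparr>carrier := H\<rparr>)) / of_nat (card (rcosets H)) :: rat)"
proof -
  let ?H = "G\<lparr>carrier := H\<rparr>" and ?K = "H \<inter> S"
  have H': "subgroup H G" "finite (rcosets H)" "torsion_free ?H" "type_FL ?H"
    using H unfolding euler_subgroup_def by auto
  have K: "subgroup ?K G" by (rule subgroups_Inter_pair[OF H'(1) S(1)])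
  have KH: "subgroup ?K ?H" by (rule subgroup_incl[OF K H'(1)]) simp
  have gH: "group ?H" by (rule subgroup_imp_group[OF H'(1)])
  have fK: "finite (rcosets\<^bsub>?H\<^esub> ?K)" by (rule finite_index_Int[OF H'(1) S])
  note I = index_trans[OF H'(1) K _ H'(2) fK]
  note F = group.type_FL_finite_index[OF gH KH fK H'(4)]
  show "euler_subgroup ?K G"
    unfolding euler_subgroup_def using K I(1) torsion_free_subset[OF H'(3)] F(1) by simp
  have "card (rcosets\<^bsub>?H\<^esub> ?K) \<noteq> 0"
    using fK subgroup.subgroup_in_rcosets[OF KH gH] by auto
  then show "of_int (euler_char_FL (G\<lparr>carrier := ?K\<rparr>)) / of_nat (card (rcosets ?K)) =
     (of_int (euler_char_FL ?H) / of_nat (card (rcosets H)) :: rat)"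
    using F(2) I(2) by simp
qed

lemma euler_char_eq:
  assumes H: "euler_subgroup H G"
  shows "euler_char G = of_int (euler_char_FL (G\<lparr>carrier := H\<rparr>)) / of_nat (card (rcosets H))"
  unfolding euler_char_def
proof (rule the_equality)
  show "\<exists>H'. euler_subgroup H' G \<and> of_int (euler_char_FL (G\<lparr>carrier := H\<rparr>)) / of_nat (card (rcosets H)) =
      (of_int (euler_char_FL (G\<lparr>carrier := H'\<rparr>)) / of_nat (card (rcosets H')) :: rat)"
    using H by blast
  fix c :: rat
  assume "\<exists>H'. euler_subgroup H' G \<and> c = of_int (euler_char_FL (G\<lparr>carrier := H'\<rparr>)) / of_nat (card (rcosets H'))"
  then obtain H' where H': "euler_subgroup H' G"
    "c = of_int (euler_char_FL (G\<lparr>carrier := H'\<rparr>)) / of_nat (card (rcosets H'))" by blast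
  have S: "subgroup H G" "finite (rcosets H)" "subgroup H' G" "finite (rcosets H')"
    using H H' unfolding euler_subgroup_def by auto
  show "c = of_int (euler_char_FL (G\<lparr>carrier := H\<rparr>)) / of_nat (card (rcosets H))"
    using euler_subgroup_Int(2)[OF H S(3,4)] euler_subgroup_Int(2)[OF H'(1) S(1,2)]
    by (simp add: H'(2) Int_commute)
qed

text \<open>\<open>H \<inter> S\<close> computes both characteristics; the indices involved differ
  by the factor \<open>card (rcosets S)\<close>.\<close>

lemma euler_char_finite_index:
  assumes H: "euler_subgroup H G" and S: "subgroup S G" "finite (rcosets S)"
  shows "virtually_FL (G\<lparr>carrier := S\<rparr>)"
    "euler_char (G\<lparr>carrier := S\<rparr>) = of_nat (card (rcosets S)) * euler_char G"
proof -
  let ?S = "G\<lparr>carrier := S\<rparr>" and ?K = "H \<inter> S"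
  note E = euler_subgroup_Int[OF H S]
  have H': "subgroup H G" "finite (rcosets H)" using H unfolding euler_subgroup_def by auto
  have K: "subgroup ?K G" "torsion_free (G\<lparr>carrier := ?K\<rparr>)" "type_FL (G\<lparr>carrier := ?K\<rparr>)"
    using E(1) unfolding euler_subgroup_def by auto
  have KS: "subgroup ?K ?S" by (rule subgroup_incl[OF K(1) S(1)]) simp
  have gS: "group ?S" by (rule subgroup_imp_group[OF S(1)])
  have fK: "finite (rcosets\<^bsub>?S\<^esub> ?K)"
    using finite_index_Int[OF S(1) H'] by (simp add: Int_commute)
  note I = index_trans[OF S(1) K(1) _ S(2) fK]
  have ES: "euler_subgroup ?K ?S"
    unfolding euler_subgroup_def using KS fK K by simp
  then show "virtually_FL ?S" unfolding virtually_FL_def using gS by blast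
  have "card (rcosets S) \<noteq> 0"
    using S subgroup.subgroup_in_rcosets[OF S(1) is_group] by auto
  then show "euler_char ?S = of_nat (card (rcosets S)) * euler_char G"
    using group.euler_char_eq[OF gS ES] euler_char_eq[OF E(1)] I(2) by simp
qed

lemma finite_subgroup_torsion:
  assumes "subgroup A G" "finite A" "x \<in> A"
  shows "\<exists>k::nat. k > 0 \<and> x [^] k = \<one>"
proof -
  interpret A: group "G\<lparr>carrier := A\<rparr>" by (rule subgroup_imp_group[OF assms(1)])
  have "x [^]\<^bsub>G\<lparr>carrier := A\<rparr>\<^esub> order (G\<lparr>carrier := A\<rparr>) = \<one>"
    using A.pow_order_eq_1[of x] assms by simp
  moreover have "order (G\<lparr>carrier := A\<rparr>) > 0" using A.order_gt_0_iff_finite assms by simp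
  ultimately show ?thesis by (auto simp: nat_pow_def)
qed

lemma torsion_free_Int_finite:
  assumes tf: "torsion_free (G\<lparr>carrier := H\<rparr>)" and A: "subgroup A G" "finite A" and x: "x \<in> H" "x \<in> A"
  shows "x = \<one>"
  using finite_subgroup_torsion[OF A x(2)] tf x(1) unfolding torsion_free_def by (auto simp: nat_pow_def)

text \<open>A torsion-free \<open>H\<close> meets the finite kernel trivially, so
  \<open>\<phi>\<close> maps it isomorphically onto its image; passing to the image divides the
  index by the order of the kernel.\<close>

lemma euler_char_quotient:
  assumes Q: "group Q" and \<phi>: "\<phi> \<in> hom G Q" and surj: "\<phi> ` carrier G = carrier Q"
    and fin: "finite (kernel G Q \<phi>)" and H: "euler_subgroup H G"
  shows "virtually_FL Q" "euler_char Q = of_nat (card (kernel G Q \<phi>)) * euler_char G"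
proof -
  interpret \<phi>: group_hom G Q \<phi> by (intro group_hom.intro group_hom_axioms.intro is_group Q \<phi>)
  let ?N = "kernel G Q \<phi>" and ?H = "G\<lparr>carrier := H\<rparr>" and ?H' = "Q\<lparr>carrier := \<phi> ` H\<rparr>"
  have H': "subgroup H G" "finite (rcosets H)" "torsion_free ?H" "type_FL ?H"
    using H unfolding euler_subgroup_def by auto
  have HG: "H \<subseteq> carrier G" by (rule subgroup.subset[OF H'(1)])
  have N: "subgroup ?N G" by (rule \<phi>.subgroup_kernel)
  have triv: "h = \<one>" if "h \<in> H" "\<phi> h = \<one>\<^bsub>Q\<^esub>" for h
    using torsion_free_Int_finite[OF H'(3) N fin that(1)] that HG by (auto simp: kernel_def)
  have inj: "h = h'" if "h \<in> H" "h' \<in> H" "\<phi> h = \<phi> h'" for h h'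
  proof -
    have c: "h \<in> carrier G" "h' \<in> carrier G" using that HG by auto
    have "\<phi> (h \<otimes> inv h') = \<one>\<^bsub>Q\<^esub>" using c that(3) by simp
    then have "h \<otimes> inv h' = \<one>"
      using triv that subgroup.m_closed[OF H'(1)] subgroup.m_inv_closed[OF H'(1)] by blast
    then show ?thesis using c inv_solve_right'[of \<one> h h'] by simp
  qed
  have sH': "subgroup (\<phi> ` H) Q" by (rule \<phi>.subgroup_img_is_subgroup[OF H'(1)])
  have gH: "group ?H" by (rule subgroup_imp_group[OF H'(1)])
  have gH': "group ?H'" by (rule group.subgroup_imp_group[OF Q sH'])
  define \<psi> where "\<psi> = inv_into H \<phi>"
  have \<psi>: "\<psi> (\<phi> h) = h" if "h \<in> H" for h
    unfolding \<psi>_def by (rule inv_into_f_f[OF _ that]) (use inj in \<open>auto simp: inj_on_def\<close>)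
  have \<psi>hom: "\<psi> \<in> hom ?H' ?H"
  proof (rule homI)
    show "\<psi> x \<in> carrier ?H" if "x \<in> carrier ?H'" for x using that \<psi> by auto
    fix x y assume "x \<in> carrier ?H'" "y \<in> carrier ?H'"
    then obtain h h' where h: "h \<in> H" "h' \<in> H" "x = \<phi> h" "y = \<phi> h'" by auto
    have "x \<otimes>\<^bsub>Q\<^esub> y = \<phi> (h \<otimes> h')" using h HG by (simp add: subset_iff)
    then show "\<psi> (x \<otimes>\<^bsub>?H'\<^esub> y) = \<psi> x \<otimes>\<^bsub>?H\<^esub> \<psi> y"
      using h \<psi> subgroup.m_closed[OF H'(1)] by simp
  qed
  \<comment> \<open>The inverse isomorphism counts as an injective homomorphism with the one-element
    transversal \<open>{\<one>}\<close>.\<close>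
  have bij: "bij_betw (\<lambda>(h, t). \<psi> h \<otimes>\<^bsub>?H\<^esub> t) (carrier ?H' \<times> {\<one>}) (carrier ?H)"
    by (rule bij_betwI[of _ _ _ "\<lambda>h. (\<phi> h, \<one>)"]) (use \<psi> HG in auto)
  note FL = type_FL_inj_hom[OF gH' gH \<psi>hom _ _ bij H'(4)]
  have FL': "type_FL ?H'" "euler_char_FL ?H' = euler_char_FL ?H"
    using FL subgroup.one_closed[OF H'(1)] by auto
  have tf: "torsion_free ?H'"
    unfolding torsion_free_def
  proof (intro ballI allI impI)
    fix x and k :: nat assume "x \<in> carrier ?H'" "k > 0 \<and> x [^]\<^bsub>?H'\<^esub> k = \<one>\<^bsub>?H'\<^esub>"
    then obtain h where h: "h \<in> H" "x = \<phi> h" "k > 0" "\<phi> h [^]\<^bsub>Q\<^esub> k = \<one>\<^bsub>Q\<^esub>"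
      by (auto simp: nat_pow_def)
    have "\<phi> (h [^] k) = \<one>\<^bsub>Q\<^esub>" using h HG \<phi>.hom_nat_pow[of h k] by (simp add: subset_iff)
    moreover have "h [^] m \<in> H" for m :: nat
      by (induction m) (simp_all add: h(1) subgroup.one_closed[OF H'(1)] subgroup.m_closed[OF H'(1)])
    ultimately have "h [^] k = \<one>" by (rule triv[rotated])
    then have "h = \<one>" using H'(3) h unfolding torsion_free_def by (auto simp: nat_pow_def)
    then show "x = \<one>\<^bsub>?H'\<^esub>" using h by simp
  qed
  have "finite (rcosets\<^bsub>Q\<^esub> (\<phi> ` H)) \<and> card (rcosets H) = card ?N * card (rcosets\<^bsub>Q\<^esub> (\<phi> ` H))"
  proof -
    have fin': "finite (rcosets\<^bsub>Q\<^esub> (\<phi> ` H))"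
    proof (rule finite_surj[OF H'(2), of _ "\<lambda>c. \<phi> ` c"], rule subsetI)
      fix c assume "c \<in> rcosets\<^bsub>Q\<^esub> (\<phi> ` H)"
      then obtain q where q: "q \<in> carrier Q" "c = \<phi> ` H #>\<^bsub>Q\<^esub> q" by (auto simp: RCOSETS_def)
      then obtain g where g: "g \<in> carrier G" "q = \<phi> g" using surj by auto
      have "\<phi> ` (H #> g) = c" using g q HG by (auto simp: r_coset_def image_iff) (metis \<phi>.hom_mult subsetD)+
      then show "c \<in> (\<lambda>c. \<phi> ` c) ` (rcosets H)" using rcosetsI[OF HG g(1)] by blast
    qed
    obtain T where T: "T \<subseteq> carrier Q" "finite T" "card T = card (rcosets\<^bsub>Q\<^esub> (\<phi> ` H))"
      "bij_betw (\<lambda>(h, t). h \<otimes>\<^bsub>Q\<^esub> t) (\<phi> ` H \<times> T) (carrier Q)"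
      using group.transversal_exists[OF Q sH' fin'] by blast
    obtain \<tau> where \<tau>: "\<And>t. t \<in> T \<Longrightarrow> \<tau> t \<in> carrier G \<and> \<phi> (\<tau> t) = t"
      using T(1) unfolding surj[symmetric] by (metis (no_types, lifting) image_iff subsetD)
    have NG: "?N \<subseteq> carrier G" by (rule subgroup.subset[OF N])
    have N1: "\<phi> k = \<one>\<^bsub>Q\<^esub>" if "k \<in> ?N" for k using that by (simp add: kernel_def)
    \<comment> \<open>A transversal of \<open>H\<close> in the whole group: kernel elements times
      lifts \<open>\<tau> t\<close> of a transversal of the image of \<open>H\<close>.\<close>
    have bij: "bij_betw (\<lambda>(h, p). h \<otimes> (fst p \<otimes> \<tau> (snd p))) (H \<times> (?N \<times> T)) (carrier G)"
      unfolding bij_betw_def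
    proof
      show "inj_on (\<lambda>(h, p). h \<otimes> (fst p \<otimes> \<tau> (snd p))) (H \<times> (?N \<times> T))"
      proof (rule inj_onI, clarsimp)
        fix h k t h' k' t'
        assume h: "h \<in> H" "h' \<in> H" and k: "k \<in> ?N" "k' \<in> ?N" and t: "t \<in> T" "t' \<in> T"
          and e: "h \<otimes> (k \<otimes> \<tau> t) = h' \<otimes> (k' \<otimes> \<tau> t')"
        have c: "h \<in> carrier G" "h' \<in> carrier G" "k \<in> carrier G" "k' \<in> carrier G"
          "\<tau> t \<in> carrier G" "\<tau> t' \<in> carrier G" "t \<in> carrier Q" "t' \<in> carrier Q"
          using h k t HG NG \<tau> T(1) by auto
        have "\<phi> (h \<otimes> (k \<otimes> \<tau> t)) = \<phi> h \<otimes>\<^bsub>Q\<^esub> t" "\<phi> (h' \<otimes> (k' \<otimes> \<tau> t')) = \<phi> h' \<otimes>\<^bsub>Q\<^esub> t'"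
          using c N1 k \<tau> t by simp_all
        then have "(\<phi> h, t) = (\<phi> h', t')"
          using inj_onD[OF bij_betw_imp_inj_on[OF T(4)], of "(\<phi> h, t)" "(\<phi> h', t')"] e h t by simp
        then have 1: "h = h'" "t = t'" using inj h by auto
        then have "k = k'" using e c by simp
        with 1 show "h = h' \<and> k = k' \<and> t = t'" by blast
      qed
      show "(\<lambda>(h, p). h \<otimes> (fst p \<otimes> \<tau> (snd p))) ` (H \<times> (?N \<times> T)) = carrier G"
      proof (intro equalityI subsetI)
        fix g assume g: "g \<in> carrier G"
        then have "\<phi> g \<in> (\<lambda>(h, t). h \<otimes>\<^bsub>Q\<^esub> t) ` (\<phi> ` H \<times> T)"
          unfolding bij_betw_imp_surj_on[OF T(4)] by simp
        then obtain h t where ht: "h \<in> H" "t \<in> T" "\<phi> g = \<phi> h \<otimes>\<^bsub>Q\<^esub> t" by auto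
        have c: "h \<in> carrier G" "\<tau> t \<in> carrier G" "\<phi> (\<tau> t) = t" "t \<in> carrier Q" using ht HG \<tau> T(1) by auto
        define k where "k = inv h \<otimes> g \<otimes> inv (\<tau> t)"
        have kc: "k \<in> carrier G" using c g by (simp add: k_def)
        have "\<phi> k = inv\<^bsub>Q\<^esub> (\<phi> h) \<otimes>\<^bsub>Q\<^esub> (\<phi> h \<otimes>\<^bsub>Q\<^esub> t) \<otimes>\<^bsub>Q\<^esub> inv\<^bsub>Q\<^esub> t"
          using c g ht(3) by (simp add: k_def)
        also have "\<dots> = \<one>\<^bsub>Q\<^esub>" using c by (simp add: \<phi>.H.m_assoc[symmetric])
        finally have "k \<in> ?N" using kc by (simp add: kernel_def)
        moreover have "h \<otimes> (k \<otimes> \<tau> t) = g"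
          using c g by (simp add: k_def m_assoc[symmetric]) (simp add: m_assoc)
        ultimately show "g \<in> (\<lambda>(h, p). h \<otimes> (fst p \<otimes> \<tau> (snd p))) ` (H \<times> (?N \<times> T))"
          using ht by (intro image_eqI[of _ _ "(h, (k, t))"]) auto
      qed (use HG NG \<tau> in \<open>auto intro!: m_closed\<close>)
    qed
    have "fst p \<otimes> \<tau> (snd p) \<in> carrier G" if "p \<in> ?N \<times> T" for p using that NG \<tau> by (auto intro!: m_closed)
    from index_of_transversal(2)[OF H'(1) _ this bij] fin fin' T show ?thesis
      by (simp add: card_cartesian_product)
  qed
  then have I: "finite (rcosets\<^bsub>Q\<^esub> (\<phi> ` H))" "card (rcosets H) = card ?N * card (rcosets\<^bsub>Q\<^esub> (\<phi> ` H))" by auto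
  have E: "euler_subgroup (\<phi> ` H) Q"
    unfolding euler_subgroup_def using sH' I(1) tf FL'(1) by blast
  then show "virtually_FL Q" unfolding virtually_FL_def using Q by blast
  have "card ?N \<noteq> 0" using fin subgroup.one_closed[OF N] by auto
  then show "euler_char Q = of_nat (card ?N) * euler_char G"
    using group.euler_char_eq[OF Q E] euler_char_eq[OF H] I(2) FL'(2) by simp
qed

end

section \<open>Amalgams of finite groups\<close>

text \<open>Nonempty reduced words, growing to the left; the flag is \<open>True\<close> if the
  first letter comes from \<open>A\<close>. No letter lies in the intersection.\<close>

inductive alternating :: "('a, 'b) monoid_scheme \<Rightarrow> 'a set \<Rightarrow> 'a set \<Rightarrow> bool \<Rightarrow> 'a \<Rightarrow> bool"
  for G A B where
    left: "a \<in> A - B \<Longrightarrow> alternating G A B True a"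
  | right: "b \<in> B - A \<Longrightarrow> alternating G A B False b"
  | left_Cons: "alternating G A B False w \<Longrightarrow> a \<in> A - B \<Longrightarrow> alternating G A B True (a \<otimes>\<^bsub>G\<^esub> w)"
  | right_Cons: "alternating G A B True w \<Longrightarrow> b \<in> B - A \<Longrightarrow> alternating G A B False (b \<otimes>\<^bsub>G\<^esub> w)"

context group begin

lemma inv_cancel:
  assumes "x \<in> carrier G" "y \<in> carrier G"
  shows "inv x \<otimes> (x \<otimes> y) = y" "x \<otimes> (inv x \<otimes> y) = y"
  using assms by (simp_all add: m_assoc[symmetric])

lemma lcos_eq_iff:
  assumes A: "subgroup A G" and g: "g \<in> carrier G" "g' \<in> carrier G"
  shows "g <# A = g' <# A \<longleftrightarrow> inv g \<otimes> g' \<in> A"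
proof
  interpret A: subgroup A G by fact
  assume "g <# A = g' <# A"
  moreover have "g' \<in> g' <# A" using g by (force simp: l_coset_def)
  ultimately obtain a where "a \<in> A" "g' = g \<otimes> a" unfolding l_coset_def by auto
  then show "inv g \<otimes> g' \<in> A" using g by (simp add: m_assoc[symmetric])
next
  interpret A: subgroup A G by fact
  assume a: "inv g \<otimes> g' \<in> A"
  have "g' = g \<otimes> (inv g \<otimes> g')" using g by (simp add: m_assoc[symmetric])
  then have "g' \<in> g <# A" using a unfolding l_coset_def by blast
  then show "g <# A = g' <# A" using l_repr_independence[OF _ g(1) A] by simp
qed

lemma lcos_mult_eq:
  assumes A: "subgroup A G" and g: "g \<in> carrier G" "a \<in> A"
  shows "(g \<otimes> a) <# A = g <# A"
proof -
  have a: "a \<in> carrier G" using subgroup.mem_carrier[OF A g(2)] .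
  have "inv g \<otimes> (g \<otimes> a) = a" using g a by (simp add: m_assoc[symmetric])
  then show ?thesis using lcos_eq_iff[OF A g(1), of "g \<otimes> a"] g a by simp
qed

text \<open>Lets the end points \<open>g A\<close> and \<open>g B\<close> of the edge
  \<open>g C\<close> be read off from the coset alone, so that the boundary map needs no
  representatives.\<close>

lemma lcos_set_mult:
  assumes C: "subgroup C G" and A: "subgroup A G" and "C \<subseteq> A" and g: "g \<in> carrier G"
  shows "(g <# C) <#> A = g <# A"
proof -
  have "C <#> A = A"
  proof (intro equalityI subsetI)
    fix x assume "x \<in> A"
    then have "x = \<one> \<otimes> x" using subgroup.mem_carrier[OF A] by simp
    then show "x \<in> C <#> A" unfolding set_mult_def using \<open>x \<in> A\<close> subgroup.one_closed[OF C] by blast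
  next
    fix x assume "x \<in> C <#> A"
    then obtain c a where "c \<in> A" "a \<in> A" "x = c \<otimes> a" using \<open>C \<subseteq> A\<close> unfolding set_mult_def by blast
    then show "x \<in> A" using subgroup.m_closed[OF A] by simp
  qed
  then show ?thesis
    using setmult_lcos_assoc[OF subgroup.subset[OF C] subgroup.subset[OF A] g] by simp
qed

lemma conj_nat_pow:
  assumes "x \<in> carrier G" "c \<in> carrier G"
  shows "(x \<otimes> c \<otimes> inv x) [^] (k::nat) = x \<otimes> c [^] k \<otimes> inv x"
proof (induction k)
  case (Suc k)
  then show ?case using assms by (simp add: m_assoc inv_cancel)
qed (use assms in simp)

text \<open>Equivalently, a torsion-free \<open>H\<close> acts freely on the cosets of a finite
  \<open>A\<close>: the stabilizer of \<open>x A\<close> in \<open>H\<close> consists of conjugates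
  by \<open>x\<close> of elements of \<open>A\<close>.\<close>

lemma torsion_free_conj_finite:
  assumes tf: "torsion_free (G\<lparr>carrier := H\<rparr>)" and A: "subgroup A G" "finite A"
    and x: "x \<in> carrier G" "c \<in> A" "x \<otimes> c \<otimes> inv x \<in> H"
  shows "c = \<one>"
proof -
  have c: "c \<in> carrier G" using subgroup.mem_carrier[OF A(1) x(2)] .
  obtain k :: nat where k: "k > 0" "c [^] k = \<one>" using finite_subgroup_torsion[OF A x(2)] by blast
  have "(x \<otimes> c \<otimes> inv x) [^] k = \<one>" using conj_nat_pow[OF x(1) c, of k] k x(1) by simp
  then have "x \<otimes> c \<otimes> inv x = \<one>" using tf x(3) k(1) unfolding torsion_free_def by (auto simp: nat_pow_def)
  then have "x \<otimes> c = x" using inv_solve_right'[of \<one> "x \<otimes> c" x] x(1) c by simp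
  then show ?thesis using x(1) c by (simp add: l_cancel_one)
qed

lemma conj_eq_of_mult_eq:
  assumes c: "h \<in> carrier G" "h' \<in> carrier G" "x \<in> carrier G" "a \<in> carrier G" "a' \<in> carrier G"
    and e: "h \<otimes> (x \<otimes> a) = h' \<otimes> (x \<otimes> a')"
  shows "x \<otimes> (a' \<otimes> inv a) \<otimes> inv x = inv h' \<otimes> h"
proof -
  have "x \<otimes> (a' \<otimes> inv a) \<otimes> inv x = inv h' \<otimes> (h' \<otimes> (x \<otimes> a')) \<otimes> inv a \<otimes> inv x"
    using c by (simp add: m_assoc inv_cancel)
  also have "\<dots> = inv h' \<otimes> (h \<otimes> (x \<otimes> a)) \<otimes> inv a \<otimes> inv x" using e by simp
  also have "\<dots> = inv h' \<otimes> h" using c by (simp add: m_assoc inv_cancel)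
  finally show ?thesis .
qed

text \<open>\<open>R\<close> represents the double cosets of \<open>H\<close> and \<open>A\<close>.
  As \<open>H\<close> acts freely on the cosets of \<open>A\<close>, multiplication is a bijection
  from \<open>H \<times> R \<times> A\<close> onto the group; it yields the free orbits as well as
  the size of \<open>R\<close>.\<close>

lemma double_coset_transversal:
  assumes H: "subgroup H G" "finite (rcosets H)" "torsion_free (G\<lparr>carrier := H\<rparr>)"
    and A: "subgroup A G" "finite A"
  obtains R where "R \<subseteq> carrier G" "finite R" "card (rcosets H) = card R * card A"
    "bij_betw (\<lambda>(h, x). (h \<otimes> x) <# A) (H \<times> R) ((\<lambda>g. g <# A) ` carrier G)"
proof -
  interpret H: subgroup H G by fact
  interpret A: subgroup A G by fact
  define D where "D g = {h \<otimes> g \<otimes> a | h a. h \<in> H \<and> a \<in> A}" for g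
  have Dself: "g \<in> D g" if "g \<in> carrier G" for g
    unfolding D_def using that by (intro CollectI exI[of _ \<one>]) simp
  have Dsub: "D g' \<subseteq> D g" if g: "g \<in> carrier G" and g': "g' \<in> D g" for g g'
  proof
    fix y assume "y \<in> D g'"
    then obtain h' a' where h': "h' \<in> H" "a' \<in> A" "y = h' \<otimes> g' \<otimes> a'" unfolding D_def by auto
    obtain h a where ha: "h \<in> H" "a \<in> A" "g' = h \<otimes> g \<otimes> a" using g' unfolding D_def by auto
    note h = h' ha
    then have "y = (h' \<otimes> h) \<otimes> g \<otimes> (a \<otimes> a')" using g by (simp add: m_assoc)
    moreover have "h' \<otimes> h \<in> H" "a \<otimes> a' \<in> A" using h by simp_all
    ultimately show "y \<in> D g" unfolding D_def by (intro CollectI exI conjI)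
  qed
  have Dsym: "g \<in> D g'" if g: "g \<in> carrier G" and g': "g' \<in> D g" for g g'
  proof -
    obtain h a where h: "h \<in> H" "a \<in> A" "g' = h \<otimes> g \<otimes> a" using g' unfolding D_def by blast
    have "g = inv h \<otimes> g' \<otimes> inv a" using h g by (simp add: m_assoc inv_cancel)
    moreover have "inv h \<in> H" "inv a \<in> A" using h by simp_all
    ultimately show ?thesis unfolding D_def by (intro CollectI exI conjI)
  qed
  have Dcar: "D g \<subseteq> carrier G" if "g \<in> carrier G" for g
    unfolding D_def using that by auto
  have Deq: "D g' = D g" if g: "g \<in> carrier G" and g': "g' \<in> D g" for g g'
    using Dsub[OF g g'] Dsub[OF subsetD[OF Dcar[OF g] g'] Dsym[OF g g']] by (rule equalityI)
  define s where "s S = (SOME g. g \<in> S)" for S :: "'a set"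
  have sD: "s (D g) \<in> D g" if "g \<in> carrier G" for g
    unfolding s_def by (rule someI[of _ g]) (rule Dself[OF that])
  obtain T where T: "T \<subseteq> carrier G" "finite T" "bij_betw (\<lambda>(h, t). h \<otimes> t) (H \<times> T) (carrier G)"
    by (rule transversal_exists[OF H(1,2)])
  define R where "R = (\<lambda>t. s (D t)) ` T"
  have Rc: "R \<subseteq> carrier G" unfolding R_def using subsetD[OF Dcar sD] T(1) by auto
  have Rs: "s (D x) = x" if x: "x \<in> R" for x
  proof -
    obtain t where t: "t \<in> T" "x = s (D t)" using x unfolding R_def by blast
    then have "D x = D t" using Deq[of t x] sD[of t] T(1) by auto
    then show ?thesis using t by simp
  qed
  have inj: "h = h' \<and> x = x' \<and> a = a'"
    if h: "h \<in> H" "h' \<in> H" and x: "x \<in> R" "x' \<in> R" and a: "a \<in> A" "a' \<in> A"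
      and e: "h \<otimes> (x \<otimes> a) = h' \<otimes> (x' \<otimes> a')" for h h' x x' a a'
  proof -
    have xc: "x \<in> carrier G" "x' \<in> carrier G" using x Rc by blast+
    have "h \<otimes> (x \<otimes> a) \<in> D x" "h' \<otimes> (x' \<otimes> a') \<in> D x'"

      unfolding D_def using h a xc by (simp_all only: mem_Collect_eq m_assoc[symmetric] H.mem_carrier A.mem_carrier, blast+)
    then have "D x = D x'" using Deq[OF xc(1), of "h \<otimes> (x \<otimes> a)"] Deq[OF xc(2), of "h \<otimes> (x \<otimes> a)"] e by simp
    then have "s (D x') = s (D x)" by (simp only:)
    then have xx: "x' = x" unfolding Rs[OF x(1)] Rs[OF x(2)] .
    \<comment> \<open>An element of \<open>H\<close> that is conjugate to one of the finite group
      \<open>A\<close>, hence trivial.\<close>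
    have eq: "x \<otimes> (a' \<otimes> inv a) \<otimes> inv x = inv h' \<otimes> h"
      by (rule conj_eq_of_mult_eq[OF H.mem_carrier[OF h(1)] H.mem_carrier[OF h(2)] xc(1)
            A.mem_carrier[OF a(1)] A.mem_carrier[OF a(2)] e[unfolded xx]])
    then have "x \<otimes> (a' \<otimes> inv a) \<otimes> inv x \<in> H" using h by simp
    then have 1: "a' \<otimes> inv a = \<one>"
      by (rule torsion_free_conj_finite[OF H(3) A xc(1), rotated]) (use a in simp)
    have "a' = (a' \<otimes> inv a) \<otimes> a" using a by (simp add: m_assoc)
    then have aa: "a = a'" using a 1 by simp
    have "inv h' \<otimes> h = \<one>" using eq 1 xc by simp
    then have "h' \<otimes> (inv h' \<otimes> h) = h'" using h by simp
    then have "h = h'" using h by (simp add: inv_cancel)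
    with aa xx show ?thesis by blast
  qed
  have sur: "\<exists>h\<in>H. \<exists>x\<in>R. \<exists>a\<in>A. g = h \<otimes> (x \<otimes> a)" if g: "g \<in> carrier G" for g
  proof -
    obtain h t where ht: "h \<in> H" "t \<in> T" "g = h \<otimes> t"
      using g unfolding bij_betw_imp_surj_on[OF T(3), symmetric] by auto
    have tc: "t \<in> carrier G" using ht T(1) by blast
    have "t \<in> D (s (D t))" by (rule Dsym[OF tc sD[OF tc]])
    then obtain h' a where h': "h' \<in> H" "a \<in> A" "t = h' \<otimes> s (D t) \<otimes> a" unfolding D_def[of "s (D t)"] by blast
    have xR: "s (D t) \<in> R" unfolding R_def using ht by blast
    then have xc: "s (D t) \<in> carrier G" using Rc by blast
    have "g = h \<otimes> (h' \<otimes> s (D t) \<otimes> a)" using ht(3) h'(3) by simp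
    also have "\<dots> = (h \<otimes> h') \<otimes> (s (D t) \<otimes> a)" using ht(1) h'(1,2) xc by (simp add: m_assoc)
    finally show ?thesis using H.m_closed[OF ht(1) h'(1)] xR h'(2) by blast
  qed
  \<comment> \<open>Read with \<open>R \<times> A\<close> as index set, this is a transversal of
    \<open>H\<close>, which gives the index.\<close>
  have bij: "bij_betw (\<lambda>(h, p). h \<otimes> (fst p \<otimes> snd p)) (H \<times> (R \<times> A)) (carrier G)"
    unfolding bij_betw_def
  proof
    show "inj_on (\<lambda>(h, p). h \<otimes> (fst p \<otimes> snd p)) (H \<times> (R \<times> A))"
      by (rule inj_onI) (clarsimp, rule inj)
    show "(\<lambda>(h, p). h \<otimes> (fst p \<otimes> snd p)) ` (H \<times> (R \<times> A)) = carrier G"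
    proof (intro equalityI subsetI)
      fix g assume "g \<in> carrier G"
      then obtain h x a where "h \<in> H" "x \<in> R" "a \<in> A" "g = h \<otimes> (x \<otimes> a)" using sur by blast
      then show "g \<in> (\<lambda>(h, p). h \<otimes> (fst p \<otimes> snd p)) ` (H \<times> (R \<times> A))"
        by (intro image_eqI[of _ _ "(h, (x, a))"]) auto
    qed (use Rc in \<open>auto intro!: m_closed\<close>)
  qed
  have finR: "finite R" unfolding R_def using T(2) by simp
  have pc: "fst p \<otimes> snd p \<in> carrier G" if "p \<in> R \<times> A" for p using that Rc by (auto intro!: m_closed)
  have card: "card (rcosets H) = card R * card A"
    using index_of_transversal(2)[OF H(1) _ pc bij] finR A(2) by (simp add: card_cartesian_product)
  have "bij_betw (\<lambda>(h, x). (h \<otimes> x) <# A) (H \<times> R) ((\<lambda>g. g <# A) ` carrier G)"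
    unfolding bij_betw_def
  proof
    show "inj_on (\<lambda>(h, x). (h \<otimes> x) <# A) (H \<times> R)"
    proof (rule inj_onI, clarsimp)
      fix h x h' x' assume h: "h \<in> H" "h' \<in> H" and x: "x \<in> R" "x' \<in> R"
        and e: "(h \<otimes> x) <# A = (h' \<otimes> x') <# A"
      have c: "h \<in> carrier G" "h' \<in> carrier G" "x \<in> carrier G" "x' \<in> carrier G" using h x Rc by auto
      define a where "a = inv (h \<otimes> x) \<otimes> (h' \<otimes> x')"
      have a: "a \<in> A" using e c lcos_eq_iff[OF A(1), of "h \<otimes> x" "h' \<otimes> x'"] by (simp add: a_def)
      have "h \<otimes> (x \<otimes> a) = (h \<otimes> x) \<otimes> a" using c a by (simp add: m_assoc)
      also have "\<dots> = h' \<otimes> x'" unfolding a_def using c by (simp add: inv_cancel)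
      finally have "h \<otimes> (x \<otimes> a) = h' \<otimes> (x' \<otimes> \<one>)" using c by simp
      from inj[OF h x a _ this] show "h = h' \<and> x = x'" by simp
    qed
    show "(\<lambda>(h, x). (h \<otimes> x) <# A) ` (H \<times> R) = (\<lambda>g. g <# A) ` carrier G"
    proof (intro equalityI subsetI)
      fix S assume "S \<in> (\<lambda>g. g <# A) ` carrier G"
      then obtain g where g: "g \<in> carrier G" "S = g <# A" by blast
      obtain h x a where h: "h \<in> H" "x \<in> R" "a \<in> A" "g = h \<otimes> (x \<otimes> a)" using sur[OF g(1)] by blast
      have c: "h \<in> carrier G" "x \<in> carrier G" using h Rc by auto
      have "g = (h \<otimes> x) \<otimes> a" using h c by (simp add: m_assoc)
      then have "S = (h \<otimes> x) <# A" using g(2) lcos_mult_eq[OF A(1) _ h(3), of "h \<otimes> x"] c by simp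
      then show "S \<in> (\<lambda>(h, x). (h \<otimes> x) <# A) ` (H \<times> R)" using h by force
    next
      fix S assume "S \<in> (\<lambda>(h, x). (h \<otimes> x) <# A) ` (H \<times> R)"
      then obtain h x where h: "h \<in> H" "x \<in> R" "S = (h \<otimes> x) <# A" by auto
      then show "S \<in> (\<lambda>g. g <# A) ` carrier G" using Rc by auto
    qed
  qed
  from that[OF Rc finR card this] show thesis .
qed

end

section \<open>Chains on the Bass--Serre tree\<close>

lemma lookup_sum': "Poly_Mapping.lookup (\<Sum>i\<in>I. f i) v = (\<Sum>i\<in>I. Poly_Mapping.lookup (f i) v)"
  by (induction I rule: infinite_finite_induct) (simp_all add: lookup_add)

lemma lookup_frag_extend:
  "Poly_Mapping.lookup (frag_extend f c) v =
     (\<Sum>p\<in>Poly_Mapping.keys c. Poly_Mapping.lookup c p * Poly_Mapping.lookup (f p) v)"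
  unfolding frag_extend_def by (simp add: lookup_sum')

text \<open>The vertices of the Bass--Serre tree are the cosets of the two factors, its edges those of
  their intersection; the second components keep the three kinds of cosets apart.\<close>

definition tree_cells :: "('a, 'm) monoid_scheme \<Rightarrow> 'a set \<Rightarrow> 'a set \<Rightarrow> nat \<Rightarrow> ('a set \<times> nat) set" where
  "tree_cells G A B i =
     (if i = 0 then (\<lambda>g. (g <#\<^bsub>G\<^esub> A, 0)) ` carrier G \<union> (\<lambda>g. (g <#\<^bsub>G\<^esub> B, 1)) ` carrier G
      else if i = 1 then (\<lambda>g. (g <#\<^bsub>G\<^esub> (A \<inter> B), 2)) ` carrier G else {})"

definition coset_act :: "('a, 'm) monoid_scheme \<Rightarrow> 'a \<Rightarrow> 'a set \<times> nat \<Rightarrow> 'a set \<times> nat" where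
  "coset_act G h = (\<lambda>(S, j). (h <#\<^bsub>G\<^esub> S, j))"

definition tree_boundary :: "('a, 'm) monoid_scheme \<Rightarrow> 'a set \<Rightarrow> 'a set \<Rightarrow>
    ('a set \<times> nat \<Rightarrow>\<^sub>0 int) \<Rightarrow> ('a set \<times> nat \<Rightarrow>\<^sub>0 int)" where
  "tree_boundary G A B =
     frag_extend (\<lambda>(S, _). frag_of (S <#>\<^bsub>G\<^esub> A, 0) - frag_of (S <#>\<^bsub>G\<^esub> B, 1))"

text \<open>The sum of the coefficients, obtained by collapsing the basis to a point.\<close>

definition augmentation :: "('x \<Rightarrow>\<^sub>0 int) \<Rightarrow> int" where
  "augmentation x = Poly_Mapping.lookup (frag_extend (\<lambda>_. frag_of ()) x) ()"

lemma augmentation_simps: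
  "augmentation (x + y) = augmentation x + augmentation y"
  "augmentation (x - y) = augmentation x - augmentation y"
  "augmentation (frag_of p) = 1"
  "augmentation (frag_cmul k x) = k * augmentation x"
  by (simp_all add: augmentation_def frag_extend_add frag_extend_diff lookup_add lookup_minus frag_extend_cmul)

lemma alternating_swap: "alternating G A B s w \<Longrightarrow> alternating G B A (\<not> s) w"
  by (induction rule: alternating.induct) (auto intro: alternating.intros)

context group begin

lemma alternating_in_carrier:
  assumes "subgroup A G" "subgroup B G" "alternating G A B s w"
  shows "w \<in> carrier G"
  using assms(3) by (induction) (auto dest: subgroup.mem_carrier[OF assms(1)] subgroup.mem_carrier[OF assms(2)])

lemma mult_mem_Diff:
  assumes A: "subgroup A G" and B: "subgroup B G" and "c \<in> A \<inter> B" "a \<in> A - B"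
  shows "c \<otimes> a \<in> A - B"
proof
  have c: "c \<in> carrier G" "a \<in> carrier G" using assms subgroup.mem_carrier[OF A] by blast+
  show "c \<otimes> a \<in> A" using assms subgroup.m_closed[OF A] by blast
  show "c \<otimes> a \<notin> B"
  proof
    assume "c \<otimes> a \<in> B"
    then have "inv c \<otimes> (c \<otimes> a) \<in> B"
      using assms subgroup.m_closed[OF B] subgroup.m_inv_closed[OF B] by blast
    then show False using assms c by (simp add: inv_cancel)
  qed
qed

lemma alternating_mult_edge:
  assumes A: "subgroup A G" and B: "subgroup B G" and "alternating G A B s w" and c: "c \<in> A \<inter> B"
  shows "alternating G A B s (c \<otimes> w)"
  using assms(3)
proof cases
  case left
  then show ?thesis using mult_mem_Diff[OF A B c] alternating.left by metis
next
  case right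
  then show ?thesis using mult_mem_Diff[OF B A _ right(2)] c alternating.right[of "c \<otimes> w" B A G] by auto
next
  case (left_Cons v a)
  have "c \<otimes> w = (c \<otimes> a) \<otimes> v"
    using left_Cons(2,4) c alternating_in_carrier[OF A B left_Cons(3)] subgroup.mem_carrier[OF A] by (auto simp: m_assoc)
  then show ?thesis using alternating.left_Cons[OF left_Cons(3) mult_mem_Diff[OF A B c left_Cons(4)]] left_Cons(1) by simp
next
  case (right_Cons v b)
  have c': "c \<in> B \<inter> A" using c by blast
  have "c \<otimes> w = (c \<otimes> b) \<otimes> v"
    using right_Cons(2,4) c alternating_in_carrier[OF A B right_Cons(3)] subgroup.mem_carrier[OF B] by (auto simp: m_assoc)
  then show ?thesis using alternating.right_Cons[OF right_Cons(3) mult_mem_Diff[OF B A c' right_Cons(4)]] right_Cons(1) by simp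
qed

text \<open>The factor \<open>x\<close> is prepended as a new letter, merged with the first letter
  or absorbed by it; a merged letter that falls into the intersection is in turn absorbed by the
  rest of the word.\<close>

lemma alternating_mult:
  assumes A: "subgroup A G" and B: "subgroup B G" and x: "x \<in> A"
    and w: "w \<in> A \<inter> B \<or> (\<exists>s. alternating G A B s w)"
  shows "x \<otimes> w \<in> A \<inter> B \<or> (\<exists>s. alternating G A B s (x \<otimes> w))"
proof -
  have letter: "y \<in> A \<Longrightarrow> y \<in> A \<inter> B \<or> (\<exists>s. alternating G A B s y)" for y
    using alternating.left[of y A B G] by blast
  from w show ?thesis
  proof (elim disjE exE)
    assume "w \<in> A \<inter> B"
    then show ?thesis using x letter subgroup.m_closed[OF A] by blast
  next
    fix s assume s: "alternating G A B s w"
    show ?thesis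
    proof (cases "x \<in> B")
      case True
      then show ?thesis using alternating_mult_edge[OF A B s] x by blast
    next
      case False
      then have x': "x \<in> A - B" using x by simp
      from s show ?thesis
      proof cases
        case left
        then show ?thesis using x letter subgroup.m_closed[OF A] by blast
      next
        case right
        then show ?thesis using alternating.left_Cons[OF s[unfolded right(1)] x'] by (metis (full_types))
      next
        case (left_Cons v a)
        have "x \<otimes> w = (x \<otimes> a) \<otimes> v"
          using left_Cons(2,4) x alternating_in_carrier[OF A B left_Cons(3)] subgroup.mem_carrier[OF A] by (auto simp: m_assoc)
        moreover have "x \<otimes> a \<in> A" using x left_Cons(4) subgroup.m_closed[OF A] by blast
        ultimately show ?thesis
          using alternating_mult_edge[OF A B left_Cons(3), of "x \<otimes> a"] alternating.left_Cons[OF left_Cons(3), of "x \<otimes> a"]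
          by (cases "x \<otimes> a \<in> B") auto
      next
        case (right_Cons v b)
        then show ?thesis using alternating.left_Cons[OF s[unfolded right_Cons(1)] x'] by (metis (full_types))
      qed
    qed
  qed
qed

end

text \<open>An amalgamated product recognized inside a given group: \<open>gen\<close> makes the
  graph of cosets connected, and \<open>red\<close> excludes circuits.\<close>

locale reduced_amalgam = group G for G (structure) +
  fixes A B
  assumes A: "subgroup A G" and B: "subgroup B G"
    and gen: "generate G (A \<union> B) = carrier G"
    and red: "\<And>s w. alternating G A B s w \<Longrightarrow> w \<notin> A \<inter> B"
begin

abbreviation "C \<equiv> A \<inter> B"
abbreviation "bd \<equiv> tree_boundary G A B"
abbreviation "cells \<equiv> tree_cells G A B"

lemma C: "subgroup C G"
  by (rule subgroups_Inter_pair[OF A B])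

lemma boundary_edge:
  assumes "g \<in> carrier G"
  shows "bd (frag_of (g <# C, j)) = frag_of (g <# A, 0) - frag_of (g <# B, 1)"
  unfolding tree_boundary_def
  using lcos_set_mult[OF C A _ assms] lcos_set_mult[OF C B _ assms] by simp

lemma cells_0: "v \<in> cells 0 \<Longrightarrow> (\<exists>g\<in>carrier G. v = (g <# A, 0)) \<or> (\<exists>g\<in>carrier G. v = (g <# B, 1))"
  and cells_1: "v \<in> cells (Suc 0) \<Longrightarrow> \<exists>g\<in>carrier G. v = (g <# C, 2)"
  and cells_2: "cells (Suc (Suc i)) = {}"
  and in_cells: "g \<in> carrier G \<Longrightarrow> (g <# A, 0) \<in> cells 0" "g \<in> carrier G \<Longrightarrow> (g <# B, 1) \<in> cells 0"
    "g \<in> carrier G \<Longrightarrow> (g <# C, 2) \<in> cells (Suc 0)"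
  by (auto simp: tree_cells_def)

lemma coset_act_eq:
  assumes "h \<in> carrier G" "g \<in> carrier G"
  shows "coset_act G h (g <# A, j) = ((h \<otimes> g) <# A, j)" "coset_act G h (g <# B, j) = ((h \<otimes> g) <# B, j)"
    "coset_act G h (g <# C, j) = ((h \<otimes> g) <# C, j)"
  using lcos_m_assoc[OF subgroup.subset[OF A] assms] lcos_m_assoc[OF subgroup.subset[OF B] assms]
    lcos_m_assoc[OF subgroup.subset[OF C] assms]
  by (simp_all add: coset_act_def)

lemma boundary_in:
  assumes "x \<in> frags (cells (Suc 0))" shows "bd x \<in> frags (cells 0)"
  unfolding tree_boundary_def
proof (rule Fr_frag_extend[OF _ assms])
  fix p assume "p \<in> cells (Suc 0)"
  then obtain g where g: "g \<in> carrier G" "p = (g <# C, 2)" using cells_1 by blast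
  have "bd (frag_of p) \<in> frags (cells 0)"
    unfolding g(2) boundary_edge[OF g(1)] by (rule Fr_diff) (use in_cells g(1) in auto)
  then show "(case p of (S, _) \<Rightarrow> frag_of (S <#> A, 0) - frag_of (S <#> B, 1)) \<in> frags (cells 0)"
    by (simp only: tree_boundary_def frag_extend_of)
qed

lemma boundary_act:
  assumes h: "h \<in> carrier G" and x: "x \<in> frags (cells (Suc 0))"
  shows "bd (perm_act (coset_act G) h x) = perm_act (coset_act G) h (bd x)"
proof (rule lin_ext[OF _ _ _ x])
  show "additive_on (cells (Suc 0)) (\<lambda>x. bd (perm_act (coset_act G) h x))" "additive_on (cells (Suc 0)) (\<lambda>x. perm_act (coset_act G) h (bd x))"
    by (simp_all add: additive_on_def perm_act_add tree_boundary_def frag_extend_add)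
  fix p assume "p \<in> cells (Suc 0)"
  then obtain g where g: "g \<in> carrier G" "p = (g <# C, 2)" using cells_1 by blast
  have 1: "perm_act (coset_act G) h (frag_of q) = frag_of (coset_act G h q)" for q
    by (simp add: perm_act_def)
  show "bd (perm_act (coset_act G) h (frag_of p)) = perm_act (coset_act G) h (bd (frag_of p))"
    using h g by (simp add: 1 coset_act_eq boundary_edge perm_act_diff)
qed

lemma augmentation_act: "augmentation (perm_act \<alpha> h x) = augmentation x"
proof -
  have "additive_on UNIV (\<lambda>x. augmentation (perm_act \<alpha> h x))" "additive_on UNIV augmentation"
    by (simp_all add: additive_on_def perm_act_add augmentation_simps)
  from lin_ext[OF this, of x] show ?thesis by (simp add: perm_act_def augmentation_simps)
qed

lemma augmentation_boundary: "augmentation (bd x) = 0"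
proof -
  have "additive_on UNIV (\<lambda>x. augmentation (bd x))" "additive_on UNIV (\<lambda>x. 0::int)"
    by (simp_all add: additive_on_def tree_boundary_def frag_extend_add augmentation_simps)
  from lin_ext[OF this, of x] show ?thesis
    by (simp add: tree_boundary_def augmentation_simps split: prod.splits)
qed

lemma boundary_image_add: "x \<in> bd ` frags (cells (Suc 0)) \<Longrightarrow> y \<in> bd ` frags (cells (Suc 0)) \<Longrightarrow> x + y \<in> bd ` frags (cells (Suc 0))"
  and boundary_image_diff: "x \<in> bd ` frags (cells (Suc 0)) \<Longrightarrow> y \<in> bd ` frags (cells (Suc 0)) \<Longrightarrow> x - y \<in> bd ` frags (cells (Suc 0))"
proof -
  assume "x \<in> bd ` frags (cells (Suc 0))" "y \<in> bd ` frags (cells (Suc 0))"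
  then obtain a b where "a \<in> frags (cells (Suc 0))" "b \<in> frags (cells (Suc 0))" "x = bd a" "y = bd b" by (elim imageE)
  then have "a + b \<in> frags (cells (Suc 0))" "a - b \<in> frags (cells (Suc 0))" "x + y = bd (a + b)" "x - y = bd (a - b)"
    using Fr_add[of a _ b] Fr_diff[of a _ b] by (simp_all add: tree_boundary_def frag_extend_add frag_extend_diff)
  then show "x + y \<in> bd ` frags (cells (Suc 0))" "x - y \<in> bd ` frags (cells (Suc 0))" by (simp_all only: imageI)
qed

lemma edge_in_image:
  assumes "g \<in> carrier G"
  shows "frag_of (g <# A, 0) - frag_of (g <# B, 1) \<in> bd ` frags (cells (Suc 0))"
  unfolding boundary_edge[OF assms, of 2, symmetric] by (rule imageI) (use in_cells(3)[OF assms] in simp)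

text \<open>A letter of \<open>A\<close> fixes the vertex \<open>g A\<close>, while a letter
  \<open>x\<close> of \<open>B\<close> leads from it to \<open>g x A\<close> over the two edges that
  meet in \<open>g B\<close>. Words in the generators therefore give paths.\<close>

lemma connected:
  assumes h: "h \<in> carrier G"
  shows "frag_of (h <# A, 0) - frag_of (\<one> <# A, 0) \<in> bd ` frags (cells (Suc 0))"
proof -
  let ?I = "bd ` frags (cells (Suc 0))"
  have zero: "0 \<in> ?I" by (rule image_eqI[of _ _ 0]) (simp_all add: tree_boundary_def)
  have step: "frag_of ((g \<otimes> x) <# A, 0) - frag_of (g <# A, 0) \<in> ?I" if "x \<in> A \<union> B" "g \<in> carrier G" for x g
  proof (cases "x \<in> A")
    case True then show ?thesis using lcos_mult_eq[OF A that(2)] zero by simp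
  next
    case False
    then have x: "x \<in> B" using that(1) by simp
    then have gx: "g \<otimes> x \<in> carrier G" using that(2) subgroup.mem_carrier[OF B] by simp
    have "(frag_of ((g \<otimes> x) <# A, 0) - frag_of ((g \<otimes> x) <# B, 1)) - (frag_of (g <# A, 0) - frag_of (g <# B, 1)) \<in> ?I"
      by (rule boundary_image_diff[OF edge_in_image[OF gx] edge_in_image[OF that(2)]])
    then show ?thesis by (simp add: lcos_mult_eq[OF B that(2) x])
  qed
  have AB: "A \<union> B \<subseteq> carrier G" using subgroup.subset[OF A] subgroup.subset[OF B] by simp
  have "\<forall>g\<in>carrier G. frag_of ((g \<otimes> h) <# A, 0) - frag_of (g <# A, 0) \<in> ?I"
    using h[folded gen]
  proof (induction rule: generate.induct)
    case one then show ?case using zero by simp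
  next
    case (incl h) then show ?case using step by blast
  next
    case (inv h)
    then have "inv h \<in> A \<union> B" using subgroup.m_inv_closed[OF A] subgroup.m_inv_closed[OF B] by blast
    then show ?case using step by blast
  next
    case (eng h1 h2)
    have c: "h1 \<in> carrier G" "h2 \<in> carrier G" using eng.hyps gen by auto
    show ?case
    proof
      fix g assume g: "g \<in> carrier G"
      have "(frag_of ((g \<otimes> h1 \<otimes> h2) <# A, 0) - frag_of ((g \<otimes> h1) <# A, 0)) +
          (frag_of ((g \<otimes> h1) <# A, 0) - frag_of (g <# A, 0)) \<in> ?I"
        by (rule boundary_image_add[OF eng.IH(2)[rule_format] eng.IH(1)[rule_format]]) (use g c in auto)
      then show "frag_of ((g \<otimes> (h1 \<otimes> h2)) <# A, 0) - frag_of (g <# A, 0) \<in> ?I"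
        using g c by (simp add: m_assoc)
    qed
  qed
  from bspec[OF this one_closed] show ?thesis using h by simp
qed

text \<open>Modulo boundaries every vertex equals the base vertex, so a 0-chain reduces to its
  augmentation times that vertex.\<close>

lemma kernel_augmentation:
  assumes x: "x \<in> frags (cells 0)" and "augmentation x = 0"
  shows "x \<in> bd ` frags (cells (Suc 0))"
proof -
  let ?I = "bd ` frags (cells (Suc 0))" and ?o = "frag_of (\<one> <# A, 0)"
  have zero: "0 \<in> ?I" by (rule image_eqI[of _ _ 0]) (simp_all add: tree_boundary_def)
  have "x - frag_cmul (augmentation x) ?o \<in> ?I"
    using x[simplified]
  proof (rule free_Abelian_group_induct)
    show "0 - frag_cmul (augmentation 0) ?o \<in> ?I" using zero by (simp add: augmentation_def)
  next
    fix x y assume "x - frag_cmul (augmentation x) ?o \<in> ?I" "y - frag_cmul (augmentation y) ?o \<in> ?I"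
    then have "(x - frag_cmul (augmentation x) ?o) - (y - frag_cmul (augmentation y) ?o) \<in> ?I"
      by (rule boundary_image_diff)
    then show "(x - y) - frag_cmul (augmentation (x - y)) ?o \<in> ?I"
      by (simp add: augmentation_simps frag_cmul_diff_distrib algebra_simps)
  next
    fix v assume "v \<in> cells 0"
    then consider g where "g \<in> carrier G" "v = (g <# A, 0)" | g where "g \<in> carrier G" "v = (g <# B, 1)"
      using cells_0 by blast
    then have "frag_of v - ?o \<in> ?I"
    proof cases
      case 1 then show ?thesis using connected by simp
    next
      case 2
      have "(frag_of (g <# A, 0) - ?o) - (frag_of (g <# A, 0) - frag_of (g <# B, 1)) \<in> ?I"
        by (rule boundary_image_diff[OF connected[OF 2(1)] edge_in_image[OF 2(1)]])
      then show ?thesis using 2 by simp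
    qed
    then show "frag_of v - frag_cmul (augmentation (frag_of v)) ?o \<in> ?I" by (simp add: augmentation_simps)
  qed
  then show ?thesis using assms(2) by simp
qed

text \<open>A cycle has no loose ends: were \<open>g C\<close> the only edge of the support at the
  vertex \<open>g D\<close>, the boundary would have a nonzero coefficient there. Any other edge at
  this vertex is \<open>g a C\<close> with \<open>a\<close> in \<open>D\<close> but outside the
  other factor.\<close>

lemma edge_continues:
  fixes j :: nat
  assumes x: "x \<in> frags (cells (Suc 0))" "bd x = 0" and g: "g \<in> carrier G" "(g <# C, 2) \<in> Poly_Mapping.keys x"
    and D: "D = A \<and> D' = B \<and> j = 0 \<or> D = B \<and> D' = A \<and> j = 1"
  shows "\<exists>a\<in>D - D'. ((g \<otimes> a) <# C, 2) \<in> Poly_Mapping.keys x"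
proof (rule ccontr)
  assume no: "\<not> ?thesis"
  have sD: "subgroup D G" "C \<subseteq> D" "D - D' = D - C" using D A B by auto
  let ?v = "(g <# D, j)" and ?p = "(g <# C, 2)"
  let ?f = "\<lambda>(S, _ :: nat). frag_of (S <#> A, 0::nat) - frag_of (S <#> B, 1)"
  have only: "Poly_Mapping.lookup (?f p) ?v = 0" if p: "p \<in> Poly_Mapping.keys x" "p \<noteq> ?p" for p
  proof -
    obtain g' where g': "g' \<in> carrier G" "p = (g' <# C, 2)" using x(1) p(1) cells_1 by blast
    have "g' <# D \<noteq> g <# D"
    proof
      assume e: "g' <# D = g <# D"
      define a where "a = inv g \<otimes> g'"
      have a: "a \<in> D" using e lcos_eq_iff[OF sD(1) g(1) g'(1)] by (simp add: a_def)
      have ga: "g \<otimes> a = g'" using g g' by (simp add: a_def inv_cancel)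
      show False
      proof (cases "a \<in> C")
        case True
        then have "p = ?p" using lcos_mult_eq[OF C g(1) True] ga g'(2) by simp
        then show False using p(2) by simp
      next
        case False
        then show False using no a sD(3) ga g' p(1) by auto
      qed
    qed
    moreover have "?f p = frag_of (g' <# A, 0) - frag_of (g' <# B, 1)"
      unfolding g'(2) using lcos_set_mult[OF C A _ g'(1)] lcos_set_mult[OF C B _ g'(1)] by simp
    ultimately show ?thesis using D by (auto simp: lookup_minus)
  qed
  have "?f ?p = frag_of (g <# A, 0) - frag_of (g <# B, 1)"
    using lcos_set_mult[OF C A _ g(1)] lcos_set_mult[OF C B _ g(1)] by simp
  then have one: "Poly_Mapping.lookup (?f ?p) ?v \<noteq> 0" using D by (auto simp: lookup_minus)
  have "0 = Poly_Mapping.lookup (bd x) ?v" using x(2) by simp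
  also have "\<dots> = (\<Sum>p\<in>Poly_Mapping.keys x. Poly_Mapping.lookup x p * Poly_Mapping.lookup (?f p) ?v)"
    unfolding tree_boundary_def by (rule lookup_frag_extend)
  also have "\<dots> = (\<Sum>p\<in>{?p}. Poly_Mapping.lookup x p * Poly_Mapping.lookup (?f p) ?v)"
    by (rule sum.mono_neutral_right) (use g(2) only in auto)
  also have "\<dots> \<noteq> 0" using one g(2) by (simp add: in_keys_iff)
  finally show False by simp
qed

text \<open>A cycle would contain an infinite path without backtracking that visits finitely many edges,
  that is, an alternating word in the edge group.\<close>

lemma boundary_inj:
  assumes x: "x \<in> frags (cells (Suc 0))" "bd x = 0"
  shows "x = 0"
proof (rule ccontr)
  assume "x \<noteq> 0"
  then have "Poly_Mapping.keys x \<noteq> {}" by simp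
  then obtain p where "p \<in> Poly_Mapping.keys x" by blast
  then obtain g0 where g0: "g0 \<in> carrier G" "(g0 <# C, 2) \<in> Poly_Mapping.keys x"
    using x(1) cells_1 by blast
  \<comment> \<open>The path runs through vertices of the two kinds in turn, so its letters are
    taken alternately from \<open>A\<close> and from \<open>B\<close>.\<close>
  define L where "L i = (if even i then A - B else B - A)" for i :: nat
  define P where "P g \<longleftrightarrow> g \<in> carrier G \<and> (g <# C, 2) \<in> Poly_Mapping.keys x" for g
  have "\<exists>s. \<forall>i. P (s i) \<and> (\<exists>a\<in>L i. s (Suc i) = s i \<otimes> a)"
  proof (rule dependent_nat_choice)
    show "\<exists>g. P g" using g0 unfolding P_def by blast
    fix g and i :: nat assume "P g"
    then have g: "g \<in> carrier G" "(g <# C, 2) \<in> Poly_Mapping.keys x" unfolding P_def by auto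
    have "\<exists>a\<in>L i. ((g \<otimes> a) <# C, 2) \<in> Poly_Mapping.keys x"
      using edge_continues[OF x g, of A B 0] edge_continues[OF x g, of B A 1] unfolding L_def by simp
    then obtain a where a: "a \<in> L i" "((g \<otimes> a) <# C, 2) \<in> Poly_Mapping.keys x" by blast
    have "a \<in> carrier G" using a(1) subgroup.mem_carrier[OF A] subgroup.mem_carrier[OF B]
      unfolding L_def by (auto split: if_splits)
    then have "P (g \<otimes> a)" unfolding P_def using g(1) a(2) by simp
    then show "\<exists>g'. P g' \<and> (\<exists>a\<in>L i. g' = g \<otimes> a)" using a(1) by blast
  qed
  then obtain s where s: "\<And>i. P (s i)" and "\<And>i. \<exists>a\<in>L i. s (Suc i) = s i \<otimes> a" by metis
  then obtain a where a: "\<And>i. a i \<in> L i" "\<And>i. s (Suc i) = s i \<otimes> a i" by metis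
  have sc: "s i \<in> carrier G" for i using s unfolding P_def by blast
  have ac: "a i \<in> carrier G" for i using a(1)[of i] subgroup.mem_carrier[OF A] subgroup.mem_carrier[OF B]
      unfolding L_def by (auto split: if_splits)
  have alt: "alternating G A B (even i) (inv (s i) \<otimes> s j)" if "i < j" for i j
    using that
  proof (induction rule: strict_inc_induct)
    case (base i)
    have "inv (s i) \<otimes> s (Suc i) = a i" using a(2) sc ac by (simp add: inv_cancel)
    then show ?case using a(1)[of i] base unfolding L_def by (auto intro: alternating.intros split: if_splits)
  next
    case (step i)
    have "inv (s i) \<otimes> s j = a i \<otimes> (inv (s (Suc i)) \<otimes> s j)"
      using sc ac by (simp add: a(2) inv_mult_group m_assoc inv_cancel)
    then show ?case using a(1)[of i] step unfolding L_def by (auto intro: alternating.intros split: if_splits)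
  qed
  \<comment> \<open>Only finitely many edges occur in \<open>x\<close>, so the path visits some edge
    twice, and the letters in between multiply into \<open>C\<close>.\<close>
  have "finite ((\<lambda>i. (s i <# C, 2::nat)) ` UNIV)"
    by (rule finite_subset[OF _ finite_keys[of x]]) (use s in \<open>auto simp: P_def\<close>)
  then have "\<not> inj (\<lambda>i. (s i <# C, 2::nat))" using finite_imageD by blast
  then obtain i j where "i < j" "s i <# C = s j <# C"
    unfolding inj_on_def by (metis linorder_neqE_nat prod.inject)
  then show False using alt red lcos_eq_iff[OF C sc sc] by blast
qed

lemma tree_resolution:
  "perm_resolution (carrier G) (coset_act G) cells augmentation (\<lambda>i. if i = 0 then bd else (\<lambda>x. 0))"
proof (rule perm_resolutionI)
  show "additive_on (cells 0) augmentation" by (simp add: additive_on_def augmentation_simps)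
  show "augmentation (perm_act (coset_act G) g x) = augmentation x" for g x by (rule augmentation_act)
  have "k \<in> augmentation ` frags (cells 0)" for k
    by (rule image_eqI[of _ _ "frag_cmul k (frag_of (\<one> <# A, 0))"])
      (use in_cells(1)[OF one_closed] in \<open>auto simp: augmentation_simps\<close>)
  then show "augmentation ` frags (cells 0) = UNIV" by blast
  show "additive_on (cells (Suc i)) (if i = 0 then bd else (\<lambda>x. 0))" for i
    by (simp add: additive_on_def tree_boundary_def frag_extend_add)
  show "(if i = 0 then bd else (\<lambda>x. 0)) x \<in> frags (cells i)" if "x \<in> frags (cells (Suc i))" for i x
    using boundary_in that by (cases i) simp_all
  show "(if i = 0 then bd else (\<lambda>x. 0)) (perm_act (coset_act G) g x)
      = perm_act (coset_act G) g ((if i = 0 then bd else (\<lambda>x. 0)) x)"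
    if "g \<in> carrier G" "x \<in> frags (cells (Suc i))" for i g x
    using boundary_act that by (cases i) (simp_all add: perm_act_def)
  show "augmentation ((if 0 = (0::nat) then bd else (\<lambda>x. 0)) x) = 0" for x
    by (simp add: augmentation_boundary)
  show "(if i = 0 then bd else (\<lambda>x. 0)) ((if Suc i = 0 then bd else (\<lambda>x. 0)) x) = 0" for i x
    by (simp add: tree_boundary_def)
  show "x \<in> (if 0 = (0::nat) then bd else (\<lambda>x. 0)) ` frags (cells (Suc 0))" if "x \<in> frags (cells 0)" "augmentation x = 0" for x
    using kernel_augmentation[OF that] by simp
  show "x \<in> (if Suc i = 0 then bd else (\<lambda>x. 0)) ` frags (cells (Suc (Suc i)))"
    if "x \<in> frags (cells (Suc i))" "(if i = 0 then bd else (\<lambda>x. 0)) x = 0" for i x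
    using boundary_inj that by (cases i) (auto simp: cells_2)
qed

text \<open>For \<open>D\<close> any of \<open>A\<close>, \<open>B\<close>, \<open>C\<close>, the
  number of free \<open>H\<close>-orbits on the cosets of \<open>D\<close> is the index of
  \<open>H\<close> divided by \<open>card D\<close>. These numbers give the ranks, so division by
  the index leaves the reciprocals of the orders.\<close>

lemma euler_char_amalgam:
  assumes fin: "finite A" "finite B"
    and H: "subgroup H G" "finite (rcosets H)" "torsion_free (G\<lparr>carrier := H\<rparr>)"
  shows "euler_subgroup H G"
    "euler_char G = 1 / of_nat (card A) + 1 / of_nat (card B) - 1 / of_nat (card C)"
proof -
  have finC: "finite C" using fin by simp
  obtain RA where RA: "RA \<subseteq> carrier G" "finite RA" "card (rcosets H) = card RA * card A"
    "bij_betw (\<lambda>(h, x). (h \<otimes> x) <# A) (H \<times> RA) ((\<lambda>g. g <# A) ` carrier G)"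
    by (rule double_coset_transversal[OF H A fin(1)])
  obtain RB where RB: "RB \<subseteq> carrier G" "finite RB" "card (rcosets H) = card RB * card B"
    "bij_betw (\<lambda>(h, x). (h \<otimes> x) <# B) (H \<times> RB) ((\<lambda>g. g <# B) ` carrier G)"
    by (rule double_coset_transversal[OF H B fin(2)])
  obtain RC where RC: "RC \<subseteq> carrier G" "finite RC" "card (rcosets H) = card RC * card C"
    "bij_betw (\<lambda>(h, x). (h \<otimes> x) <# C) (H \<times> RC) ((\<lambda>g. g <# C) ` carrier G)"
    by (rule double_coset_transversal[OF H C finC])
  have HG: "H \<subseteq> carrier G" and H1: "\<one> \<in> H" using H(1) subgroup.subset subgroup.one_closed by blast+
  let ?H = "G\<lparr>carrier := H\<rparr>"
  \<comment> \<open>Representatives of the \<open>H\<close>-orbits on the cells of each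
    degree.\<close>
  define R :: "nat \<Rightarrow> ('a set \<times> nat) set" where "R i = (if i = 0 then (\<lambda>x. (x <# A, 0)) ` RA \<union> (\<lambda>x. (x <# B, 1)) ` RB
      else if i = 1 then (\<lambda>x. (x <# C, 2)) ` RC else {})" for i
  have inj: "inj_on (\<lambda>x. x <# (D :: 'a set)) RD"
    if "bij_betw (\<lambda>(h, x). (h \<otimes> x) <# D) (H \<times> RD) ((\<lambda>g. g <# D) ` carrier G)" "RD \<subseteq> carrier G" for D RD
  proof (rule inj_onI)
    fix x x' assume x: "x \<in> RD" "x' \<in> RD" "x <# D = x' <# D"
    then have "x \<in> carrier G" "x' \<in> carrier G" using that(2) by blast+
    then show "x = x'" using x
        inj_onD[OF bij_betw_imp_inj_on[OF that(1)], of "(\<one>, x)" "(\<one>, x')"] H1 by simp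
  qed
  have bij1: "bij_betw (\<lambda>(h, v). coset_act G h v) (H \<times> (\<lambda>x. (x <# D, j)) ` RD) ((\<lambda>g. (g <# D, j)) ` carrier G)"
    if b: "bij_betw (\<lambda>(h, x). (h \<otimes> x) <# D) (H \<times> RD) ((\<lambda>g. g <# D) ` carrier G)" and RD: "RD \<subseteq> carrier G"
      and D: "D \<subseteq> carrier G" for D RD and j :: nat
  proof -
    have e: "coset_act G h (x <# D, j) = ((h \<otimes> x) <# D, j)" if "h \<in> H" "x \<in> RD" for h x
      using lcos_m_assoc[OF D] that HG RD by (auto simp: coset_act_def)
    show ?thesis
      unfolding bij_betw_def
    proof
      show "inj_on (\<lambda>(h, v). coset_act G h v) (H \<times> (\<lambda>x. (x <# D, j)) ` RD)"
      proof (rule inj_onI, clarsimp)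
        fix h x h' x' assume h: "h \<in> H" "x \<in> RD" "h' \<in> H" "x' \<in> RD"
          and "coset_act G h (x <# D, j) = coset_act G h' (x' <# D, j)"
        then have "(h \<otimes> x) <# D = (h' \<otimes> x') <# D" using e by simp
        then have "(h, x) = (h', x')"
          using inj_onD[OF bij_betw_imp_inj_on[OF b], of "(h, x)" "(h', x')"] h by simp
        then show "h = h' \<and> x <# D = x' <# D" by simp
      qed
      show "(\<lambda>(h, v). coset_act G h v) ` (H \<times> (\<lambda>x. (x <# D, j)) ` RD) = (\<lambda>g. (g <# D, j)) ` carrier G"
      proof (intro equalityI subsetI)
        fix v assume "v \<in> (\<lambda>g. (g <# D, j)) ` carrier G"
        then obtain S where S: "S \<in> (\<lambda>g. g <# D) ` carrier G" "v = (S, j)" by blast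
        then obtain h x where hx: "h \<in> H" "x \<in> RD" "S = (h \<otimes> x) <# D"
          unfolding bij_betw_imp_surj_on[OF b, symmetric] by auto
        then show "v \<in> (\<lambda>(h, v). coset_act G h v) ` (H \<times> (\<lambda>x. (x <# D, j)) ` RD)"
          using e S by (intro image_eqI[of _ _ "(h, (x <# D, j))"]) auto
      next
        fix v assume "v \<in> (\<lambda>(h, v). coset_act G h v) ` (H \<times> (\<lambda>x. (x <# D, j)) ` RD)"
        then obtain h x where "h \<in> H" "x \<in> RD" "v = coset_act G h (x <# D, j)" by auto
        moreover from this have "h \<otimes> x \<in> carrier G" using HG RD by blast
        ultimately show "v \<in> (\<lambda>g. (g <# D, j)) ` carrier G" using e by auto
      qed
    qed
  qed
  have "finite_free_resolution ?H (Suc 0) (\<lambda>i. card (R i))"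
  proof (rule finite_free_resolution_of_free_action[where \<psi> = "\<lambda>h. h", OF subgroup_imp_group[OF H(1)] tree_resolution])
    show "h \<in> carrier G" if "h \<in> carrier ?H" for h using that HG by auto
    show "coset_act G (h \<otimes>\<^bsub>?H\<^esub> h') v = coset_act G h (coset_act G h' v)"
      if h: "h \<in> carrier ?H" "h' \<in> carrier ?H" and v: "v \<in> cells i" for h h' i v
    proof -
      obtain S j where S: "v = (S, j)" by (cases v)
      obtain D g where "D \<in> {A, B, C}" "g \<in> carrier G" "S = g <# D"
        using v unfolding S tree_cells_def by (auto split: if_splits)
      then have "S \<subseteq> carrier G"
        using l_coset_subset_G subgroup.subset[OF A] subgroup.subset[OF B] subgroup.subset[OF C] by blast
      then show ?thesis using lcos_m_assoc[of S h h'] h HG by (auto simp: S coset_act_def)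
    qed
    show "finite (R i)" for i unfolding R_def using RA RB RC by simp
    show "R i \<subseteq> cells i" for i unfolding R_def tree_cells_def using RA(1) RB(1) RC(1) by auto
    show "R i = {}" if "i > Suc 0" for i using that unfolding R_def by simp
    fix i :: nat
    consider "i = 0" | "i = 1" | "i > 1" by linarith
    then show "bij_betw (\<lambda>(h, v). coset_act G h v) (carrier ?H \<times> R i) (cells i)"
    proof cases
      case 1
      have "bij_betw (\<lambda>(h, v). coset_act G h v) (H \<times> (\<lambda>x. (x <# A, 0)) ` RA \<union> H \<times> (\<lambda>x. (x <# B, 1)) ` RB)
        ((\<lambda>g. (g <# A, 0)) ` carrier G \<union> (\<lambda>g. (g <# B, 1)) ` carrier G)"
        by (rule bij_betw_combine[OF bij1[OF RA(4,1) subgroup.subset[OF A]] bij1[OF RB(4,1) subgroup.subset[OF B]]]) auto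
      then show ?thesis unfolding 1 R_def tree_cells_def by (simp add: Sigma_Un_distrib2)
    next
      case 2
      show ?thesis unfolding 2 R_def tree_cells_def using bij1[OF RC(4,1) subgroup.subset[OF C]] by simp
    next
      case 3
      then show ?thesis unfolding R_def tree_cells_def by (simp add: bij_betw_def)
    qed
  qed
  note FL = this
  have "card (R 0) = card RA + card RB"
  proof -
    have "card ((\<lambda>x. (x <# A, 0::nat)) ` RA) = card RA" "card ((\<lambda>x. (x <# B, 1::nat)) ` RB) = card RB"
      using inj[OF RA(4,1)] inj[OF RB(4,1)] by (auto intro!: card_image simp: inj_on_def)
    then show ?thesis unfolding R_def using RA(2) RB(2) by (subst if_P, simp, subst card_Un_disjoint) auto
  qed
  moreover have "card (R 1) = card RC"
    unfolding R_def using inj[OF RC(4,1)] by (auto intro!: card_image simp: inj_on_def)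
  ultimately have \<chi>: "euler_char_FL ?H = int (card RA) + int (card RB) - int (card RC)"
    using group.euler_char_FL_eq[OF subgroup_imp_group[OF H(1)] FL] by simp
  show E: "euler_subgroup H G"
    unfolding euler_subgroup_def type_FL_def using H FL by blast
  have "card (rcosets H) \<noteq> 0"
    using H(2) subgroup.subgroup_in_rcosets[OF H(1) is_group] by auto
  then have nz: "card (rcosets H) \<noteq> 0" "card A \<noteq> 0" "card B \<noteq> 0" "card C \<noteq> 0"
    using RA(3) RB(3) RC(3) by (metis mult_0_right)+
  have q: "(of_nat (card RD) :: rat) / of_nat (card (rcosets H)) = 1 / of_nat d"
    if "card (rcosets H) = card RD * d" for RD :: "'a set" and d
  proof -
    have "card RD \<noteq> 0" using that nz(1) by auto
    then show ?thesis unfolding that by simp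
  qed
  show "euler_char G = 1 / of_nat (card A) + 1 / of_nat (card B) - 1 / of_nat (card C)"
    unfolding euler_char_eq[OF E] \<chi> q[OF RA(3), symmetric] q[OF RB(3), symmetric] q[OF RC(3), symmetric]
    by (simp add: add_divide_distrib diff_divide_distrib)
qed

text \<open>The induction over generation concerns left multiplication by \<open>w\<close> as an
  operator: it preserves the set of edge elements and alternating words, to which
  \<open>\<one>\<close> belongs.\<close>

lemma alternating_or_edge:
  assumes "w \<in> carrier G"
  shows "w \<in> C \<or> (\<exists>s. alternating G A B s w)"
proof -
  have AB: "A \<union> B \<subseteq> carrier G" using subgroup.subset[OF A] subgroup.subset[OF B] by simp
  have mult: "x \<otimes> w \<in> C \<or> (\<exists>s. alternating G A B s (x \<otimes> w))"
    if x: "x \<in> A \<union> B" and w: "w \<in> C \<or> (\<exists>s. alternating G A B s w)" for x w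
  proof (cases "x \<in> A")
    case True
    then show ?thesis using alternating_mult[OF A B] w by blast
  next
    case False
    then have "x \<otimes> w \<in> B \<inter> A \<or> (\<exists>s. alternating G B A s (x \<otimes> w))"
      using x w alternating_swap[of G A B] by (intro alternating_mult[OF B A]) auto
    then show ?thesis using alternating_swap[of G B A] by blast
  qed
  have "\<forall>v\<in>carrier G. v \<in> C \<or> (\<exists>s. alternating G A B s v) \<longrightarrow> w \<otimes> v \<in> C \<or> (\<exists>s. alternating G A B s (w \<otimes> v))"
    using assms[folded gen]
  proof (induction rule: generate.induct)
    case one then show ?case by simp
  next
    case (incl h) then show ?case using mult by blast
  next
    case (inv h)
    then have "inv h \<in> A \<union> B" using subgroup.m_inv_closed[OF A] subgroup.m_inv_closed[OF B] by blast
    then show ?case using mult by blast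
  next
    case (eng h1 h2)
    show ?case
    proof (intro ballI impI)
      fix v assume v: "v \<in> carrier G" "v \<in> C \<or> (\<exists>s. alternating G A B s v)"
      have c: "h1 \<in> carrier G" "h2 \<in> carrier G" "v \<in> carrier G" using eng.hyps v gen by auto
      have "h2 \<otimes> v \<in> C \<or> (\<exists>s. alternating G A B s (h2 \<otimes> v))" using eng.IH(2) v by blast
      moreover have "h2 \<otimes> v \<in> carrier G" using c by simp
      ultimately have "h1 \<otimes> (h2 \<otimes> v) \<in> C \<or> (\<exists>s. alternating G A B s (h1 \<otimes> (h2 \<otimes> v)))" using eng.IH(1) by blast
      then show "h1 \<otimes> h2 \<otimes> v \<in> C \<or> (\<exists>s. alternating G A B s (h1 \<otimes> h2 \<otimes> v))"
        using c by (simp add: m_assoc)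
    qed
  qed
  then have "w \<otimes> \<one> \<in> C \<or> (\<exists>s. alternating G A B s (w \<otimes> \<one>))"
    using subgroup.one_closed[OF C] one_closed by blast
  then show ?thesis using assms by simp
qed

end

section \<open>Valuation rings of the complex numbers\<close>

definition csubring :: "complex set \<Rightarrow> bool" where
  "csubring R \<longleftrightarrow> 1 \<in> R \<and> (\<forall>x\<in>R. \<forall>y\<in>R. x - y \<in> R \<and> x * y \<in> R)"

lemma csubringD:
  assumes "csubring R"
  shows csubring_1: "1 \<in> R" and csubring_0: "0 \<in> R"
    and csubring_diff: "\<And>x y. x \<in> R \<Longrightarrow> y \<in> R \<Longrightarrow> x - y \<in> R"
    and csubring_mult: "\<And>x y. x \<in> R \<Longrightarrow> y \<in> R \<Longrightarrow> x * y \<in> R"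
    and csubring_minus: "\<And>x. x \<in> R \<Longrightarrow> - x \<in> R"
    and csubring_add: "\<And>x y. x \<in> R \<Longrightarrow> y \<in> R \<Longrightarrow> x + y \<in> R"
proof -
  show 1: "1 \<in> R" and d: "\<And>x y. x \<in> R \<Longrightarrow> y \<in> R \<Longrightarrow> x - y \<in> R"
    "\<And>x y. x \<in> R \<Longrightarrow> y \<in> R \<Longrightarrow> x * y \<in> R"
    using assms unfolding csubring_def by blast+
  show 0: "0 \<in> R" using d(1)[OF 1 1] by simp
  show m: "- x \<in> R" if "x \<in> R" for x using d(1)[OF 0 that] by simp
  show "x + y \<in> R" if "x \<in> R" "y \<in> R" for x y using d(1)[OF that(1) m[OF that(2)]] by simp
qed

lemma csubring_sum: "csubring R \<Longrightarrow> (\<And>i. i \<in> I \<Longrightarrow> f i \<in> R) \<Longrightarrow> sum f I \<in> R"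
  by (induction I rule: infinite_finite_induct) (simp_all add: csubring_0 csubring_add)

lemma csubring_power: "csubring R \<Longrightarrow> x \<in> R \<Longrightarrow> x ^ n \<in> R"
  by (induction n) (simp_all add: csubring_1 csubring_mult)

lemma csubring_of_nat: "csubring R \<Longrightarrow> of_nat n \<in> R"
  by (induction n) (simp_all add: csubring_0 csubring_1 csubring_add)

lemma csubring_of_int: "csubring R \<Longrightarrow> of_int n \<in> R"
  using csubring_of_nat[of R "nat \<bar>n\<bar>"] csubring_minus[of R "of_nat (nat \<bar>n\<bar>)"]
  by (cases "n \<ge> 0") auto

section \<open>Adjoining an element to a ring, and the construction of valuation rings\<close>

definition adjoin :: "complex set \<Rightarrow> complex \<Rightarrow> complex set" where
  "adjoin R x = (\<lambda>p. poly p x) ` {p. \<forall>i. Polynomial.coeff p i \<in> R}"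

lemma csubring_adjoin:
  assumes R: "csubring R"
  shows "csubring (adjoin R x)" "R \<subseteq> adjoin R x" "x \<in> adjoin R x"
proof -
  let ?P = "{p. \<forall>i. Polynomial.coeff p i \<in> R}"
  show "csubring (adjoin R x)"
    unfolding csubring_def
  proof (intro conjI ballI)
    show "1 \<in> adjoin R x" unfolding adjoin_def
      by (rule image_eqI[of _ _ 1]) (use R in \<open>auto simp: csubring_1 csubring_0\<close>)
    fix a b assume "a \<in> adjoin R x" "b \<in> adjoin R x"
    then obtain p q where pq: "p \<in> ?P" "q \<in> ?P" "a = poly p x" "b = poly q x" unfolding adjoin_def by blast
    have "p - q \<in> ?P" using pq csubring_diff[OF R] by simp
    moreover have "a - b = poly (p - q) x" using pq by simp
    ultimately show "a - b \<in> adjoin R x" unfolding adjoin_def by blast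
    have "p * q \<in> ?P" using pq csubring_mult[OF R] by (auto simp: coeff_mult intro!: csubring_sum[OF R])
    moreover have "a * b = poly (p * q) x" using pq by simp
    ultimately show "a * b \<in> adjoin R x" unfolding adjoin_def by blast
  qed
  show "R \<subseteq> adjoin R x"
  proof
    fix a assume "a \<in> R"
    then show "a \<in> adjoin R x" unfolding adjoin_def
      by (intro image_eqI[of _ _ "[:a:]"]) (auto simp: coeff_pCons csubring_0[OF R] split: nat.splits)
  qed
  show "x \<in> adjoin R x" unfolding adjoin_def
    by (rule image_eqI[of _ _ "[:0, 1:]"]) (auto simp: coeff_pCons csubring_0[OF R] csubring_1[OF R] split: nat.splits)
qed

text \<open>Elements of the ideal generated by \<open>l\<close> in the ring \<open>R[x]\<close>,
  with a bound on the degree. That 1 is among them for some \<open>n\<close> means that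
  \<open>l\<close> becomes a unit on adjoining \<open>x\<close>.\<close>

definition lpolys :: "nat \<Rightarrow> complex set \<Rightarrow> complex \<Rightarrow> nat \<Rightarrow> complex set" where
  "lpolys l R x n = {\<Sum>i\<le>n. of_nat l * a i * x ^ i | a. \<forall>i. a i \<in> R}"

lemma lpolysI: "\<forall>i. a i \<in> R \<Longrightarrow> y = (\<Sum>i\<le>n. of_nat l * a i * x ^ i) \<Longrightarrow> y \<in> lpolys l R x n"
  unfolding lpolys_def by (intro CollectI exI conjI)

lemma lpolys_of_adjoin:
  assumes l: "l > 0" and "1 / of_nat l \<in> adjoin R x"
  shows "\<exists>n. 1 \<in> lpolys l R x n"
proof -
  obtain p where p: "\<forall>i. Polynomial.coeff p i \<in> R" "1 / of_nat l = poly p x" using assms(2) unfolding adjoin_def by blast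
  have "1 = of_nat l * poly p x" using l by (simp flip: p(2))
  also have "\<dots> = (\<Sum>i\<le>Polynomial.degree p. of_nat l * Polynomial.coeff p i * x ^ i)"
    by (simp add: poly_altdef sum_distrib_left mult.assoc)
  finally have "1 \<in> lpolys l R x (Polynomial.degree p)" by (rule lpolysI[OF p(1)])
  then show ?thesis ..
qed

lemma lpolys_add:
  assumes R: "csubring R" and "y \<in> lpolys l R x n" "z \<in> lpolys l R x n"
  shows "y + z \<in> lpolys l R x n"
proof -
  obtain a b where ab: "\<forall>i. a i \<in> R" "\<forall>i. b i \<in> R"
    "y = (\<Sum>i\<le>n. of_nat l * a i * x ^ i)" "z = (\<Sum>i\<le>n. of_nat l * b i * x ^ i)"
    using assms unfolding lpolys_def by blast
  have "y + z = (\<Sum>i\<le>n. of_nat l * (a i + b i) * x ^ i)"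
    unfolding ab(3,4) by (simp add: algebra_simps sum.distrib)
  moreover have "\<forall>i. a i + b i \<in> R" using ab csubring_add[OF R] by blast
  ultimately show ?thesis by (intro lpolysI)
qed

lemma lpolys_monom:
  assumes R: "csubring R" and "c \<in> R" "k \<le> n"
  shows "of_nat l * c * x ^ k \<in> lpolys l R x n"
proof -
  have "of_nat l * c * x ^ k = (\<Sum>i\<le>n. of_nat l * (if i = k then c else 0) * x ^ i)"
  proof -
    have "(\<Sum>i\<le>n. of_nat l * (if i = k then c else 0) * x ^ i) = (\<Sum>i\<le>n. if i = k then of_nat l * c * x ^ i else 0)"
      by (rule sum.cong) auto
    then show ?thesis using assms(3) by simp
  qed
  moreover have "\<forall>i. (if i = k then c else 0) \<in> R" using assms csubring_0[OF R] by simp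
  ultimately show ?thesis by (rule lpolysI[rotated])
qed

lemma lpolys_sum:
  assumes R: "csubring R" and "\<And>j. j \<in> J \<Longrightarrow> f j \<in> lpolys l R x n"
  shows "sum f J \<in> lpolys l R x n"
  using assms(2)
proof (induction J rule: infinite_finite_induct)
  case (insert j J) then show ?case using lpolys_add[OF R] by simp
qed (use lpolys_monom[OF R csubring_0[OF R], of 0] in simp_all)

text \<open>The degree reduction in the classical proof that a maximal subring is a valuation ring.\<close>

lemma lpolys_reduce:
  assumes R: "csubring R" and unit: "\<And>a. a \<in> R \<Longrightarrow> 1 / (1 - of_nat l * a) \<in> R"
    and nz: "\<And>a. a \<in> R \<Longrightarrow> 1 - of_nat l * a \<noteq> 0"
    and x: "x \<noteq> 0" and n: "1 \<in> lpolys l R x n" and m: "1 \<in> lpolys l R (1 / x) m" and mn: "m \<le> n"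
  shows "n > 0 \<and> 1 \<in> lpolys l R x (n - 1)"
proof -
  obtain a where a: "\<forall>i. a i \<in> R" "1 = (\<Sum>i\<le>n. of_nat l * a i * x ^ i)" using n unfolding lpolys_def by blast
  obtain b where b: "\<forall>i. b i \<in> R" "1 = (\<Sum>i\<le>m. of_nat l * b i * (1 / x) ^ i)" using m unfolding lpolys_def by blast
  have "n \<noteq> 0"
  proof
    assume "n = 0"
    then have "1 = of_nat l * a 0" using a(2) by simp
    then show False using nz[of "a 0"] a(1) by simp
  qed
  then obtain k where k: "n = Suc k" by (cases n) auto
  \<comment> \<open>The constant term of the relation for \<open>1 / x\<close> is moved to the other
    side, where it becomes a unit by \<open>unit\<close>.\<close>
  define u where "u = 1 - of_nat l * b 0"
  have u: "1 / u \<in> R" "u \<noteq> 0" unfolding u_def using unit nz b(1) by blast+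
  have "1 = of_nat l * b 0 + (\<Sum>j=1..m. of_nat l * b j * (1 / x) ^ j)"
    using b(2) by (simp add: atMost_atLeast0 sum.atLeast_Suc_atMost)
  then have usum: "u = (\<Sum>j=1..m. of_nat l * b j * (1 / x) ^ j)"
    unfolding u_def by (metis add_diff_cancel_left')
  \<comment> \<open>The relation for \<open>1 / x\<close>, multiplied by \<open>x ^ n\<close>,
    expresses \<open>x ^ n\<close> through lower powers; \<open>m \<le> n\<close> keeps the
    exponents nonnegative.\<close>
  have "u * x ^ n = (\<Sum>j=1..m. of_nat l * b j * x ^ (n - j))"
  proof -
    have "of_nat l * b j * (1 / x) ^ j * x ^ n = of_nat l * b j * x ^ (n - j)" if "j \<in> {1..m}" for j
      using x mn that by (simp add: power_diff power_one_over field_simps)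
    then show ?thesis unfolding usum sum_distrib_right by (intro sum.cong refl)
  qed
  then have "x ^ n = (\<Sum>j=1..m. of_nat l * b j * x ^ (n - j)) * (1 / u)"
    using u(2) by (simp add: field_simps)
  then have xn: "of_nat l * a n * x ^ n = (\<Sum>j=1..m. of_nat l * (a n * (of_nat l * b j) * (1 / u)) * x ^ (n - j))"
    by (simp add: sum_distrib_left sum_distrib_right mult_ac)
  have "of_nat l * a n * x ^ n \<in> lpolys l R x k"
    unfolding xn
  proof (rule lpolys_sum[OF R], rule lpolys_monom[OF R])
    fix j assume j: "j \<in> {1..m}"
    show "a n * (of_nat l * b j) * (1 / u) \<in> R"
      by (intro csubring_mult[OF R] csubring_of_nat[OF R] u) (use a b in auto)
    show "n - j \<le> k" using j k by auto
  qed
  moreover have "(\<Sum>i\<le>k. of_nat l * a i * x ^ i) \<in> lpolys l R x k"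
    by (rule lpolysI[OF a(1) refl])
  ultimately have "(\<Sum>i\<le>k. of_nat l * a i * x ^ i) + of_nat l * a n * x ^ n \<in> lpolys l R x k"
    using lpolys_add[OF R] by blast
  then show ?thesis using a(2) k by simp
qed

text \<open>Descent: the larger of the two degrees is lowered, the roles of \<open>x\<close> and
  \<open>1 / x\<close> being symmetric.\<close>

lemma lpolys_contradiction:
  assumes R: "csubring R" and unit: "\<And>a. a \<in> R \<Longrightarrow> 1 / (1 - of_nat l * a) \<in> R"
    and nz: "\<And>a. a \<in> R \<Longrightarrow> 1 - of_nat l * a \<noteq> 0" and x: "x \<noteq> 0"
  shows "1 \<in> lpolys l R x n \<Longrightarrow> 1 \<in> lpolys l R (1 / x) m \<Longrightarrow> False"
proof (induction "n + m" arbitrary: n m rule: less_induct)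
  case less
  show ?case
  proof (cases "m \<le> n")
    case True
    from lpolys_reduce[OF R unit nz x less.prems True] have "n > 0" "1 \<in> lpolys l R x (n - 1)" by auto
    then show ?thesis using less.hyps[of "n - 1" m] less.prems by simp
  next
    case False
    have "1 / x \<noteq> 0" "1 \<in> lpolys l R (1 / (1 / x)) n" using x less.prems by simp_all
    from lpolys_reduce[OF R unit nz this(1) less.prems(2) this(2)] False
    have "m > 0" "1 \<in> lpolys l R (1 / x) (m - 1)" by auto
    then show ?thesis using less.hyps[of n "m - 1"] less.prems by simp
  qed
qed

text \<open>A valuation ring of the field of complex numbers in which \<open>l\<close> is not a
  unit; for prime \<open>l\<close> its valuation lies above the \<open>l\<close>-adic one.\<close>

locale valuation_ring =
  fixes V :: "complex set" and l :: nat
  assumes sub: "csubring V" and l: "l > 0" "1 / of_nat l \<notin> V"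
    and total: "\<And>x. x \<noteq> 0 \<Longrightarrow> x \<in> V \<or> 1 / x \<in> V"

text \<open>Chevalley's extension argument: Zorn's lemma, applied to the subrings without
  \<open>1 / l\<close>, of which the integers are one, gives a maximal such ring, and maximality
  makes it a valuation ring.\<close>

lemma valuation_ring_exists:
  assumes l: "l > 1"
  shows "\<exists>V. valuation_ring V l"
proof -
  define F where "F = {R. csubring R \<and> 1 / of_nat l \<notin> R}"
  have "(\<int> :: complex set) \<in> F"
  proof -
    have "1 / of_nat l \<notin> (\<int> :: complex set)"
    proof
      assume "1 / of_nat l \<in> (\<int> :: complex set)"
      then obtain k where "1 / of_nat l = (of_int k :: complex)" by (auto elim: Ints_cases)
      then have "of_int (k * int l) = (of_int 1 :: complex)" using l by (simp add: field_simps)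
      then have "k * int l = 1" unfolding of_int_eq_iff .
      then show False using l by (simp add: zmult_eq_1_iff)
    qed
    then show ?thesis by (simp add: F_def csubring_def)
  qed
  moreover have "\<Union>\<C> \<in> F" if C: "\<C> \<noteq> {}" "subset.chain F \<C>" for \<C>
  proof -
    have CF: "\<C> \<subseteq> F" and additive_on: "\<And>A B. A \<in> \<C> \<Longrightarrow> B \<in> \<C> \<Longrightarrow> A \<subseteq> B \<or> B \<subseteq> A"
      using C(2) by (auto simp: subset_chain_def)
    have "csubring (\<Union>\<C>)"
      unfolding csubring_def
    proof (intro conjI ballI)
      obtain R where "R \<in> \<C>" using C(1) by blast
      then show "1 \<in> \<Union>\<C>" using CF csubring_1 unfolding F_def by blast
      fix x y assume "x \<in> \<Union>\<C>" "y \<in> \<Union>\<C>"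
      then obtain R where R: "R \<in> \<C>" "x \<in> R" "y \<in> R" using additive_on by blast
      then have "csubring R" using CF unfolding F_def by blast
      then have "x - y \<in> R" "x * y \<in> R" using R csubring_diff csubring_mult by blast+
      then show "x - y \<in> \<Union>\<C>" "x * y \<in> \<Union>\<C>" using R(1) by blast+
    qed
    then show ?thesis using CF unfolding F_def by blast
  qed
  ultimately have "\<exists>M\<in>F. \<forall>R\<in>F. M \<subseteq> R \<longrightarrow> R = M" by (intro subset_Zorn_nonempty) auto
  then obtain M where M: "csubring M" "1 / of_nat l \<notin> M"
    and max: "\<And>R. csubring R \<Longrightarrow> M \<subseteq> R \<Longrightarrow> 1 / of_nat l \<notin> R \<Longrightarrow> R = M"
    unfolding F_def by blast
  have adj: "\<exists>n. 1 \<in> lpolys l M x n" if "x \<notin> M" for x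
  proof -
    have "adjoin M x \<noteq> M" using csubring_adjoin(3)[OF M(1), of x] that by auto
    then have "1 / of_nat l \<in> adjoin M x" using max[OF csubring_adjoin(1,2)[OF M(1)]] by blast
    then show ?thesis using l by (intro lpolys_of_adjoin) auto
  qed
  have nz: "1 - of_nat l * a \<noteq> 0" if "a \<in> M" for a
  proof
    assume "1 - of_nat l * a = 0"
    then have "a = 1 / of_nat l" using l by (simp add: field_simps)
    then show False using that M(2) by simp
  qed
  \<comment> \<open>If the inverse of \<open>u = 1 - l a\<close> were missing from \<open>M\<close>,
    adjoining it would put some \<open>u ^ n\<close> into \<open>l M\<close>; but every power of
    \<open>u\<close> is congruent to 1 modulo \<open>l\<close>.\<close>
  have unit: "1 / (1 - of_nat l * a) \<in> M" if a: "a \<in> M" for a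
  proof (rule ccontr)
    define u where "u = 1 - of_nat l * a"
    assume "1 / (1 - of_nat l * a) \<notin> M"
    then obtain n where "1 \<in> lpolys l M (1 / u) n" using adj unfolding u_def by blast
    then obtain b where b: "\<forall>i. b i \<in> M" "1 = (\<Sum>i\<le>n. of_nat l * b i * (1 / u) ^ i)" unfolding lpolys_def by blast
    have u: "u \<noteq> 0" "u \<in> M" unfolding u_def using nz[OF a] a M(1)
      by (auto intro!: csubring_diff csubring_mult csubring_1 csubring_of_nat)
    have un: "u ^ n = of_nat l * (\<Sum>i\<le>n. b i * u ^ (n - i))"
    proof -
      have "u ^ n = (\<Sum>i\<le>n. of_nat l * b i * (1 / u) ^ i) * u ^ n" unfolding b(2)[symmetric] by simp
      also have "\<dots> = (\<Sum>i\<le>n. of_nat l * (b i * u ^ (n - i)))"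
        unfolding sum_distrib_right by (rule sum.cong) (use u in \<open>auto simp: power_diff field_simps\<close>)
      finally show ?thesis by (simp add: sum_distrib_left)
    qed
    have pow: "\<exists>c\<in>M. u ^ k = 1 - of_nat l * c" for k
    proof (induction k)
      case 0 show ?case using csubring_0[OF M(1)] by (intro bexI[of _ 0]) auto
    next
      case (Suc k)
      then obtain c where c: "c \<in> M" "u ^ k = 1 - of_nat l * c" by blast
      have "u ^ Suc k = 1 - of_nat l * (c + a - of_nat l * a * c)"
        by (simp add: c(2)) (simp add: u_def algebra_simps)
      moreover have "c + a - of_nat l * a * c \<in> M"
        by (intro csubring_diff[OF M(1)] csubring_add[OF M(1)] csubring_mult[OF M(1)] csubring_of_nat[OF M(1)] c a)
      ultimately show ?case by blast
    qed
    then obtain c where c: "c \<in> M" "u ^ n = 1 - of_nat l * c" by blast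
    have "1 = of_nat l * (c + (\<Sum>i\<le>n. b i * u ^ (n - i)))" using un c(2) by (simp add: algebra_simps)
    moreover have "c + (\<Sum>i\<le>n. b i * u ^ (n - i)) \<in> M"
      by (intro csubring_add[OF M(1)] c csubring_sum[OF M(1)] csubring_mult[OF M(1)] csubring_power[OF M(1)] u)
        (use b in auto)
    ultimately show False using nz by force
  qed
  have "valuation_ring M l"
  proof
    show "x \<in> M \<or> 1 / x \<in> M" if "x \<noteq> 0" for x
      using lpolys_contradiction[OF M(1) unit nz that] adj by blast
  qed (use M l in auto)
  then show ?thesis ..
qed

section \<open>Comparison of absolute values\<close>

context valuation_ring begin

lemma in_ring:
  "1 \<in> V" "0 \<in> V" "\<And>x y. x \<in> V \<Longrightarrow> y \<in> V \<Longrightarrow> x + y \<in> V" "\<And>x y. x \<in> V \<Longrightarrow> y \<in> V \<Longrightarrow> x - y \<in> V"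
  "\<And>x y. x \<in> V \<Longrightarrow> y \<in> V \<Longrightarrow> x * y \<in> V" "\<And>x. x \<in> V \<Longrightarrow> - x \<in> V" "\<And>n. of_nat n \<in> V" "\<And>n. of_int n \<in> V"
  "\<And>k. numeral k \<in> V" "\<And>x n. x \<in> V \<Longrightarrow> x ^ n \<in> V"
proof -
  show "numeral k \<in> V" for k using csubring_of_nat[OF sub, of "numeral k"] by simp
qed (simp_all add: csubringD[OF sub] csubring_of_nat[OF sub] csubring_of_int[OF sub] csubring_power[OF sub])

text \<open>The relation |x| <= |y| for the absolute value of \<open>V\<close>, expressed by
  divisibility, so that no value group has to be constructed.\<close>

definition le :: "complex \<Rightarrow> complex \<Rightarrow> bool" where "le x y \<longleftrightarrow> (\<exists>a\<in>V. x = a * y)"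

definition lt :: "complex \<Rightarrow> complex \<Rightarrow> bool" where "lt x y \<longleftrightarrow> \<not> le y x"

lemma le_refl: "le x x"
  unfolding le_def using in_ring(1) by (intro bexI[of _ 1]) auto

lemma le_trans: "le x y \<Longrightarrow> le y z \<Longrightarrow> le x z"
proof -
  assume "le x y" "le y z"
  then obtain a b where "a \<in> V" "b \<in> V" "x = a * y" "y = b * z" unfolding le_def by blast
  then have "a * b \<in> V" "x = (a * b) * z" using in_ring(5) by simp_all
  then show ?thesis unfolding le_def by blast
qed

lemma le_total: "le x y \<or> le y x"
proof (cases "x = 0 \<or> y = 0")
  case True
  then show ?thesis unfolding le_def using in_ring(2) by (metis mult_zero_left)
next
  case False
  then have "x / y \<noteq> 0" by simp
  then have "x / y \<in> V \<or> y / x \<in> V" using total[of "x / y"] by simp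
  moreover have "x = (x / y) * y" "y = (y / x) * x" using False by simp_all
  ultimately show ?thesis unfolding le_def by blast
qed

lemma lt_imp_le: "lt x y \<Longrightarrow> le x y"
  unfolding lt_def using le_total by blast

lemma lt_le_trans: "lt x y \<Longrightarrow> le y z \<Longrightarrow> lt x z"
  and le_lt_trans: "le x y \<Longrightarrow> lt y z \<Longrightarrow> lt x z"
  unfolding lt_def using le_trans by blast+

lemma le_add: "le x z \<Longrightarrow> le y z \<Longrightarrow> le (x + y) z"
proof -
  assume "le x z" "le y z"
  then obtain a b where "a \<in> V" "b \<in> V" "x = a * z" "y = b * z" unfolding le_def by blast
  then have "a + b \<in> V" "x + y = (a + b) * z" using in_ring(3) by (simp_all add: distrib_right)
  then show ?thesis unfolding le_def by blast
qed

lemma le_mult_unit: "u \<in> V \<Longrightarrow> le x y \<Longrightarrow> le (u * x) y"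
proof -
  assume u: "u \<in> V" and "le x y"
  then obtain a where "a \<in> V" "x = a * y" unfolding le_def by blast
  then have "u * a \<in> V" "u * x = (u * a) * y" using in_ring(5)[OF u] by simp_all
  then show ?thesis unfolding le_def by blast
qed

lemma le_unit_mult: "u \<noteq> 0 \<Longrightarrow> 1 / u \<in> V \<Longrightarrow> le x y \<Longrightarrow> le x (u * y)"
proof -
  assume u: "u \<noteq> 0" "1 / u \<in> V" and "le x y"
  then obtain a where a: "a \<in> V" "x = a * y" unfolding le_def by blast
  then have "x = (a * (1 / u)) * (u * y)" using u by simp
  then show ?thesis unfolding le_def using in_ring(5)[OF a(1) u(2)] by blast
qed

lemma le_minus: "le (- x) y \<longleftrightarrow> le x y"
  using le_mult_unit[OF in_ring(6)[OF in_ring(1)], of x y] le_mult_unit[OF in_ring(6)[OF in_ring(1)], of "- x" y] by auto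

lemma le_mult: "le x y \<Longrightarrow> le (x * w) (y * w)"
  unfolding le_def by (metis mult.assoc)

lemma le_mult_cancel: "w \<noteq> 0 \<Longrightarrow> le (x * w) (y * w) \<longleftrightarrow> le x y"
  using le_mult[of "x * w" "y * w" "1 / w"] le_mult[of x y w] by auto

lemma lt_mult: "w \<noteq> 0 \<Longrightarrow> lt (x * w) (y * w) \<longleftrightarrow> lt x y"
  unfolding lt_def by (simp add: le_mult_cancel)

lemma lt_add: "lt x z \<Longrightarrow> lt y z \<Longrightarrow> lt (x + y) z"
  using le_total[of x y] le_add[of x y y] le_add[of x x y] le_refl[of x] le_refl[of y]
    le_trans[of z "x + y" x] le_trans[of z "x + y" y] unfolding lt_def by blast

lemma lt_minus: "lt (- x) y \<longleftrightarrow> lt x y"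
proof -
  have "le y (- x) \<longleftrightarrow> le y x"
    using le_trans[of y "- x" x] le_trans[of y x "- x"] le_minus[of x x] le_minus[of "- x" "- x"]
      le_refl[of x] le_refl[of "- x"] by auto
  then show ?thesis unfolding lt_def by simp
qed

lemma lt_irrefl: "\<not> lt x x"
  unfolding lt_def using le_refl by blast

text \<open>In an ultrametric a strictly dominant term determines the size of a sum: otherwise
  \<open>x = (x + y) - y\<close> would be smaller than itself.\<close>

lemma le_add_small: "lt y x \<Longrightarrow> le x (x + y)" and le_add_small': "lt y x \<Longrightarrow> le (x + y) x"
proof -
  assume y: "lt y x"
  show "le x (x + y)"
  proof (rule ccontr)
    assume "\<not> le x (x + y)"
    then have "lt ((x + y) + (- y)) x" using lt_add y lt_minus unfolding lt_def by blast
    then show False using lt_irrefl by simp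
  qed
  show "le (x + y) x" using le_add[OF le_refl lt_imp_le[OF y]] .
qed

text \<open>An instance of integral closedness: \<open>z\<close> equals
  \<open>(1 / z) ^ (n - 1)\<close>, so it lies in \<open>V\<close> even if at first only
  \<open>1 / z\<close> is known to.\<close>

lemma root_of_unity_in:
  assumes "z ^ n = 1" "n > 0"
  shows "z \<in> V" "1 / z \<in> V"
proof -
  have *: "z \<in> V" if "z ^ n = 1" for z
  proof (rule ccontr)
    assume "z \<notin> V"
    have "z \<noteq> 0" using that \<open>n > 0\<close> by (auto simp: power_0_left)
    then have "1 / z \<in> V" using total \<open>z \<notin> V\<close> by blast
    then have "(1 / z) ^ (n - 1) \<in> V" by (rule in_ring)
    moreover have "(1 / z) ^ (n - 1) = z"
    proof -
      have "z ^ n = z ^ (n - 1) * z" using \<open>n > 0\<close> by (metis power_minus_mult)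
      then show ?thesis using that \<open>z \<noteq> 0\<close> by (simp add: field_simps)
    qed
    ultimately show False using \<open>z \<notin> V\<close> by simp
  qed
  show "z \<in> V" using * assms by simp
  show "1 / z \<in> V" using *[of "1 / z"] assms by (simp add: power_one_over)
qed

text \<open>Integral closedness in degree 2: division by \<open>z\<close> expresses \<open>z\<close>
  through \<open>1 / z\<close>.\<close>

lemma quadratic_in:
  assumes "z * z = s * z - t" "s \<in> V" "t \<in> V"
  shows "z \<in> V"
proof (rule ccontr)
  assume "z \<notin> V"
  then have "z \<noteq> 0" using in_ring(2) by auto
  with total[OF this] \<open>z \<notin> V\<close> have z: "z \<noteq> 0" "1 / z \<in> V" by blast+
  have "z = s - t * (1 / z)" using assms(1) z(1) by (simp add: field_simps)
  also have "\<dots> \<in> V" by (intro in_ring assms z)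
  finally show False using \<open>z \<notin> V\<close> by simp
qed

section \<open>Roots of unity congruent to 1\<close>

lemma congruent_power:
  assumes "t \<in> V" "e \<in> V"
  shows "\<exists>t'\<in>V. (1 + e * t) ^ k = 1 + e * t'"
proof (induction k)
  case 0 show ?case using in_ring(2) by (intro bexI[of _ 0]) auto
next
  case (Suc k)
  then obtain t' where t': "t' \<in> V" "(1 + e * t) ^ k = 1 + e * t'" by blast
  have "(1 + e * t) ^ Suc k = 1 + e * (t + t' + e * t * t')" using t'(2) by (simp add: algebra_simps)
  moreover have "t + t' + e * t * t' \<in> V" by (intro in_ring assms t')
  ultimately show ?case by blast
qed

text \<open>If \<open>\<mu> = 1 + e * t\<close> is not 1, the sum of its first \<open>p\<close>
  powers vanishes, while each power is congruent to 1 modulo \<open>e\<close>. For \<open>p\<close>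
  different from \<open>l\<close> this makes \<open>p\<close> a multiple of \<open>l\<close> in
  \<open>V\<close>, against Bezout; for \<open>p = l\<close> expanding the sum makes
  \<open>l\<close> a unit. With \<open>l = 2\<close> the modulus has to be 4, because
  \<open>-1\<close> is congruent to 1 modulo 2.\<close>

lemma root_of_unity_congruent_prime:
  assumes le: "l = 3 \<and> e = 3 \<or> l = 2 \<and> e = 4" and t: "t \<in> V" and p: "Factorial_Ring.prime (p::nat)"
    and pow: "(1 + e * t) ^ p = 1"
  shows "e * t = 0"
proof (rule ccontr)
  assume nz: "e * t \<noteq> 0"
  have eV: "e \<in> V" "e \<noteq> 0" using le in_ring(9) by auto
  define \<mu> where "\<mu> = 1 + e * t"
  have "(\<mu> - 1) * (\<Sum>i<p. \<mu> ^ i) = 0" using power_diff_1_eq[of \<mu> p] pow by (simp add: \<mu>_def)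
  then have sum0: "(\<Sum>i<p. \<mu> ^ i) = 0" using nz by (simp add: \<mu>_def)
  have "m = 1 \<or> m = 3" if "m dvd 3" for m :: nat
  proof -
    have "m \<le> 3" using dvd_imp_le[OF that] by simp
    then have "m \<in> {0, 1, 2, 3}" by auto
    then show ?thesis using that by auto
  qed
  then have "Factorial_Ring.prime (3::nat)" unfolding prime_nat_iff by simp
  then have "Factorial_Ring.prime l" using le two_is_prime_nat by blast
  then consider "l = p" | "coprime p l" using primes_coprime[OF p, of l] by blast
  then show False
  proof cases
    case 2
    obtain f where f: "\<And>i. f i \<in> V \<and> \<mu> ^ i = 1 + e * f i" using congruent_power[OF t eV(1)] unfolding \<mu>_def by metis
    have "(\<Sum>i<p. \<mu> ^ i) = of_nat p + e * (\<Sum>i<p. f i)" using f by (simp add: sum.distrib sum_distrib_left)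
    then have ps: "of_nat p = - (e * (\<Sum>i<p. f i))" using sum0 by (simp add: eq_neg_iff_add_eq_0)
    have fV: "(\<Sum>i<p. f i) \<in> V" by (rule csubring_sum[OF sub]) (simp add: f)
    have "gcd (int p) (int l) = 1" using 2 by simp
    then obtain a b :: int where ab: "a * int p + b * int l = 1"
      using bezout_int[of "int p" "int l"] by metis
    obtain e' where e': "e' \<in> V" "e = of_nat l * e'" using le in_ring(1) in_ring(9)[of "num.Bit0 num.One"]
      by (cases "l = 3") auto
    have "of_int a * of_nat p + of_int b * of_nat l = (1::complex)"
      using ab by (metis of_int_1 of_int_add of_int_mult of_int_of_nat_eq)
    then have "1 = of_nat l * (of_int b - of_int a * e' * (\<Sum>i<p. f i))"
      unfolding ps e'(2) by (simp add: algebra_simps)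
    then have "1 / of_nat l = of_int b - of_int a * e' * (\<Sum>i<p. f i)" using l(1) by (simp add: field_simps)
    also have "\<dots> \<in> V" by (intro in_ring e' fV)
    finally show False using l(2) by simp
  next
    case 1
    from le show False
    proof (elim disjE conjE)
      assume "l = 3" "e = 3"
      then have "0 = 1 + \<mu> + \<mu> ^ 2" using sum0 1 by (simp add: eval_nat_numeral)
      also have "\<dots> = 3 * (1 + 3 * (t + t ^ 2))" by (simp add: \<mu>_def \<open>e = 3\<close> algebra_simps power2_eq_square)
      finally have "1 + 3 * (t + t ^ 2) = 0" by (metis mult_eq_0_iff zero_neq_numeral)
      then have "1 = 3 * - (t + t ^ 2)" by (simp only: eq_neg_iff_add_eq_0 mult_minus_right)
      then have "1 / of_nat l = - (t + t ^ 2)"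
        unfolding \<open>l = 3\<close> by (metis nonzero_mult_div_cancel_left of_nat_numeral zero_neq_numeral)
      also have "\<dots> \<in> V" by (intro in_ring t)
      finally show False using l(2) by simp
    next
      assume "l = 2" "e = 4"
      then have "0 = 1 + \<mu>" using sum0 1 by (simp add: eval_nat_numeral)
      also have "\<dots> = 2 * (1 + 2 * t)" by (simp add: \<mu>_def \<open>e = 4\<close> algebra_simps)
      finally have "1 + 2 * t = 0" by (metis mult_eq_0_iff zero_neq_numeral)
      then have "1 = 2 * - t" by (simp only: eq_neg_iff_add_eq_0 mult_minus_right)
      then have "1 / of_nat l = - t"
        unfolding \<open>l = 2\<close> by (metis nonzero_mult_div_cancel_left of_nat_numeral zero_neq_numeral)
      also have "\<dots> \<in> V" by (intro in_ring t)
      finally show False using l(2) by simp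
    qed
  qed
qed

text \<open>With \<open>N = p * k\<close>, the prime case applied to the \<open>k\<close>-th power
  strips one prime off the exponent.\<close>

lemma root_of_unity_congruent:
  assumes le: "l = 3 \<and> e = 3 \<or> l = 2 \<and> e = 4" and t: "t \<in> V"
  shows "N > 0 \<Longrightarrow> (1 + e * t) ^ N = 1 \<Longrightarrow> e * t = 0"
proof (induction N rule: less_induct)
  case (less N)
  have eV: "e \<in> V" using le in_ring(9) by auto
  show ?case
  proof (cases "N = 1")
    case True then show ?thesis using less.prems by simp
  next
    case False
    then obtain p where p: "Factorial_Ring.prime p" "p dvd N" using prime_factor_nat by blast
    then obtain k where k: "N = p * k" by (elim dvdE)
    obtain t' where t': "t' \<in> V" "(1 + e * t) ^ k = 1 + e * t'" using congruent_power[OF t eV] by blast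
    have "(1 + e * t') ^ p = 1" using less.prems(2) unfolding k t'(2)[symmetric] by (simp add: power_mult mult.commute flip: power_mult)
    then have "e * t' = 0" by (rule root_of_unity_congruent_prime[OF le t'(1) p(1)])
    then have "(1 + e * t) ^ k = 1" using t'(2) by simp
    moreover have "k < N" "k > 0" using k p(1) less.prems(1) prime_gt_1_nat[OF p(1)] by auto
    ultimately show ?thesis using less.IH by blast
  qed
qed

text \<open>For a rotation by the angle of \<open>z\<close> this says that \<open>cos\<close> and \<open>sin\<close> have 2-adic absolute
  value larger than 1.\<close>

lemma root_of_unity_sum_large:
  assumes l2: "l = 2" and z: "z ^ N = 1" "N > 0" "z ^ 4 \<noteq> 1"
  shows "lt 2 (1 + z ^ 2)"
  unfolding lt_def
proof
  assume "le (1 + z ^ 2) 2"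
  \<comment> \<open>If 2 divided \<open>1 + z ^ 2\<close>, then \<open>z ^ 4\<close> would be a root
    of unity congruent to 1 modulo 4, hence 1.\<close>
  then obtain a where a: "a \<in> V" "1 + z ^ 2 = a * 2" unfolding le_def by blast
  have "z ^ 2 = a * 2 - 1" using a(2) by (simp add: algebra_simps)
  have "z ^ 4 = (z ^ 2) ^ 2" by (simp flip: power_mult)
  also have "\<dots> = 1 + 4 * (a ^ 2 - a)"
    unfolding \<open>z ^ 2 = _\<close> by (simp add: power2_eq_square algebra_simps)
  finally have z4: "z ^ 4 = 1 + 4 * (a ^ 2 - a)" .
  have "(z ^ 4) ^ N = (z ^ N) ^ 4" by (simp add: mult.commute flip: power_mult)
  then have "(1 + 4 * (a ^ 2 - a)) ^ N = 1" by (simp only: z4 z(1) power_one)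
  then have "4 * (a ^ 2 - a) = 0" using l2 z(2) by (intro root_of_unity_congruent[of 4 "a ^ 2 - a" N] in_ring a) auto
  then show False using z4 z(3) by simp
qed

end

section \<open>Unitary matrices and the Clifford group\<close>

lemma abelian_group_complex_ring: "abelian_group complex_ring"
  by (rule abelian_groupI) (auto simp: complex_ring_def intro: exI[of _ "- _"] add.left_inverse)

lemma a_inv_complex_ring: "\<ominus>\<^bsub>complex_ring\<^esub> x = - x"
  by (rule abelian_group.minus_equality[OF abelian_group_complex_ring]) (simp_all add: complex_ring_def)

lemma csubring_subring_gen: "csubring (subring_gen S)"
  unfolding csubring_def subring_gen_def
proof (intro conjI ballI)
  show "1 \<in> generate_ring complex_ring S"
    using generate_ring.one[of complex_ring S] by (simp add: complex_ring_def)
  fix x y assume x: "x \<in> generate_ring complex_ring S" and y: "y \<in> generate_ring complex_ring S"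
  show "x - y \<in> generate_ring complex_ring S"
    using generate_ring.eng_add[OF x generate_ring.a_inv[OF y]]
    unfolding a_inv_complex_ring by (simp add: complex_ring_def)
  show "x * y \<in> generate_ring complex_ring S"
    using generate_ring.eng_mult[OF x y] by (simp add: complex_ring_def)
qed

lemma subring_gen_incl: "x \<in> S \<Longrightarrow> x \<in> subring_gen S"
  unfolding subring_gen_def by (rule generate_ring.incl)

lemma subring_gen_minimal:
  assumes R: "csubring R" and "S \<subseteq> R"
  shows "subring_gen S \<subseteq> R"
proof
  fix x assume "x \<in> subring_gen S"
  then show "x \<in> R" unfolding subring_gen_def
  proof (induction rule: generate_ring.induct)
    case one then show ?case using csubring_1[OF R] by (simp add: complex_ring_def)
  next
    case (incl h) then show ?case using assms(2) by blast
  next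
    case (a_inv h) then show ?case using csubring_minus[OF R] by (simp add: a_inv_complex_ring)
  next
    case (eng_add h1 h2) then show ?case using csubring_add[OF R] by (simp add: complex_ring_def)
  next
    case (eng_mult h1 h2) then show ?case using csubring_mult[OF R] by (simp add: complex_ring_def)
  qed
qed

section \<open>Two-by-two matrices and unitarity\<close>

definition mat2 :: "complex \<Rightarrow> complex \<Rightarrow> complex \<Rightarrow> complex \<Rightarrow> complex^2^2" where
  "mat2 a b c d = vector [vector [a, b], vector [c, d]]"

lemma mat2_nth [simp]:
  "mat2 a b c d $ 1 $ 1 = a" "mat2 a b c d $ 1 $ 2 = b" "mat2 a b c d $ 2 $ 1 = c" "mat2 a b c d $ 2 $ 2 = d"
  unfolding mat2_def by (simp_all add: vector_2)

lemma mat2_eqI: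
  fixes A B :: "complex^2^2"
  assumes "A $ 1 $ 1 = B $ 1 $ 1" "A $ 1 $ 2 = B $ 1 $ 2" "A $ 2 $ 1 = B $ 2 $ 1" "A $ 2 $ 2 = B $ 2 $ 2"
  shows "A = B"
  using assms by (simp add: vec_eq_iff forall_2)

lemma mat2_eq_iff: "mat2 a b c d = mat2 a' b' c' d' \<longleftrightarrow> a = a' \<and> b = b' \<and> c = c' \<and> d = d'"
  by (metis mat2_nth)

lemma mat2_cases: obtains a b c d where "A = mat2 a b c d"
  by (rule that[of "A $ 1 $ 1" "A $ 1 $ 2" "A $ 2 $ 1" "A $ 2 $ 2"]) (rule mat2_eqI; simp)

lemma matrix_mult_2: "((A :: complex^2^2) ** B) $ i $ j = A $ i $ 1 * B $ 1 $ j + A $ i $ 2 * B $ 2 $ j"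
  by (simp add: matrix_matrix_mult_def sum_2)

lemma mat2_mult:
  "mat2 a b c d ** mat2 a' b' c' d' = mat2 (a * a' + b * c') (a * b' + b * d') (c * a' + d * c') (c * b' + d * d')"
  by (rule mat2_eqI) (simp_all add: matrix_mult_2)

lemma dagger_mat2: "dagger (mat2 a b c d) = mat2 (cnj a) (cnj c) (cnj b) (cnj d)"
  by (rule mat2_eqI) (simp_all add: dagger_def)

lemma mat_mat2: "mat c = mat2 c 0 0 c"
  by (rule mat2_eqI) (simp_all add: mat_def)

lemma det_mat2: "det (mat2 a b c d) = a * d - b * c"
  by (simp add: det_2)

lemma dagger_mult: "dagger (A ** B) = dagger B ** dagger A"
  by (cases A rule: mat2_cases; cases B rule: mat2_cases) (simp add: mat2_mult dagger_mat2 mult.commute)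

lemma dagger_dagger: "dagger (dagger A) = A"
  by (cases A rule: mat2_cases) (simp add: dagger_mat2)

lemma entries_in_mat2: "entries_in R (mat2 a b c d) \<longleftrightarrow> a \<in> R \<and> b \<in> R \<and> c \<in> R \<and> d \<in> R"
  by (auto simp: entries_in_def forall_2)

lemma entries_in_mult: "csubring R \<Longrightarrow> entries_in R A \<Longrightarrow> entries_in R B \<Longrightarrow> entries_in R (A ** B)"
  by (cases A rule: mat2_cases; cases B rule: mat2_cases)
    (simp add: mat2_mult entries_in_mat2 csubring_add csubring_mult)

text \<open>The inverse is forced to be \<open>dagger g\<close>, so invertibility over
  \<open>R\<close> becomes a condition on the conjugate entries.\<close>

lemma U2_iff:
  "g \<in> carrier (U2 R) \<longleftrightarrow> entries_in R g \<and> entries_in R (dagger g) \<and> g ** dagger g = mat 1"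
proof
  assume "g \<in> carrier (U2 R)"
  then obtain B where B: "entries_in R g" "entries_in R B" "g ** B = mat 1" "B ** g = mat 1" "g ** dagger g = mat 1"
    unfolding U2_def GL2_def by auto
  have "B = B ** (g ** dagger g)" using B(5) by simp
  also have "\<dots> = dagger g" using B(4) by (simp add: matrix_mul_assoc)
  finally show "entries_in R g \<and> entries_in R (dagger g) \<and> g ** dagger g = mat 1" using B by simp
next
  assume g: "entries_in R g \<and> entries_in R (dagger g) \<and> g ** dagger g = mat 1"
  then have "dagger g ** g = mat 1" using matrix_left_right_inverse by blast
  then show "g \<in> carrier (U2 R)" using g unfolding U2_def GL2_def by auto
qed

lemma U2_simps: "monoid.mult (U2 R) = (**)" "one (U2 R) = mat 1"
  by (simp_all add: U2_def)

lemma U2_unitary: "g \<in> carrier (U2 R) \<Longrightarrow> g ** dagger g = mat 1 \<and> dagger g ** g = mat 1"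
  using U2_iff matrix_left_right_inverse by blast

lemma group_U2:
  assumes R: "csubring R"
  shows "group (U2 R)"
proof (rule groupI)
  fix x y assume xy: "x \<in> carrier (U2 R)" "y \<in> carrier (U2 R)"
  have "(x ** y) ** dagger (x ** y) = x ** (y ** dagger y) ** dagger x"
    by (simp add: dagger_mult matrix_mul_assoc)
  also have "\<dots> = mat 1" using xy by (simp add: U2_iff)
  finally show "x \<otimes>\<^bsub>U2 R\<^esub> y \<in> carrier (U2 R)"
    using xy entries_in_mult[OF R] unfolding U2_iff U2_simps dagger_mult by blast
next
  show "\<one>\<^bsub>U2 R\<^esub> \<in> carrier (U2 R)"
    unfolding U2_iff U2_simps mat_mat2 dagger_mat2 mat2_mult entries_in_mat2
    using csubring_0[OF R] csubring_1[OF R] by simp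
next
  fix x assume x: "x \<in> carrier (U2 R)"
  have "dagger x \<in> carrier (U2 R)" using x U2_unitary[OF x] unfolding U2_iff dagger_dagger by blast
  then show "\<exists>y\<in>carrier (U2 R). y \<otimes>\<^bsub>U2 R\<^esub> x = \<one>\<^bsub>U2 R\<^esub>"
    using U2_unitary[OF x] unfolding U2_simps by blast
qed (simp_all add: U2_simps matrix_mul_assoc)

lemma inv_U2:
  assumes R: "csubring R" and g: "g \<in> carrier (U2 R)"
  shows "inv\<^bsub>U2 R\<^esub> g = dagger g"
proof (rule group.inv_equality[OF group_U2[OF R]])
  show "dagger g \<otimes>\<^bsub>U2 R\<^esub> g = \<one>\<^bsub>U2 R\<^esub>" using U2_unitary[OF g] by (simp add: U2_simps)
  show "dagger g \<in> carrier (U2 R)" using g U2_unitary[OF g] unfolding U2_iff dagger_dagger by blast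
qed (use g in simp)

section \<open>Roots of unity and the ring \<open>Rn n\<close>\<close>

definition mu :: "nat \<Rightarrow> complex set" where
  "mu n = {z. z ^ n = 1}"

lemma mu_mult: "x \<in> mu n \<Longrightarrow> y \<in> mu n \<Longrightarrow> x * y \<in> mu n"
  and mu_inverse: "x \<in> mu n \<Longrightarrow> 1 / x \<in> mu n"
  and mu_divide: "x \<in> mu n \<Longrightarrow> y \<in> mu n \<Longrightarrow> x / y \<in> mu n"
  and mu_1: "1 \<in> mu n"
  by (simp_all add: mu_def power_mult_distrib power_divide)

lemma mu_nonzero: "n > 0 \<Longrightarrow> x \<in> mu n \<Longrightarrow> x \<noteq> 0"
  by (auto simp: mu_def power_0_left)

lemma mu_dvd: "m dvd n \<Longrightarrow> mu m \<subseteq> mu n"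
  by (auto simp: mu_def power_mult elim!: dvdE)

lemma mu_cnj: assumes "n > 0" "x \<in> mu n" shows "cnj x = 1 / x"
proof -
  have "norm x ^ n = 1" using assms by (simp add: mu_def flip: norm_power)
  then have "norm x = 1" using assms(1) by (intro power_eq_imp_eq_base[of "norm x" n 1]) simp_all
  then have "x * cnj x = 1" by (simp add: complex_norm_square[symmetric])
  then show ?thesis using mu_nonzero[OF assms] by (simp add: field_simps)
qed

lemma card_mu: "n > 0 \<Longrightarrow> card (mu n) = n" and finite_mu: "n > 0 \<Longrightarrow> finite (mu n)"
proof -
  assume n: "n > 0"
  show "card (mu n) = n" unfolding mu_def by (rule card_roots_unity_eq[OF n])
  then show "finite (mu n)" using n card.infinite by fastforce
qed

lemma zeta_power: "\<zeta> n ^ k = cis (2 * pi * real k / real n)"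
proof -
  have z: "\<zeta> n = cis (2 * pi / real n)" unfolding \<zeta>_def cis_conv_exp by (simp add: mult_ac)
  show ?thesis unfolding z Complex.DeMoivre by (simp add: field_simps)
qed

lemma mu_eq_powers: "n > 0 \<Longrightarrow> mu n = (\<lambda>k. \<zeta> n ^ k) ` {..<n}"
  using Complex.bij_betw_roots_unity[of n] unfolding mu_def zeta_power by (simp add: bij_betw_def)

lemma zeta_in_mu: "n > 0 \<Longrightarrow> \<zeta> n \<in> mu n"
proof -
  assume n: "n > 0"
  have "\<zeta> n ^ n = 1" using n by (simp add: zeta_power)
  then show ?thesis by (simp add: mu_def)
qed

lemma mu_4: "mu 4 = {1, -1, \<i>, - \<i>}"
proof (rule Set.set_eqI)
  fix z :: complex
  have "(z - 1) * ((z + 1) * ((z - \<i>) * (z + \<i>))) = z ^ 4 - 1"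
    by (simp add: algebra_simps power4_eq_xxxx)
  then have "z ^ 4 = 1 \<longleftrightarrow> (z - 1) * ((z + 1) * ((z - \<i>) * (z + \<i>))) = 0" by simp
  also have "\<dots> \<longleftrightarrow> z - 1 = 0 \<or> z + 1 = 0 \<or> z - \<i> = 0 \<or> z + \<i> = 0" by (simp only: mult_eq_0_iff)
  also have "\<dots> \<longleftrightarrow> z \<in> {1, -1, \<i>, - \<i>}"
    by (simp only: right_minus_eq insert_iff empty_iff simp_thms eq_neg_iff_add_eq_0)
  finally show "z \<in> mu 4 \<longleftrightarrow> z \<in> {1, -1, \<i>, - \<i>}" by (simp only: mu_def mem_Collect_eq)
qed

lemma csubring_Rn: "csubring (Rn n)"
  unfolding Rn_def by (rule csubring_subring_gen)

lemma mu_subset_Rn: "n > 0 \<Longrightarrow> mu n \<subseteq> Rn n"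
proof -
  assume "n > 0"
  have "\<zeta> n \<in> Rn n" unfolding Rn_def by (rule subring_gen_incl) simp
  then show ?thesis unfolding mu_eq_powers[OF \<open>n > 0\<close>] using csubring_power[OF csubring_Rn] by blast
qed

section \<open>The Clifford group and sums of four squares\<close>

abbreviation "Zi2 \<equiv> subring_gen {\<i>, 1 / 2}"

lemma Zi2_form: "z \<in> Zi2 \<Longrightarrow> \<exists>p q :: int. \<exists>k :: nat. z = (of_int p + \<i> * of_int q) / 2 ^ k"
proof -
  let ?S = "{z. \<exists>p q :: int. \<exists>k :: nat. z = (of_int p + \<i> * of_int q) / 2 ^ k}"
  have "csubring ?S"
    unfolding csubring_def
  proof (intro conjI ballI)
    show "1 \<in> ?S" by (intro CollectI exI[of _ 1] exI[of _ 0] exI[of _ "0 :: nat"]) simp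
    fix x y assume "x \<in> ?S" "y \<in> ?S"
    then obtain p q p' q' :: int and k k' :: nat where x: "x = (of_int p + \<i> * of_int q) / 2 ^ k"
      and y: "y = (of_int p' + \<i> * of_int q') / 2 ^ k'" by blast
    show "x - y \<in> ?S"
      by (intro CollectI exI[of _ "p * 2 ^ k' - p' * 2 ^ k"] exI[of _ "q * 2 ^ k' - q' * 2 ^ k"] exI[of _ "k + k'"])
        (simp add: x y field_simps power_add)
    show "x * y \<in> ?S"
      by (intro CollectI exI[of _ "p * p' - q * q'"] exI[of _ "p * q' + q * p'"] exI[of _ "k + k'"])
        (simp add: x y field_simps power_add)
  qed
  moreover have "{\<i>, 1 / 2} \<subseteq> ?S"
  proof -
    have "\<i> \<in> ?S" by (intro CollectI exI[of _ 0] exI[of _ 1] exI[of _ "0 :: nat"]) simp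
    moreover have "1 / 2 \<in> ?S" by (intro CollectI exI[of _ 1] exI[of _ 0] exI[of _ "1 :: nat"]) simp
    ultimately show ?thesis by blast
  qed
  ultimately have "Zi2 \<subseteq> ?S" by (rule subring_gen_minimal)
  then show "z \<in> Zi2 \<Longrightarrow> ?thesis" by blast
qed

lemma square_mod_8: "even x \<Longrightarrow> (x :: int)\<^sup>2 mod 8 \<in> {0, 4}" "odd x \<Longrightarrow> x\<^sup>2 mod 8 = 1"
proof -
  have "x mod 8 \<in> {0, 1, 2, 3, 4, 5, 6, 7}" using pos_mod_bound[of 8 x] pos_mod_sign[of 8 x] by auto
  moreover have "x\<^sup>2 mod 8 = (x mod 8)\<^sup>2 mod 8" by (simp add: power_mod)
  moreover have "even x \<longleftrightarrow> even (x mod 8)" by presburger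
  ultimately show "even x \<Longrightarrow> x\<^sup>2 mod 8 \<in> {0, 4}" "odd x \<Longrightarrow> x\<^sup>2 mod 8 = 1" by auto
qed

text \<open>Squares are 0, 1 or 4 modulo 8. Divisibility of the sum by 4 makes all or none of the
  terms odd, and four odd squares add up to 4 modulo 8.\<close>

lemma four_squares_even:
  fixes p q r s :: int
  assumes "8 dvd p\<^sup>2 + q\<^sup>2 + r\<^sup>2 + s\<^sup>2"
  shows "even p \<and> even q \<and> even r \<and> even s"
proof -
  have c: "\<exists>a e. x\<^sup>2 = 8 * a + e \<and> (even x \<and> (e = 0 \<or> e = 4) \<or> odd x \<and> e = 1)" for x :: int
    using square_mod_8[of x] mult_div_mod_eq[of 8 "x\<^sup>2"] by (intro exI[of _ "x\<^sup>2 div 8"] exI[of _ "x\<^sup>2 mod 8"]) auto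
  obtain a e where p: "p\<^sup>2 = 8 * a + e" "even p \<and> (e = 0 \<or> e = 4) \<or> odd p \<and> e = 1" using c[of p] by blast
  obtain b f where q: "q\<^sup>2 = 8 * b + f" "even q \<and> (f = 0 \<or> f = 4) \<or> odd q \<and> f = 1" using c[of q] by blast
  obtain c g where r: "r\<^sup>2 = 8 * c + g" "even r \<and> (g = 0 \<or> g = 4) \<or> odd r \<and> g = 1" using c[of r] by blast
  obtain d h where s: "s\<^sup>2 = 8 * d + h" "even s \<and> (h = 0 \<or> h = 4) \<or> odd s \<and> h = 1" using c[of s] by blast
  have "8 dvd (8 * a + e) + (8 * b + f) + (8 * c + g) + (8 * d + h)" using assms unfolding p(1) q(1) r(1) s(1) .
  moreover have "(8 * a + e) + (8 * b + f) + (8 * c + g) + (8 * d + h) = 8 * (a + b + c + d) + (e + f + g + h)"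
    by (simp add: algebra_simps)
  ultimately have "8 dvd e + f + g + h" using dvd_add_right_iff[of 8 "8 * (a + b + c + d)" "e + f + g + h"] by simp
  moreover have "e = 0 \<or> e = 1 \<or> e = 4" "f = 0 \<or> f = 1 \<or> f = 4" "g = 0 \<or> g = 1 \<or> g = 4" "h = 0 \<or> h = 1 \<or> h = 4"
    using p(2) q(2) r(2) s(2) by blast+
  ultimately have "e \<noteq> 1 \<and> f \<noteq> 1 \<and> g \<noteq> 1 \<and> h \<noteq> 1" by (elim disjE; simp)
  then show ?thesis using p(2) q(2) r(2) s(2) by blast
qed

text \<open>Halving stops at sum 4 rather than 1, because 4 is also a sum of four odd squares; that
  solution accounts for the Hadamard matrix.\<close>

lemma four_squares_descent:
  fixes p q r s :: int
  assumes "p\<^sup>2 + q\<^sup>2 + r\<^sup>2 + s\<^sup>2 = 4 ^ Suc k"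
  shows "\<exists>p' q' r' s'. p = 2 ^ k * p' \<and> q = 2 ^ k * q' \<and> r = 2 ^ k * r' \<and> s = 2 ^ k * s' \<and>
    p'\<^sup>2 + q'\<^sup>2 + r'\<^sup>2 + s'\<^sup>2 = 4"
  using assms
proof (induction k arbitrary: p q r s)
  case (Suc k)
  have "8 dvd p\<^sup>2 + q\<^sup>2 + r\<^sup>2 + s\<^sup>2" unfolding Suc.prems by simp
  then obtain a b c d where e: "p = 2 * a" "q = 2 * b" "r = 2 * c" "s = 2 * d"
    using four_squares_even by (metis evenE)
  have "4 * (a\<^sup>2 + b\<^sup>2 + c\<^sup>2 + d\<^sup>2) = 4 * 4 ^ Suc k" using Suc.prems unfolding e by (simp add: power_mult_distrib)
  then have "a\<^sup>2 + b\<^sup>2 + c\<^sup>2 + d\<^sup>2 = 4 ^ Suc k" by simp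
  from Suc.IH[OF this] obtain p' q' r' s' where "a = 2 ^ k * p'" "b = 2 ^ k * q'" "c = 2 ^ k * r'" "d = 2 ^ k * s'"
    "p'\<^sup>2 + q'\<^sup>2 + r'\<^sup>2 + s'\<^sup>2 = 4" by blast
  then show ?case unfolding e by (intro exI[of _ p'] exI[of _ q'] exI[of _ r'] exI[of _ s']) simp
qed simp

lemma four_squares_4:
  fixes p q r s :: int
  assumes "p\<^sup>2 + q\<^sup>2 + r\<^sup>2 + s\<^sup>2 = 4"
  shows "(\<bar>p\<bar> = 1 \<and> \<bar>q\<bar> = 1 \<and> \<bar>r\<bar> = 1 \<and> \<bar>s\<bar> = 1) \<or> (r = 0 \<and> s = 0 \<and> (\<bar>p\<bar> = 2 \<and> q = 0 \<or> p = 0 \<and> \<bar>q\<bar> = 2)) \<or>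
    (p = 0 \<and> q = 0 \<and> (\<bar>r\<bar> = 2 \<and> s = 0 \<or> r = 0 \<and> \<bar>s\<bar> = 2))"
proof -
  have b: "x \<in> {-2, -1, 0, 1, 2}" if "x\<^sup>2 \<le> 4" for x :: int
  proof -
    have "\<bar>x\<bar> \<le> 2" using that power2_le_iff_abs_le[of 2 x] by simp
    then show ?thesis by auto
  qed
  have "p\<^sup>2 \<ge> 0" "q\<^sup>2 \<ge> 0" "r\<^sup>2 \<ge> 0" "s\<^sup>2 \<ge> 0" by simp_all
  then have "p\<^sup>2 \<le> 4" "q\<^sup>2 \<le> 4" "r\<^sup>2 \<le> 4" "s\<^sup>2 \<le> 4" using assms by linarith+
  then have "p \<in> {-2, -1, 0, 1, 2}" "q \<in> {-2, -1, 0, 1, 2}" "r \<in> {-2, -1, 0, 1, 2}" "s \<in> {-2, -1, 0, 1, 2}"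
    using b by blast+
  then show ?thesis using assms by (elim insertE emptyE) simp_all
qed

text \<open>\<open>rho\<close> is \<open>1 / (1 + \<i>)\<close>.\<close>

definition rho :: complex where "rho = (1 - \<i>) / 2"

lemma rho_cnj: "rho * cnj rho = 1 / 2" "rho \<noteq> 0"
  by (simp_all add: rho_def complex_eq_iff)

text \<open>Clearing denominators in a unit row gives four squares whose sum is a power of 4, and
  the descent leaves the sum 4. Its 8 + 16 solutions are the doubled units of the Hurwitz
  quaternions.\<close>

lemma Zi2_unit_row:
  assumes a: "a \<in> Zi2" "b \<in> Zi2" and n: "a * cnj a + b * cnj b = 1"
  shows "(a \<in> mu 4 \<and> b = 0) \<or> (a = 0 \<and> b \<in> mu 4) \<or> (a / rho \<in> mu 4 \<and> b / rho \<in> mu 4)"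
proof -
  obtain p q r s :: int and k k' :: nat where ab: "a = (of_int p + \<i> * of_int q) / 2 ^ k"
    "b = (of_int r + \<i> * of_int s) / 2 ^ k'"
    using Zi2_form[OF a(1)] Zi2_form[OF a(2)] by blast
  define K where "K = k + k'"
  \<comment> \<open>The extra factor 2 makes the exponent a successor, as the descent
    requires.\<close>
  define P where "P = p * 2 ^ k' * 2"
  define Q where "Q = q * 2 ^ k' * 2"
  define R where "R = r * 2 ^ k * 2"
  define S where "S = s * 2 ^ k * 2"
  have a': "a = (of_int P + \<i> * of_int Q) / 2 ^ Suc K" and b': "b = (of_int R + \<i> * of_int S) / 2 ^ Suc K"
    unfolding ab P_def Q_def R_def S_def K_def by (simp_all add: field_simps power_add)
  have "Re (a * cnj a + b * cnj b) = (of_int (P\<^sup>2 + Q\<^sup>2 + R\<^sup>2 + S\<^sup>2)) / 4 ^ Suc K"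
  proof -
    have c: "(2 :: complex) ^ Suc K = of_real (2 ^ Suc K)" by simp
    have f: "Re a = of_int P / 2 ^ Suc K" "Im a = of_int Q / 2 ^ Suc K" "Re b = of_int R / 2 ^ Suc K" "Im b = of_int S / 2 ^ Suc K"
      unfolding a' b' c Re_divide_of_real Im_divide_of_real by (simp_all del: power_Suc)
    have "((2::real) ^ Suc K)\<^sup>2 = 4 ^ Suc K" by (simp add: power_mult_distrib power2_eq_square flip: power_mult_distrib)
    then show ?thesis using f by (simp add: power2_eq_square[symmetric] power_divide add_divide_distrib del: power_Suc)
  qed
  then have "(of_int (P\<^sup>2 + Q\<^sup>2 + R\<^sup>2 + S\<^sup>2) :: real) = of_int (4 ^ Suc K)" using n by (simp add: field_simps)
  then have "P\<^sup>2 + Q\<^sup>2 + R\<^sup>2 + S\<^sup>2 = 4 ^ Suc K" by (simp only: of_int_eq_iff)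
  from four_squares_descent[OF this] obtain p' q' r' s' where e: "P = 2 ^ K * p'" "Q = 2 ^ K * q'" "R = 2 ^ K * r'" "S = 2 ^ K * s'"
    "p'\<^sup>2 + q'\<^sup>2 + r'\<^sup>2 + s'\<^sup>2 = 4" by blast
  have A: "a = (of_int p' + \<i> * of_int q') / 2" and B: "b = (of_int r' + \<i> * of_int s') / 2"
    unfolding a' b' e by (simp_all add: field_simps)
  have quot: "z / rho \<in> mu 4" if "\<bar>x\<bar> = 1" "\<bar>y\<bar> = 1" "z = (of_int x + \<i> * of_int y) / 2" for x y :: int and z
  proof -
    have "x = 1 \<or> x = -1" "y = 1 \<or> y = -1" using that by linarith+
    then show ?thesis unfolding that(3) mu_4 rho_def by (auto simp: field_simps)
  qed
  have un: "z \<in> mu 4" if "\<bar>x\<bar> = 2 \<and> y = 0 \<or> x = 0 \<and> \<bar>y\<bar> = 2" "z = (of_int x + \<i> * of_int y) / 2" for x y :: int and z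
  proof -
    have "(x = 2 \<or> x = -2) \<and> y = 0 \<or> x = 0 \<and> (y = 2 \<or> y = -2)" using that by linarith
    then show ?thesis unfolding that(2) mu_4 by auto
  qed
  from four_squares_4[OF e(5)] show ?thesis
  proof (elim disjE)
    assume "\<bar>p'\<bar> = 1 \<and> \<bar>q'\<bar> = 1 \<and> \<bar>r'\<bar> = 1 \<and> \<bar>s'\<bar> = 1"
    then have "a / rho \<in> mu 4" "b / rho \<in> mu 4" using quot[OF _ _ A] quot[OF _ _ B] by blast+
    then show ?thesis by blast
  next
    assume h: "r' = 0 \<and> s' = 0 \<and> (\<bar>p'\<bar> = 2 \<and> q' = 0 \<or> p' = 0 \<and> \<bar>q'\<bar> = 2)"
    then have "a \<in> mu 4" using un[OF _ A] by blast
    moreover have "b = 0" using B h by simp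
    ultimately show ?thesis by blast
  next
    assume h: "p' = 0 \<and> q' = 0 \<and> (\<bar>r'\<bar> = 2 \<and> s' = 0 \<or> r' = 0 \<and> \<bar>s'\<bar> = 2)"
    then have "b \<in> mu 4" using un[OF _ B] by blast
    moreover have "a = 0" using A h by simp
    ultimately show ?thesis by blast
  qed
qed

text \<open>\<open>hmat 1 1 1\<close> is the Hadamard matrix up to a scalar; \<open>hmat u p q\<close> with \<open>p\<close>, \<open>q\<close> in
  \<open>mu 4\<close> are the matrices that conjugate no diagonal Pauli matrix to a diagonal one.\<close>

definition diag2 :: "complex \<Rightarrow> complex \<Rightarrow> complex^2^2" where "diag2 u v = mat2 u 0 0 v"

definition antidiag2 :: "complex \<Rightarrow> complex \<Rightarrow> complex^2^2" where "antidiag2 u v = mat2 0 u v 0"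

definition hmat :: "complex \<Rightarrow> complex \<Rightarrow> complex \<Rightarrow> complex^2^2" where
  "hmat u p q = mat2 (rho * u) (rho * (u * p)) (rho * (u * q)) (- (rho * (u * p * q)))"

lemma mat_mult_dg: "mat c ** diag2 u v = diag2 (c * u) (c * v)" "mat c ** antidiag2 u v = antidiag2 (c * u) (c * v)"
    "mat c ** hmat u p q = hmat (c * u) p q"
  by (simp_all add: mat_mat2 diag2_def antidiag2_def hmat_def mat2_mult algebra_simps)

lemma dg_mult: "diag2 u v ** diag2 u' v' = diag2 (u * u') (v * v')" "diag2 u v ** antidiag2 u' v' = antidiag2 (u * u') (v * v')"
    "antidiag2 u v ** diag2 u' v' = antidiag2 (u * v') (v * u')" "antidiag2 u v ** antidiag2 u' v' = diag2 (u * v') (v * u')"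
  by (simp_all add: diag2_def antidiag2_def mat2_mult)

lemma nn_decomp: "hmat u p q = diag2 u u ** (diag2 1 q ** (hmat 1 1 1 ** diag2 1 p))"
  by (simp add: diag2_def hmat_def mat2_mult algebra_simps)

lemma rho_in: "rho \<in> Zi2" "\<i> \<in> Zi2"
proof -
  have R: "csubring Zi2" by (rule csubring_subring_gen)
  show i: "\<i> \<in> Zi2" by (rule subring_gen_incl) simp
  have h: "1 / 2 \<in> Zi2" by (rule subring_gen_incl) simp
  have "rho = (1 - \<i>) * (1 / 2)" by (simp add: rho_def)
  then show "rho \<in> Zi2" using csubring_mult[OF R csubring_diff[OF R csubring_1[OF R] i] h] by (simp only:)
qed

lemma mu_4_in: "mu 4 \<subseteq> Zi2"
  using csubringD[OF csubring_subring_gen[of "{\<i>, 1 / 2}"]] rho_in(2) unfolding mu_4 by auto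

lemma mu_4_cnj: "u \<in> mu 4 \<Longrightarrow> cnj u \<in> mu 4"
  unfolding mu_4 by auto

lemma mu_4_cnj_mult: "u \<in> mu 4 \<Longrightarrow> u * cnj u = 1"
  unfolding mu_4 by auto

lemma Clifford_mem:
  assumes "u \<in> mu 4" "v \<in> mu 4"
  shows "diag2 u v \<in> Clifford" "antidiag2 u v \<in> Clifford" "w \<in> mu 4 \<Longrightarrow> hmat u v w \<in> Clifford"
proof -
  have R: "csubring Zi2" by (rule csubring_subring_gen)
  note m = subsetD[OF mu_4_in] and c = mu_4_cnj_mult
  have c2: "x * cnj x = 1 \<Longrightarrow> cnj x * x = 1" for x :: complex by (simp add: mult.commute)
  show "diag2 u v \<in> Clifford" "antidiag2 u v \<in> Clifford"
    unfolding Clifford_def U2_iff diag2_def antidiag2_def dagger_mat2 entries_in_mat2 mat_mat2 mat2_mult mat2_eq_iff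
    using assms m mu_4_cnj c csubring_0[OF R] by simp_all
  assume w: "w \<in> mu 4"
  have rc: "cnj rho \<in> Zi2"
  proof -
    have "cnj rho = \<i> * rho" by (simp add: rho_def algebra_simps complex_eq_iff)
    then show ?thesis using csubring_mult[OF R rho_in(2,1)] by simp
  qed
  have e: "entries_in Zi2 (hmat u v w)" "entries_in Zi2 (dagger (hmat u v w))"
    unfolding hmat_def dagger_mat2 entries_in_mat2 complex_cnj_mult complex_cnj_minus
    by (intro conjI csubring_mult[OF R] csubring_minus[OF R] rho_in rc m assms w mu_4_cnj)+
  have "hmat u v w ** dagger (hmat u v w) = mat2
     (rho * cnj rho * (u * cnj u) * (1 + v * cnj v)) (rho * cnj rho * (u * cnj u) * cnj w * (1 - v * cnj v))
     (rho * cnj rho * (u * cnj u) * w * (1 - v * cnj v)) (rho * cnj rho * (u * cnj u) * (w * cnj w) * (1 + v * cnj v))"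
    unfolding hmat_def dagger_mat2 mat2_mult mat2_eq_iff by (simp add: algebra_simps)
  also have "\<dots> = mat 1" unfolding c[OF assms(1)] c[OF assms(2)] c[OF w] rho_cnj(1) mat_mat2 by simp
  finally show "hmat u v w \<in> Clifford" unfolding Clifford_def U2_iff using e by blast
qed

text \<open>The first row fixes the shape; orthogonality and the norms of the columns determine the
  rest. The list has 16 + 16 + 64 = 96 members: four scalar multiples for each of the 24 rotations
  of the octahedron.\<close>

lemma Clifford_cases:
  assumes "g \<in> Clifford"
  shows "(\<exists>u\<in>mu 4. \<exists>v\<in>mu 4. g = diag2 u v) \<or> (\<exists>u\<in>mu 4. \<exists>v\<in>mu 4. g = antidiag2 u v) \<or>
    (\<exists>u\<in>mu 4. \<exists>p\<in>mu 4. \<exists>q\<in>mu 4. g = hmat u p q)"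
proof -
  obtain a b c d where g: "g = mat2 a b c d" by (rule mat2_cases)
  have u: "g ** dagger g = mat 1" "dagger g ** g = mat 1" using assms U2_unitary unfolding Clifford_def by blast+
  have e: "a \<in> Zi2" "b \<in> Zi2" "c \<in> Zi2" "d \<in> Zi2"
    using assms unfolding Clifford_def U2_iff g entries_in_mat2 by blast+
  have r: "a * cnj a + b * cnj b = 1" "c * cnj c + d * cnj d = 1" "c * cnj a + d * cnj b = 0"
    and col: "a * cnj a + c * cnj c = 1" "b * cnj b + d * cnj d = 1"
    using u unfolding g dagger_mat2 mat_mat2 mat2_mult mat2_eq_iff by (simp_all add: mult.commute)
  have nz: "z \<noteq> 0" if "z \<in> mu 4" for z using mu_nonzero[OF _ that] by simp
  have one: "z * cnj z = 1" if "z \<in> mu 4" for z by (rule mu_4_cnj_mult[OF that])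
  have half: "z * cnj z = 1 / 2" if "z / rho \<in> mu 4" for z
  proof -
    have "z = rho * (z / rho)" using rho_cnj(2) by simp
    then have "z * cnj z = rho * cnj rho * ((z / rho) * cnj (z / rho))" by (metis (no_types) complex_cnj_mult mult.assoc mult.left_commute)
    then show ?thesis using one[OF that] rho_cnj(1) by simp
  qed
  from Zi2_unit_row[OF e(1,2) r(1)] show ?thesis
  proof (elim disjE conjE)
    assume h: "a \<in> mu 4" "b = 0"
    then have "c = 0" using r(3) nz by auto
    moreover from this have "d \<in> mu 4" using Zi2_unit_row[OF e(3,4) r(2)] mu_nonzero[of 4 0] by auto
    ultimately show ?thesis using h unfolding g diag2_def by blast
  next
    assume h: "a = 0" "b \<in> mu 4"
    then have "d = 0" using r(3) nz by auto
    moreover from this have "c \<in> mu 4" using Zi2_unit_row[OF e(3,4) r(2)] mu_nonzero[of 4 0] by auto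
    ultimately show ?thesis using h unfolding g antidiag2_def by blast
  next
    assume h: "a / rho \<in> mu 4" "b / rho \<in> mu 4"
    have "c * cnj c = 1 - a * cnj a" using col(1) by (simp only: eq_diff_eq add.commute)
    then have cn: "c * cnj c = 1 / 2" unfolding half[OF h(1)] by simp
    have "c / rho \<in> mu 4"
      using Zi2_unit_row[OF e(3,4) r(2)] one[of c] cn by auto
    define u where "u = a / rho"
    define v where "v = b / rho"
    define w where "w = c / rho"
    have uvw: "u \<in> mu 4" "v \<in> mu 4" "w \<in> mu 4" unfolding u_def v_def w_def by fact+
    have abc: "a = rho * u" "b = rho * v" "c = rho * w" unfolding u_def v_def w_def using rho_cnj(2) by simp_all
    \<comment> \<open>Orthogonality of the rows, multiplied by \<open>b\<close> in order to solve
      for \<open>d\<close>.\<close>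
    have "d * (b * cnj b) = - c * cnj a * b" using r(3) by (simp add: eq_neg_iff_add_eq_0 algebra_simps) (metis distrib_left mult_zero_right mult.commute mult.left_commute)
    then have d: "d = - (2 * c * cnj a * b)" using half[OF h(2)] by (simp add: field_simps)
    have "d = - (2 * (rho * cnj rho) * (rho * (w * v * cnj u)))" unfolding d abc by simp
    also have "\<dots> = - (rho * (w * v * cnj u))" unfolding rho_cnj(1) by simp
    finally have d': "d = - (rho * (w * v * cnj u))" .
    have cu: "cnj u = 1 / u" using one[OF uvw(1)] nz[OF uvw(1)] by (simp add: field_simps)
    have "g = hmat u (v / u) (w / u)"
      unfolding g hmat_def abc d' mat2_eq_iff cu using nz[OF uvw(1)] by (simp add: field_simps)
    then show ?thesis using uvw(1) mu_divide[OF uvw(2,1)] mu_divide[OF uvw(3,1)] by blast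
  qed
qed

section \<open>Ping-pong\<close>

text \<open>Twice the coordinates of a matrix with respect to the Pauli matrices, the second one
  multiplied by \<open>\<i>\<close>.\<close>

definition cX :: "complex^2^2 \<Rightarrow> complex" where "cX M = M $ 1 $ 2 + M $ 2 $ 1"
definition cY :: "complex^2^2 \<Rightarrow> complex" where "cY M = M $ 2 $ 1 - M $ 1 $ 2"
definition cZ :: "complex^2^2 \<Rightarrow> complex" where "cZ M = M $ 1 $ 1 - M $ 2 $ 2"

definition conjm :: "complex^2^2 \<Rightarrow> complex^2^2 \<Rightarrow> complex^2^2" where
  "conjm g M = g ** M ** dagger g"

lemma conjm_mult: "conjm (g ** h) M = conjm g (conjm h M)"
  by (simp add: conjm_def dagger_mult matrix_mul_assoc)

text \<open>If \<open>w\<close> is \<open>cis t\<close>, this is the rotation about the third axis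
  by \<open>t\<close>: the coefficients are \<open>cos t\<close> and \<open>\<i> * sin t\<close>,
  and the factor \<open>\<i>\<close> is matched by the one in \<open>cY\<close>.\<close>

lemma conjm_dg:
  assumes n: "n > 0" and uv: "u \<in> mu n" "v \<in> mu n" and w: "w = v / u"
  shows "cX (conjm (diag2 u v) M) = (w + 1 / w) / 2 * cX M + (w - 1 / w) / 2 * cY M"
    "cY (conjm (diag2 u v) M) = (w - 1 / w) / 2 * cX M + (w + 1 / w) / 2 * cY M"
    "cZ (conjm (diag2 u v) M) = cZ M"
proof -
  obtain a b c d where M: "M = mat2 a b c d" by (rule mat2_cases)
  have nz: "u \<noteq> 0" "v \<noteq> 0" using mu_nonzero[OF n] uv by blast+
  show "cX (conjm (diag2 u v) M) = (w + 1 / w) / 2 * cX M + (w - 1 / w) / 2 * cY M"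
    "cY (conjm (diag2 u v) M) = (w - 1 / w) / 2 * cX M + (w + 1 / w) / 2 * cY M"
    "cZ (conjm (diag2 u v) M) = cZ M"
    unfolding M w conjm_def cX_def cY_def cZ_def diag2_def dagger_mat2 mat2_mult mat2_nth
      mu_cnj[OF n uv(1)] mu_cnj[OF n uv(2)] using nz by (simp_all add: field_simps)
qed

lemma conjm_ad_1:
  "cX (conjm (antidiag2 1 1) M) = cX M" "cY (conjm (antidiag2 1 1) M) = - cY M" "cZ (conjm (antidiag2 1 1) M) = - cZ M"
  by (cases M rule: mat2_cases; simp add: conjm_def cX_def cY_def cZ_def antidiag2_def dagger_mat2 mat2_mult)+

lemma conjm_nn:
  "conjm (hmat 1 1 1) (mat2 a b c d) = mat2 (rho * cnj rho * (a + b + c + d)) (rho * cnj rho * (a - b + c - d))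
     (rho * cnj rho * (a + b - c - d)) (rho * cnj rho * (a - b - c + d))"
  unfolding conjm_def hmat_def dagger_mat2 mat2_mult mat2_eq_iff by (simp add: algebra_simps)

lemma conjm_nn_1:
  "cX (conjm (hmat 1 1 1) M) = cZ M" "cY (conjm (hmat 1 1 1) M) = - cY M" "cZ (conjm (hmat 1 1 1) M) = cX M"
proof -
  obtain a b c d where M: "M = mat2 a b c d" by (rule mat2_cases)
  show "cX (conjm (hmat 1 1 1) M) = cZ M" "cY (conjm (hmat 1 1 1) M) = - cY M" "cZ (conjm (hmat 1 1 1) M) = cX M"
    unfolding M conjm_nn rho_cnj(1) cX_def cY_def cZ_def mat2_nth by (simp_all add: field_simps)
qed

section \<open>The ping-pong regions\<close>

context valuation_ring begin

lemma le_0: "le 0 x" unfolding le_def using in_ring(2) by (intro bexI[of _ 0]) auto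

lemma lt_0: "x \<noteq> 0 \<Longrightarrow> lt 0 x" unfolding lt_def le_def by auto

lemma lt_nonzero: "lt x y \<Longrightarrow> y \<noteq> 0" unfolding lt_def using le_0 by auto

lemma le_minus_right: "le x (- y) \<longleftrightarrow> le x y"
  using lt_minus[of y x] unfolding lt_def by blast

lemma i_in: "\<i> \<in> V" "1 / \<i> \<in> V"
  using root_of_unity_in[of \<i> 4] by simp_all

lemma le_i: "le (\<i> * x) y \<longleftrightarrow> le x y"
proof
  assume "le (\<i> * x) y"
  from le_mult_unit[OF i_in(2) this] show "le x y" by simp
qed (rule le_mult_unit[OF i_in(1)])

lemma le_i_right: "le x (\<i> * y) \<longleftrightarrow> le x y"
proof
  assume "le x (\<i> * y)"
  from le_unit_mult[of "1 / \<i>", OF _ _ this] show "le x y" using i_in by simp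
next
  assume "le x y"
  then show "le x (\<i> * y)" using i_in by (intro le_unit_mult) simp_all
qed

lemmas le_units = le_minus le_minus_right le_i le_i_right

lemma lt_units: "lt (- x) y \<longleftrightarrow> lt x y" "lt x (- y) \<longleftrightarrow> lt x y" "lt (\<i> * x) y \<longleftrightarrow> lt x y" "lt x (\<i> * y) \<longleftrightarrow> lt x y"
  unfolding lt_def by (simp_all add: le_units)

text \<open>The two ping-pong regions. A non-monomial Clifford element moves \<open>stB\<close> into \<open>stA\<close> because it
  permutes the coordinate axes without fixing the third one; a rotation about the third axis
  by an angle that is not a multiple of \<open>pi / 2\<close> moves \<open>stA\<close> into \<open>stB\<close>.\<close>

definition stA :: "complex^2^2 \<Rightarrow> bool" where
  "stA M \<longleftrightarrow> lt (cX M) (cY M) \<and> le (cZ M) (cY M) \<or> lt (cY M) (cX M) \<and> le (cZ M) (cX M)"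

definition stB :: "complex^2^2 \<Rightarrow> bool" where
  "stB M \<longleftrightarrow> le (cX M) (cY M) \<and> le (cY M) (cX M) \<and> lt (cZ M) (cX M)"

text \<open>A rotation by a multiple of \<open>pi / 2\<close> permutes the first two coordinates up
  to factors in \<open>mu 4\<close>, which are units, and both regions are symmetric in these
  coordinates.\<close>

lemma st_mu4:
  assumes n: "n > 0" and uv: "u \<in> mu n" "v \<in> mu n" "v / u \<in> mu 4"
  shows "stA (conjm (diag2 u v) M) \<longleftrightarrow> stA M" "stB (conjm (diag2 u v) M) \<longleftrightarrow> stB M"
proof -
  note c = conjm_dg[OF n uv(1,2) refl, of M]
  define A where "A = (v / u + 1 / (v / u)) / 2"
  define B where "B = (v / u - 1 / (v / u)) / 2"
  have "v / u = 1 \<or> v / u = -1 \<or> v / u = \<i> \<or> v / u = - \<i>" using uv(3) unfolding mu_4 by blast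
  then have "A = 1 \<and> B = 0 \<or> A = -1 \<and> B = 0 \<or> A = 0 \<and> B = \<i> \<or> A = 0 \<and> B = - \<i>"
    unfolding A_def B_def by (elim disjE; simp only:; simp add: complex_eq_iff)
  then have "cX (conjm (diag2 u v) M) = cX M \<and> cY (conjm (diag2 u v) M) = cY M \<or>
    cX (conjm (diag2 u v) M) = - cX M \<and> cY (conjm (diag2 u v) M) = - cY M \<or>
    cX (conjm (diag2 u v) M) = \<i> * cY M \<and> cY (conjm (diag2 u v) M) = \<i> * cX M \<or>
    cX (conjm (diag2 u v) M) = - (\<i> * cY M) \<and> cY (conjm (diag2 u v) M) = - (\<i> * cX M)"
    unfolding c A_def[symmetric] B_def[symmetric] by (elim disjE conjE) simp_all
  then show "stA (conjm (diag2 u v) M) \<longleftrightarrow> stA M" "stB (conjm (diag2 u v) M) \<longleftrightarrow> stB M"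
    unfolding stA_def stB_def c(3)
    using lt_le_trans[of "cZ M" "cX M" "cY M"] lt_le_trans[of "cZ M" "cY M" "cX M"]
    by (elim disjE conjE; simp add: le_units lt_units; blast)+
qed

text \<open>\<open>A\<close> and \<open>B\<close> play the part of cosine and sine, of equal
  absolute value larger than 1. The dominant coordinate \<open>x\<close> then dominates in both new
  coordinates, which get the same size and outgrow \<open>z\<close>.\<close>

lemma stB_expand:
  assumes AB: "le A B" "le B A" "lt 1 A" and xyz: "lt y x" "le z x"
  shows "le (A * x + B * y) (B * x + A * y)" "le (B * x + A * y) (A * x + B * y)" "lt z (A * x + B * y)"
    "lt z (B * x + A * y)"
proof -
  have x: "x \<noteq> 0" using lt_nonzero[OF xyz(1)] .
  have A: "A \<noteq> 0" using lt_nonzero[OF AB(3)] .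
  have m: "le (a * c) (b * c)" if "le a b" for a b c by (rule le_mult[OF that])
  have "lt (y * A) (x * A)" using lt_mult[OF A] xyz(1) by blast
  then have yA: "lt (A * y) (A * x)" by (simp add: mult.commute)
  have AB': "le (A * x) (B * x)" "le (B * x) (A * x)" "le (B * y) (A * y)" using m AB by blast+
  have By: "lt (B * y) (A * x)" using le_lt_trans[OF AB'(3) yA] .
  have Ay: "lt (A * y) (B * x)" using lt_le_trans[OF yA AB'(1)] .
  note 1 = le_add_small[OF By] le_add_small'[OF By] and 2 = le_add_small[OF Ay] le_add_small'[OF Ay]
  show a: "le (A * x + B * y) (B * x + A * y)" using 1(2) AB'(1) 2(1) le_trans by blast
  show b: "le (B * x + A * y) (A * x + B * y)" using 2(2) AB'(2) 1(1) le_trans by blast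
  have "lt (1 * x) (A * x)" using lt_mult[OF x] AB(3) by blast
  then have "lt z (A * x)" using le_lt_trans[OF xyz(2)] by simp
  then show c: "lt z (A * x + B * y)" using lt_le_trans 1(1) by blast
  show "lt z (B * x + A * y)" using lt_le_trans[OF c a] .
qed

lemma stB_dg:
  assumes l2: "l = 2" and n: "n > 0" and uv: "u \<in> mu n" "v \<in> mu n" "v / u \<notin> mu 4" and M: "stA M"
  shows "stB (conjm (diag2 u v) M)"
proof -
  define w where "w = v / u"
  define A where "A = (w + 1 / w) / 2"
  define B where "B = (w - 1 / w) / 2"
  have w: "w ^ n = 1" "w ^ 4 \<noteq> 1" using mu_divide[OF uv(2,1)] uv(3) unfolding w_def mu_def by auto
  have wV: "w \<in> V" "w \<noteq> 0" "2 * w \<noteq> 0" using root_of_unity_in(1)[OF w(1) n] w(1) n by (auto simp: power_0_left)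
  have big: "lt 2 (1 + w ^ 2)" by (rule root_of_unity_sum_large[OF l2 w(1) n w(2)])
  \<comment> \<open>After multiplication by \<open>2 * w\<close> the cosine becomes
    \<open>1 + w ^ 2\<close>, and the sine differs from it, up to sign, by \<open>2 * w ^ 2\<close>,
    which is smaller because \<open>w\<close> is a unit.\<close>
  have A: "A * (2 * w) = 1 + w ^ 2" and B: "B * (2 * w) = - ((1 + w ^ 2) + (- (w ^ 2 * 2)))"
    unfolding A_def B_def using wV by (simp_all add: field_simps power2_eq_square)
  have "le (w * 2) 2" using le_mult_unit[OF wV(1) le_refl] .
  then have "lt (1 * (2 * w)) (A * (2 * w))" unfolding A using le_lt_trans[OF _ big] by (simp add: mult.commute)
  then have A1: "lt 1 A" using lt_mult[OF wV(3)] by blast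
  have "le (w ^ 2 * 2) 2" using le_mult_unit[OF in_ring(10)[OF wV(1)] le_refl] .
  then have sm: "lt (- (w ^ 2 * 2)) (1 + w ^ 2)" using le_lt_trans[OF _ big] by (simp add: lt_units)
  have "le (A * (2 * w)) (B * (2 * w))" "le (B * (2 * w)) (A * (2 * w))"
    unfolding A B le_minus le_minus_right using le_add_small[OF sm] le_add_small'[OF sm] by simp_all
  then have AB: "le A B" "le B A" using le_mult_cancel[OF wV(3)] by blast+
  note c = conjm_dg[OF n uv(1,2) w_def, of M, folded A_def B_def]
  from M show ?thesis unfolding stA_def
  proof (elim disjE conjE)
    assume h: "lt (cX M) (cY M)" "le (cZ M) (cY M)"
    note e = stB_expand[OF AB A1 h]
    show ?thesis unfolding stB_def c using e by (simp add: add.commute)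
  next
    assume h: "lt (cY M) (cX M)" "le (cZ M) (cX M)"
    note e = stB_expand[OF AB A1 h]
    show ?thesis unfolding stB_def c using e by simp
  qed
qed

lemma st_ad_1: "stA (conjm (antidiag2 1 1) M) \<longleftrightarrow> stA M" "stB (conjm (antidiag2 1 1) M) \<longleftrightarrow> stB M"
  unfolding stA_def stB_def conjm_ad_1 by (simp_all add: le_units lt_units)

text \<open>By \<open>nn_decomp\<close> only the Hadamard matrix matters, the diagonal factors
  preserving both regions. The second alternative for \<open>M\<close> admits multiples of the third
  Pauli matrix, where the game starts.\<close>

lemma stA_nn:
  assumes n: "n > 0" "4 dvd n" and u: "u \<in> mu n" "p \<in> mu 4" "q \<in> mu 4"
    and M: "stB M \<or> (cX M = 0 \<and> cY M = 0 \<and> cZ M \<noteq> 0)"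
  shows "stA (conjm (hmat u p q) M)"
proof -
  have "mu 4 \<subseteq> mu n" using n(2) by (rule mu_dvd)
  then have pq: "p \<in> mu n" "q \<in> mu n" using u by auto
  define M1 where "M1 = conjm (diag2 1 p) M"
  have M1: "stB M1 \<or> (cX M1 = 0 \<and> cY M1 = 0 \<and> cZ M1 \<noteq> 0)"
    using M st_mu4(2)[OF n(1) mu_1 pq(1), of M] u(2) conjm_dg[OF n(1) mu_1 pq(1) refl, of M]
    unfolding M1_def by auto
  \<comment> \<open>The first and third coordinates are exchanged: from \<open>stB\<close> the small
    third coordinate becomes the first, and the second dominates.\<close>
  have "stA (conjm (hmat 1 1 1) M1)"
    using M1 unfolding stA_def conjm_nn_1 stB_def using lt_le_trans[of "cZ M1" "cX M1" "cY M1"]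
    by (auto simp: le_units lt_units le_0 lt_0)
  then have "stA (conjm (diag2 1 q) (conjm (hmat 1 1 1) M1))"
    using st_mu4(1)[OF n(1) mu_1 pq(2)] u(3) by simp
  then have "stA (conjm (diag2 u u) (conjm (diag2 1 q) (conjm (hmat 1 1 1) M1)))"
    using st_mu4(1)[OF n(1) u(1) u(1)] mu_nonzero[OF n(1) u(1)] mu_1 by simp
  then show ?thesis unfolding M1_def nn_decomp[of u p q] conjm_mult .
qed

end

lemma mat_commute: "mat c ** (A :: complex^2^2) = A ** mat c"
  by (cases A rule: mat2_cases) (simp add: mat_mat2 mat2_mult mult.commute)

lemma mat_eq_dg: "mat c = diag2 c c"
  by (simp add: mat_mat2 diag2_def)

lemma T_gate_eq: "T_gate n = diag2 1 (\<zeta> n)"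
  by (simp add: T_gate_def diag2_def mat2_def)

lemma dg_eq_iff: "diag2 u v = diag2 u' v' \<longleftrightarrow> u = u' \<and> v = v'" "antidiag2 u v = antidiag2 u' v' \<longleftrightarrow> u = u' \<and> v = v'"
  by (auto simp: diag2_def antidiag2_def mat2_eq_iff)

section \<open>The two factors of the amalgam and their orders\<close>

locale gates =
  fixes n :: nat
  assumes n: "n > 0" "4 dvd n"
begin

abbreviation "U \<equiv> U2 (Rn n)"
abbreviation "G \<equiv> U\<lparr>carrier := Gn n\<rparr>"

text \<open>Enlarged by the scalars in \<open>mu n\<close>, the two factors of the amalgam: preimages of the
  octahedral group and of the dihedral group of order \<open>2 n\<close>.\<close>

definition cliff_part :: "(complex^2^2) set" where "cliff_part = {mat c ** g | c g. c \<in> mu n \<and> g \<in> Clifford}"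
definition mono_part :: "(complex^2^2) set" where
  "mono_part = (\<lambda>(u, v). diag2 u v) ` (mu n \<times> mu n) \<union> (\<lambda>(u, v). antidiag2 u v) ` (mu n \<times> mu n)"

lemma group_U: "group U" by (rule group_U2[OF csubring_Rn])

lemma mu4_sub: "mu 4 \<subseteq> mu n" using n(2) by (rule mu_dvd)

lemma Zi2_sub: "Zi2 \<subseteq> Rn n"
proof (rule subring_gen_minimal[OF csubring_Rn])
  have "\<i> \<in> mu 4" unfolding mu_4 by simp
  then have "\<i> \<in> Rn n" using mu4_sub mu_subset_Rn[OF n(1)] by blast
  moreover have "1 / 2 \<in> Rn n" unfolding Rn_def by (rule subring_gen_incl) simp
  ultimately show "{\<i>, 1 / 2} \<subseteq> Rn n" by simp
qed

lemma Clifford_sub: "Clifford \<subseteq> carrier U"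
proof
  fix g assume "g \<in> Clifford"
  then have "entries_in Zi2 g \<and> entries_in Zi2 (dagger g) \<and> g ** dagger g = mat 1" unfolding Clifford_def U2_iff .
  then show "g \<in> carrier U" unfolding U2_iff using Zi2_sub by (auto simp: entries_in_def)
qed

lemma Clifford_mult: "g \<in> Clifford \<Longrightarrow> h \<in> Clifford \<Longrightarrow> g ** h \<in> Clifford"
  using monoid.m_closed[OF group.is_monoid[OF group_U2[OF csubring_subring_gen]], of g "{\<i>, 1 / 2}" h]
  unfolding Clifford_def U2_simps .

lemma Clifford_dagger: "g \<in> Clifford \<Longrightarrow> dagger g \<in> Clifford"
  using U2_unitary unfolding Clifford_def U2_iff dagger_dagger by blast

lemma Bt_sub: "mono_part \<subseteq> carrier U"
proof -
  have "u * (1 / u) = 1 \<and> 1 / u \<in> Rn n \<and> u \<in> Rn n" if "u \<in> mu n" for u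
    using that mu_nonzero[OF n(1) that] mu_inverse[OF that] mu_subset_Rn[OF n(1)] by auto
  then show ?thesis
    unfolding mono_part_def U2_iff diag2_def antidiag2_def dagger_mat2 entries_in_mat2 mat_mat2 mat2_mult mat2_eq_iff
    using csubring_0[OF csubring_Rn] mu_cnj[OF n(1)]
    by (auto simp: U2_iff dagger_mat2 entries_in_mat2 mat_mat2 mat2_mult mat2_eq_iff)
qed

lemma Bt_mem: "u \<in> mu n \<Longrightarrow> v \<in> mu n \<Longrightarrow> diag2 u v \<in> mono_part" "u \<in> mu n \<Longrightarrow> v \<in> mu n \<Longrightarrow> antidiag2 u v \<in> mono_part"
  unfolding mono_part_def by auto

lemma Bt_cases:
  assumes "g \<in> mono_part"
  obtains u v where "u \<in> mu n" "v \<in> mu n" "g = diag2 u v" | u v where "u \<in> mu n" "v \<in> mu n" "g = antidiag2 u v"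
  using assms unfolding mono_part_def by auto

lemma subgroup_Bt: "subgroup mono_part U"
proof (rule group.subgroupI[OF group_U Bt_sub])
  show "mono_part \<noteq> {}" using Bt_mem[OF mu_1 mu_1] by blast
  show "inv\<^bsub>U\<^esub> g \<in> mono_part" if g: "g \<in> mono_part" for g
  proof -
    have 1: "inv\<^bsub>U\<^esub> g = dagger g" using inv_U2[OF csubring_Rn] g Bt_sub by blast
    have 2: "dagger (diag2 u v) = diag2 (1 / u) (1 / v)" "dagger (antidiag2 u v) = antidiag2 (1 / v) (1 / u)"
      if "u \<in> mu n" "v \<in> mu n" for u v
      using that by (simp_all add: diag2_def antidiag2_def dagger_mat2 mu_cnj[OF n(1)])
    from g show ?thesis unfolding 1
    proof (cases rule: Bt_cases)
      case (1 u v) then show "dagger g \<in> mono_part" using 2 Bt_mem mu_inverse by simp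
    next
      case (2 u v) then show "dagger g \<in> mono_part" using \<open>\<And>u v. u \<in> mu n \<Longrightarrow> v \<in> mu n \<Longrightarrow> dagger (antidiag2 u v) = _\<close> Bt_mem mu_inverse by simp
    qed
  qed
  show "g \<otimes>\<^bsub>U\<^esub> h \<in> mono_part" if g: "g \<in> mono_part" and h: "h \<in> mono_part" for g h
    using g
  proof (cases rule: Bt_cases)
    case g: (1 u v)
    from h show ?thesis
      by (cases rule: Bt_cases) (simp_all add: g U2_simps dg_mult Bt_mem mu_mult)
  next
    case g: (2 u v)
    from h show ?thesis
      by (cases rule: Bt_cases) (simp_all add: g U2_simps dg_mult Bt_mem mu_mult)
  qed
qed

lemma mat_in_U: "c \<in> mu n \<Longrightarrow> mat c \<in> carrier U"
  unfolding mat_eq_dg using Bt_mem Bt_sub by blast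

lemma subgroup_At: "subgroup cliff_part U"
proof (rule group.subgroupI[OF group_U])
  show sub: "cliff_part \<subseteq> carrier U"
    unfolding cliff_part_def using monoid.m_closed[OF group.is_monoid[OF group_U] mat_in_U subsetD[OF Clifford_sub]]
    by (auto simp: U2_simps)
  have "diag2 1 1 \<in> Clifford" using Clifford_mem(1)[OF mu_1 mu_1] .
  then show "cliff_part \<noteq> {}" unfolding cliff_part_def using mu_1 by blast
  show "inv\<^bsub>U\<^esub> g \<in> cliff_part" if g: "g \<in> cliff_part" for g
  proof -
    have 1: "inv\<^bsub>U\<^esub> g = dagger g" using inv_U2[OF csubring_Rn] g sub by blast
    obtain c h where h: "c \<in> mu n" "h \<in> Clifford" "g = mat c ** h" using g unfolding cliff_part_def by blast
    have "dagger (mat c :: complex^2^2) = mat (1 / c)" unfolding mat_mat2 dagger_mat2 using mu_cnj[OF n(1) h(1)] by simp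
    then have "dagger g = mat (1 / c) ** dagger h" unfolding h(3) dagger_mult using mat_commute by metis
    then show ?thesis unfolding 1 cliff_part_def using mu_inverse[OF h(1)] Clifford_dagger[OF h(2)] by blast
  qed
  show "g \<otimes>\<^bsub>U\<^esub> h \<in> cliff_part" if "g \<in> cliff_part" "h \<in> cliff_part" for g h
  proof -
    obtain c g' where g: "c \<in> mu n" "g' \<in> Clifford" "g = mat c ** g'" using \<open>g \<in> cliff_part\<close> unfolding cliff_part_def by blast
    obtain d h' where h: "d \<in> mu n" "h' \<in> Clifford" "h = mat d ** h'" using \<open>h \<in> cliff_part\<close> unfolding cliff_part_def by blast
    have "g ** h = mat c ** (g' ** mat d) ** h'" unfolding g h by (simp add: matrix_mul_assoc)
    also have "\<dots> = (mat c ** mat d) ** (g' ** h')" unfolding mat_commute[of d g', symmetric] by (simp add: matrix_mul_assoc)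
    also have "(mat c :: complex^2^2) ** mat d = mat (c * d)" by (simp add: mat_mat2 mat2_mult)
    finally show ?thesis unfolding cliff_part_def U2_simps using mu_mult[OF g(1) h(1)] Clifford_mult[OF g(2) h(2)] by blast
  qed
qed

text \<open>The scalar is absorbed into \<open>u\<close>, which makes the parameters unique. The
  three families have \<open>4 n\<close>, \<open>4 n\<close> and \<open>16 n\<close> members, whence
  the order \<open>24 n\<close>.\<close>

lemma At_iff:
  "g \<in> cliff_part \<longleftrightarrow> (\<exists>u\<in>mu n. \<exists>w\<in>mu 4. g = diag2 u (u * w)) \<or> (\<exists>u\<in>mu n. \<exists>w\<in>mu 4. g = antidiag2 u (u * w)) \<or>
    (\<exists>u\<in>mu n. \<exists>p\<in>mu 4. \<exists>q\<in>mu 4. g = hmat u p q)"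
proof
  assume "g \<in> cliff_part"
  then obtain c h where h: "c \<in> mu n" "h \<in> Clifford" "g = mat c ** h" unfolding cliff_part_def by blast
  have q: "c * x \<in> mu n \<and> y / x \<in> mu 4 \<and> c * x * (y / x) = c * y" if "x \<in> mu 4" "y \<in> mu 4" for x y
    using mu_mult[OF h(1), of x] mu4_sub that mu_divide[OF that(2,1)] mu_nonzero[of 4 x] by auto
  from Clifford_cases[OF h(2)] show "(\<exists>u\<in>mu n. \<exists>w\<in>mu 4. g = diag2 u (u * w)) \<or> (\<exists>u\<in>mu n. \<exists>w\<in>mu 4. g = antidiag2 u (u * w)) \<or>
    (\<exists>u\<in>mu n. \<exists>p\<in>mu 4. \<exists>q\<in>mu 4. g = hmat u p q)"
  proof (elim disjE bexE)
    fix x y assume "x \<in> mu 4" "y \<in> mu 4" "h = diag2 x y"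
    then show ?thesis using q[of x y] h(3) mat_mult_dg(1)[of c x y] by metis
  next
    fix x y assume "x \<in> mu 4" "y \<in> mu 4" "h = antidiag2 x y"
    then show ?thesis using q[of x y] h(3) mat_mult_dg(2)[of c x y] by metis
  next
    fix x y z assume "x \<in> mu 4" "y \<in> mu 4" "z \<in> mu 4" "h = hmat x y z"
    then show ?thesis using q[of x x] h(3) mat_mult_dg(3)[of c x y z] by metis
  qed
next
  have 1: "mat c ** h \<in> cliff_part" if "c \<in> mu n" "h \<in> Clifford" for c h using that unfolding cliff_part_def by blast
  assume "(\<exists>u\<in>mu n. \<exists>w\<in>mu 4. g = diag2 u (u * w)) \<or> (\<exists>u\<in>mu n. \<exists>w\<in>mu 4. g = antidiag2 u (u * w)) \<or>
    (\<exists>u\<in>mu n. \<exists>p\<in>mu 4. \<exists>q\<in>mu 4. g = hmat u p q)"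
  then show "g \<in> cliff_part"
  proof (elim disjE bexE)
    fix u w assume "u \<in> mu n" "w \<in> mu 4" "g = diag2 u (u * w)"
    then show ?thesis using 1[of u "diag2 1 w"] Clifford_mem(1)[OF mu_1, of w] by (simp add: mat_mult_dg)
  next
    fix u w assume "u \<in> mu n" "w \<in> mu 4" "g = antidiag2 u (u * w)"
    then show ?thesis using 1[of u "antidiag2 1 w"] Clifford_mem(2)[OF mu_1, of w] by (simp add: mat_mult_dg)
  next
    fix u p q assume "u \<in> mu n" "p \<in> mu 4" "q \<in> mu 4" "g = hmat u p q"
    then show ?thesis using 1[of u "hmat 1 p q"] Clifford_mem(3)[OF mu_1, of p q] by (simp add: mat_mult_dg)
  qed
qed

lemma nn_notin_Bt: "u \<in> mu n \<Longrightarrow> p \<in> mu 4 \<Longrightarrow> hmat u p q \<notin> mono_part"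
  using mu_nonzero[OF n(1), of u] mu_nonzero[of 4 p] rho_cnj(2)
  unfolding mono_part_def hmat_def diag2_def antidiag2_def by (auto simp: mat2_eq_iff)

lemma AB_iff:
  "g \<in> cliff_part \<inter> mono_part \<longleftrightarrow> (\<exists>u\<in>mu n. \<exists>w\<in>mu 4. g = diag2 u (u * w)) \<or> (\<exists>u\<in>mu n. \<exists>w\<in>mu 4. g = antidiag2 u (u * w))"
proof
  assume "g \<in> cliff_part \<inter> mono_part"
  then show "(\<exists>u\<in>mu n. \<exists>w\<in>mu 4. g = diag2 u (u * w)) \<or> (\<exists>u\<in>mu n. \<exists>w\<in>mu 4. g = antidiag2 u (u * w))"
    using At_iff[of g] nn_notin_Bt by blast
next
  assume *: "(\<exists>u\<in>mu n. \<exists>w\<in>mu 4. g = diag2 u (u * w)) \<or> (\<exists>u\<in>mu n. \<exists>w\<in>mu 4. g = antidiag2 u (u * w))"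
  then have "g \<in> mono_part" using Bt_mem mu_mult mu4_sub by blast
  then show "g \<in> cliff_part \<inter> mono_part" using * At_iff by blast
qed

lemma card_Bt: "card mono_part = 2 * n * n" and finite_Bt: "finite mono_part"
proof -
  have i: "inj_on (\<lambda>(u, v). diag2 u v) (mu n \<times> mu n)" "inj_on (\<lambda>(u, v). antidiag2 u v) (mu n \<times> mu n)"
    by (auto simp: inj_on_def dg_eq_iff)
  have d: "(\<lambda>(u, v). diag2 u v) ` (mu n \<times> mu n) \<inter> (\<lambda>(u, v). antidiag2 u v) ` (mu n \<times> mu n) = {}"
    using mu_nonzero[OF n(1)] by (auto simp: diag2_def antidiag2_def mat2_eq_iff)
  show "finite mono_part" unfolding mono_part_def using finite_mu[OF n(1)] by simp
  show "card mono_part = 2 * n * n"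
    unfolding mono_part_def using d finite_mu[OF n(1)]
    by (subst card_Un_disjoint) (simp_all add: card_image[OF i(1)] card_image[OF i(2)] card_cartesian_product card_mu[OF n(1)])
qed

lemma card_AB: "card (cliff_part \<inter> mono_part) = 8 * n" and finite_AB: "finite (cliff_part \<inter> mono_part)"
proof -
  let ?f = "\<lambda>(u, w). diag2 u (u * w)" and ?g = "\<lambda>(u, w). antidiag2 u (u * w)" and ?S = "mu n \<times> mu 4"
  have e: "cliff_part \<inter> mono_part = ?f ` ?S \<union> ?g ` ?S" by (rule Set.set_eqI) (auto simp: AB_iff[unfolded Int_iff])
  have i: "inj_on ?f ?S" "inj_on ?g ?S"
    using mu_nonzero[OF n(1)] by (auto simp: inj_on_def dg_eq_iff)
  have d: "?f ` ?S \<inter> ?g ` ?S = {}"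
    using mu_nonzero[OF n(1)] by (auto simp: diag2_def antidiag2_def mat2_eq_iff)
  have f: "finite ?S" using finite_mu[OF n(1)] finite_mu[of 4] by simp
  show "finite (cliff_part \<inter> mono_part)" unfolding e using f by simp
  show "card (cliff_part \<inter> mono_part) = 8 * n"
    unfolding e using d f
    by (subst card_Un_disjoint) (simp_all add: card_image[OF i(1)] card_image[OF i(2)] card_cartesian_product card_mu n(1))
qed

lemma card_At: "card cliff_part = 24 * n" and finite_At: "finite cliff_part"
proof -
  let ?f = "\<lambda>(u, p, q). hmat u p q" and ?S = "mu n \<times> mu 4 \<times> mu 4"
  have im: "g \<in> ?f ` ?S \<longleftrightarrow> (\<exists>u\<in>mu n. \<exists>p\<in>mu 4. \<exists>q\<in>mu 4. g = hmat u p q)" for g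
    by (auto simp: image_iff)
  have e: "cliff_part = (cliff_part \<inter> mono_part) \<union> ?f ` ?S"
  proof (rule Set.set_eqI)
    fix g show "g \<in> cliff_part \<longleftrightarrow> g \<in> (cliff_part \<inter> mono_part) \<union> ?f ` ?S"
      unfolding Un_iff im AB_iff At_iff disj_assoc ..
  qed
  have i: "inj_on ?f ?S"
  proof (rule inj_onI, clarsimp)
    fix u p q u' p' q' assume u: "u \<in> mu n" "u' \<in> mu n" and "hmat u p q = hmat u' p' q'"
    then have "rho * u = rho * u'" "rho * (u * p) = rho * (u' * p')" "rho * (u * q) = rho * (u' * q')"
      unfolding hmat_def mat2_eq_iff by blast+
    then show "u = u' \<and> p = p' \<and> q = q'" using rho_cnj(2) mu_nonzero[OF n(1)] u by auto
  qed
  have d: "(cliff_part \<inter> mono_part) \<inter> ?f ` ?S = {}" using nn_notin_Bt by auto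
  have f: "finite ?S" using finite_mu[OF n(1)] finite_mu[of 4] by simp
  show "finite cliff_part" by (subst e) (use finite_AB f in simp)
  show "card cliff_part = 24 * n"
    by (subst e, subst card_Un_disjoint)
      (use d f finite_AB in \<open>simp_all add: card_image[OF i] card_cartesian_product card_mu n(1) card_AB\<close>)
qed

text \<open>Conjugation by \<open>antidiag2 1 1\<close> moves powers of the gate to the other
  diagonal entry. So all diagonal matrices over \<open>mu n\<close> lie in \<open>Gn n\<close>, in
  particular the scalars that were added to the Clifford group.\<close>

lemma Gn_eq: "Gn n = generate U (cliff_part \<union> mono_part)"
proof (rule equalityI)
  have "Clifford \<subseteq> cliff_part"
  proof
    fix g assume "g \<in> Clifford"
    moreover have "g = mat 1 ** g" by simp
    ultimately show "g \<in> cliff_part" unfolding cliff_part_def using mu_1 by blast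
  qed
  moreover have "T_gate n \<in> mono_part" unfolding T_gate_eq by (rule Bt_mem(1)[OF mu_1 zeta_in_mu[OF n(1)]])
  ultimately show "Gn n \<subseteq> generate U (cliff_part \<union> mono_part)"
    unfolding Gn_def by (intro group.mono_generate[OF group_U]) auto
  have TU: "T_gate n \<in> carrier U" using \<open>T_gate n \<in> mono_part\<close> Bt_sub by blast
  have sG: "subgroup (Gn n) U"
    unfolding Gn_def by (rule group.generate_is_subgroup[OF group_U]) (use TU Clifford_sub in simp)
  have m: "g ** h \<in> Gn n" if "g \<in> Gn n" "h \<in> Gn n" for g h
    using subgroup.m_closed[OF sG that] by (simp add: U2_simps)
  have C: "Clifford \<subseteq> Gn n" and T: "diag2 1 (\<zeta> n) \<in> Gn n"
    unfolding Gn_def T_gate_eq by (auto intro: generate.incl)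
  have one: "diag2 1 1 \<in> Gn n" using C Clifford_mem(1)[OF mu_1 mu_1] by blast
  have "diag2 1 (\<zeta> n ^ k) \<in> Gn n" for k
  proof (induction k)
    case (Suc k)
    then show ?case using m[OF T Suc] by (simp add: dg_mult)
  qed (use one in simp)
  then have d1: "diag2 1 v \<in> Gn n" if "v \<in> mu n" for v using that unfolding mu_eq_powers[OF n(1)] by blast
  have X: "antidiag2 1 1 \<in> Gn n" using C Clifford_mem(2)[OF mu_1 mu_1] by blast
  have d2: "diag2 v 1 \<in> Gn n" if "v \<in> mu n" for v
    using m[OF m[OF X d1[OF that]] X] by (simp add: dg_mult)
  have d: "diag2 u v \<in> Gn n" if "u \<in> mu n" "v \<in> mu n" for u v
    using m[OF d2[OF that(1)] d1[OF that(2)]] by (simp add: dg_mult)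
  have a: "antidiag2 u v \<in> Gn n" if "u \<in> mu n" "v \<in> mu n" for u v
    using m[OF d[OF that] X] by (simp add: dg_mult)
  have "mono_part \<subseteq> Gn n" unfolding mono_part_def using d a by auto
  moreover have "cliff_part \<subseteq> Gn n" unfolding cliff_part_def mat_eq_dg using m[OF d] C by auto
  ultimately show "generate U (cliff_part \<union> mono_part) \<subseteq> Gn n"
    by (intro group.generate_subgroup_incl[OF group_U _ sG]) simp
qed

lemma subgroup_Gn: "subgroup (Gn n) U"
  unfolding Gn_eq
  by (rule group.generate_is_subgroup[OF group_U]) (use subgroup.subset[OF subgroup_At] Bt_sub in simp)

lemma group_G: "group G"
  by (rule group.subgroup_imp_group[OF group_U subgroup_Gn])

lemma AB_sub: "cliff_part \<subseteq> Gn n" "mono_part \<subseteq> Gn n"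
  unfolding Gn_eq by (auto intro: generate.incl)

text \<open>The third Pauli matrix and its negative; monomial matrices preserve this pair under
  conjugation.\<close>

abbreviation "\<sigma> \<equiv> diag2 1 (-1)"
abbreviation "\<sigma>' \<equiv> diag2 (-1) 1"

lemma conjm_Bt:
  assumes "b \<in> mono_part" "M \<in> {\<sigma>, \<sigma>'}"
  shows "conjm b M \<in> {\<sigma>, \<sigma>'}"
proof -
  have c: "u * (1 / u) = 1" if "u \<in> mu n" for u using mu_nonzero[OF n(1) that] by simp
  show ?thesis using assms(1)
  proof (cases rule: Bt_cases)
    case (1 u v)
    then show ?thesis using assms(2) c mu_nonzero[OF n(1)]
      by (auto simp: conjm_def diag2_def dagger_mat2 mat2_mult mat2_eq_iff mu_cnj[OF n(1)])
  next
    case (2 u v)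
    then show ?thesis using assms(2) c mu_nonzero[OF n(1)]
      by (auto simp: conjm_def diag2_def antidiag2_def dagger_mat2 mat2_mult mat2_eq_iff mu_cnj[OF n(1)])
  qed
qed

lemma c_sigma: "M \<in> {\<sigma>, \<sigma>'} \<Longrightarrow> cX M = 0 \<and> cY M = 0 \<and> cZ M \<noteq> 0"
  by (auto simp: cX_def cY_def cZ_def diag2_def)

lemma (in valuation_ring) not_st_sigma: "cX M = 0 \<and> cY M = 0 \<and> cZ M \<noteq> 0 \<Longrightarrow> \<not> stA M \<and> \<not> stB M"
  unfolding stA_def stB_def using lt_irrefl lt_nonzero by auto

text \<open>Each letter sends the image of \<open>\<sigma>\<close> into the region of its own
  factor. The exception is a word that is a single letter of \<open>mono_part\<close>: it leaves
  \<open>\<sigma>\<close> in place up to sign, and a following letter of \<open>cliff_part\<close>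
  accepts this position.\<close>

lemma alternating_state:
  assumes V: "valuation_ring V 2" and alt: "alternating G cliff_part mono_part s w"
  shows "(s \<longrightarrow> valuation_ring.stA V (conjm w \<sigma>)) \<and>
    (\<not> s \<longrightarrow> valuation_ring.stB V (conjm w \<sigma>) \<or> (w \<in> mono_part - cliff_part \<and> conjm w \<sigma> \<in> {\<sigma>, \<sigma>'}))"
proof -
  interpret V: valuation_ring V 2 by fact
  have A: "V.stA (conjm a M)" if a: "a \<in> cliff_part - mono_part" and M: "V.stB M \<or> M \<in> {\<sigma>, \<sigma>'}" for a M
  proof -
    obtain u p q where "u \<in> mu n" "p \<in> mu 4" "q \<in> mu 4" "a = hmat u p q"
      using a At_iff[of a] AB_iff[of a] by blast
    then show ?thesis using V.stA_nn[OF n] M c_sigma by blast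
  qed
  have B: "V.stB (conjm b M)" if b: "b \<in> mono_part - cliff_part" and M: "V.stA M" for b M
  proof -
    have b': "b \<in> mono_part" using b by blast
    have na: "v / u \<notin> mu 4" if uv: "u \<in> mu n" "v \<in> mu n" "b = diag2 u v \<or> b = antidiag2 u v" for u v
    proof
      assume q: "v / u \<in> mu 4"
      have "v = u * (v / u)" using mu_nonzero[OF n(1) uv(1)] by simp
      then show False using b uv(1,3) q AB_iff[of b] by (metis DiffD2 Int_iff)
    qed
    from b' show ?thesis
    proof (cases rule: Bt_cases)
      case (1 u v)
      then show ?thesis using V.stB_dg[OF refl n(1) 1(1,2) na M] by blast
    next
      case (2 u v)
      have "b = diag2 u v ** antidiag2 1 1" using 2 by (simp add: dg_mult)
      moreover have "V.stA (conjm (antidiag2 1 1) M)" using M V.st_ad_1 by blast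
      ultimately show ?thesis using V.stB_dg[OF refl n(1) 2(1,2) na] 2 by (simp add: conjm_mult)
    qed
  qed
  show ?thesis using alt
  proof (induction)
    case (left a) then show ?case using A[of a \<sigma>] by blast
  next
    case (right b) then show ?case using conjm_Bt[of b \<sigma>] by blast
  next
    case (left_Cons w a)
    then show ?case using A[of a "conjm w \<sigma>"] by (auto simp: U2_simps conjm_mult)
  next
    case (right_Cons w b)
    then show ?case using B[of b "conjm w \<sigma>"] by (auto simp: U2_simps conjm_mult)
  qed
qed

text \<open>Neither region contains \<open>\<sigma>\<close> or its negative. This yields both the
  reducedness of the amalgam and the determination of its scalars.\<close>

lemma alternating_not_fixing:
  assumes alt: "alternating G cliff_part mono_part s w" and "conjm w \<sigma> \<in> {\<sigma>, \<sigma>'}"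
  shows "w \<in> mono_part - cliff_part"
proof -
  obtain V where V: "valuation_ring V 2" using valuation_ring_exists[of 2] by auto
  then interpret V: valuation_ring V 2 .
  show ?thesis using alternating_state[OF V alt] V.not_st_sigma[OF c_sigma[OF assms(2)]] by (cases s) blast+
qed

lemma amalgam: "reduced_amalgam G cliff_part mono_part"
proof -
  show ?thesis
  proof (rule reduced_amalgam.intro[OF group_G reduced_amalgam_axioms.intro])
    show "subgroup cliff_part G" by (rule group.subgroup_incl[OF group_U subgroup_At subgroup_Gn AB_sub(1)])
    show "subgroup mono_part G" by (rule group.subgroup_incl[OF group_U subgroup_Bt subgroup_Gn AB_sub(2)])
    show "generate G (cliff_part \<union> mono_part) = carrier G"
      using group.generate_consistent[OF group_U _ subgroup_Gn, of "cliff_part \<union> mono_part"] AB_sub Gn_eq by simp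
    show "w \<notin> cliff_part \<inter> mono_part" if alt: "alternating G cliff_part mono_part s w" for s w
    proof
      assume w: "w \<in> cliff_part \<inter> mono_part"
      then have "conjm w \<sigma> \<in> {\<sigma>, \<sigma>'}" using conjm_Bt[of w \<sigma>] by blast
      then show False using alternating_not_fixing[OF alt] w by blast
    qed
  qed
qed

text \<open>Scalars fix \<open>\<sigma>\<close> under conjugation, hence lie in
  \<open>mono_part\<close>. Size alone would not decide this: for \<open>n = 28\<close> the ring
  contains (1 + sqrt(-7)) / (1 - sqrt(-7)), of modulus 1 but not a root of unity.\<close>

lemma scalar_in_Gn_iff: "mat c \<in> Gn n \<longleftrightarrow> c \<in> mu n"
proof
  interpret G: reduced_amalgam G cliff_part mono_part by (rule amalgam)
  assume c: "mat c \<in> Gn n"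
  then have u: "c * cnj c = 1" using subgroup.subset[OF subgroup_Gn]
    unfolding mat_mat2 by (auto simp: U2_iff dagger_mat2 mat2_mult mat_mat2 mat2_eq_iff dest!: subsetD)
  have "conjm (mat c) \<sigma> = \<sigma>" unfolding conjm_def diag2_def mat_mat2 dagger_mat2 mat2_mult using u by simp
  then have "mat c \<in> mono_part" using G.alternating_or_edge[of "mat c"] c alternating_not_fixing by auto
  then show "c \<in> mu n"
    by (cases rule: Bt_cases) (auto simp: mat_mat2 diag2_def antidiag2_def mat2_eq_iff)
next
  assume "c \<in> mu n"
  then show "mat c \<in> Gn n" unfolding mat_eq_dg using Bt_mem AB_sub by blast
qed

end

section \<open>A torsion-free congruence subgroup\<close>

definition cong3 :: "complex set \<Rightarrow> complex^2^2 \<Rightarrow> complex^2^2 \<Rightarrow> bool" where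
  "cong3 R g h \<longleftrightarrow> (\<exists>k. entries_in R k \<and> g = h + mat 3 ** k)"

lemma entries_in_add: "csubring R \<Longrightarrow> entries_in R A \<Longrightarrow> entries_in R B \<Longrightarrow> entries_in R (A + B)"
  and entries_in_uminus: "csubring R \<Longrightarrow> entries_in R A \<Longrightarrow> entries_in R (- A)"
  and entries_in_0: "csubring R \<Longrightarrow> entries_in R 0"
  by (simp_all add: entries_in_def csubring_add csubring_minus csubring_0)

lemma mat2_add: "mat2 a b c d + mat2 a' b' c' d' = mat2 (a + a') (b + b') (c + c') (d + d')"
  and mat2_minus: "- mat2 a b c d = mat2 (- a) (- b) (- c) (- d)"
  by (rule mat2_eqI; simp)+

lemma cong3_refl: "csubring R \<Longrightarrow> cong3 R g g"
  unfolding cong3_def using entries_in_0 by (intro exI[of _ 0]) (simp add: matrix_matrix_mult_def vec_eq_iff)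

lemma cong3_sym: "csubring R \<Longrightarrow> cong3 R g h \<Longrightarrow> cong3 R h g"
proof -
  assume R: "csubring R" and "cong3 R g h"
  then obtain k where k: "entries_in R k" "g = h + mat 3 ** k" unfolding cong3_def by blast
  have "h = g + mat 3 ** (- k)"
    unfolding k(2) by (cases k rule: mat2_cases; cases h rule: mat2_cases) (simp add: mat_mat2 mat2_mult mat2_add mat2_minus)
  then show ?thesis unfolding cong3_def using entries_in_uminus[OF R k(1)] by blast
qed

lemma cong3_trans: "csubring R \<Longrightarrow> cong3 R g h \<Longrightarrow> cong3 R h k \<Longrightarrow> cong3 R g k"
proof -
  assume R: "csubring R" and "cong3 R g h" "cong3 R h k"
  then obtain x y where x: "entries_in R x" "g = h + mat 3 ** x" and y: "entries_in R y" "h = k + mat 3 ** y"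
    unfolding cong3_def by blast
  have "g = k + mat 3 ** (y + x)" unfolding x(2) y(2) by (simp add: matrix_add_ldistrib add.assoc)
  then show ?thesis unfolding cong3_def using entries_in_add[OF R y(1) x(1)] by blast
qed

lemma cong3_mult:
  assumes R: "csubring R" and "cong3 R g h" and k: "entries_in R k"
  shows "cong3 R (g ** k) (h ** k)" "cong3 R (k ** g) (k ** h)"
proof -
  obtain x where x: "entries_in R x" "g = h + mat 3 ** x" using assms(2) unfolding cong3_def by blast
  have add_r: "(A + B) ** D = A ** D + B ** D" for A B D :: "complex^2^2"
    by (simp add: vec_eq_iff matrix_matrix_mult_def sum_2 forall_2 algebra_simps)
  have "g ** k = h ** k + mat 3 ** (x ** k)" unfolding x(2) by (simp add: add_r matrix_mul_assoc)
  then show "cong3 R (g ** k) (h ** k)" unfolding cong3_def using entries_in_mult[OF R x(1) k] by blast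
  have "k ** g = k ** h + (k ** mat 3) ** x" unfolding x(2) by (simp add: matrix_add_ldistrib matrix_mul_assoc)
  then have "k ** g = k ** h + mat 3 ** (k ** x)" unfolding mat_commute[of 3 k, symmetric] by (simp add: matrix_mul_assoc)
  then show "cong3 R (k ** g) (k ** h)" unfolding cong3_def using entries_in_mult[OF R k x(1)] by blast
qed

text \<open>The eigenvector is stored as the first column of a matrix, so that only products of
  two-by-two matrices occur.\<close>

lemma eigenvector_exists:
  assumes "\<kappa> * \<kappa> = (a + d) * \<kappa> - (a * d - b * c)"
  shows "\<exists>x y. (x \<noteq> 0 \<or> y \<noteq> 0) \<and> mat2 a b c d ** mat2 x 0 y 0 = mat \<kappa> ** mat2 x 0 y 0"
proof -
  have e: "(\<kappa> - a) * (\<kappa> - d) = b * c" using assms by (simp add: algebra_simps)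
  have *: ?thesis if "x \<noteq> 0 \<or> y \<noteq> 0" "a * x + b * y = \<kappa> * x" "c * x + d * y = \<kappa> * y" for x y
    by (intro exI[of _ x] exI[of _ y]) (use that in \<open>simp add: mat_mat2 mat2_mult\<close>)
  have "\<kappa> = a \<or> \<kappa> = d" if "b = 0" using e that by simp
  then consider "b \<noteq> 0" | "c \<noteq> 0" | "b = 0" "c = 0" "\<kappa> = a" | "b = 0" "c = 0" "\<kappa> = d" by blast
  then show ?thesis
  proof cases
    \<comment> \<open>This vector is annihilated by the first row of the matrix minus
      \<open>\<kappa>\<close> identically, and by the second row because of
      \<open>e\<close>.\<close>
    case 1 show ?thesis by (rule *[of b "\<kappa> - a"]) (use 1 e in \<open>simp_all add: algebra_simps\<close>)
  next
    case 2 show ?thesis by (rule *[of "\<kappa> - d" c]) (use 2 e in \<open>simp_all add: algebra_simps\<close>)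
  next
    case 3 show ?thesis by (rule *[of 1 0]) (use 3 in simp_all)
  next
    case 4 show ?thesis by (rule *[of 0 1]) (use 4 in simp_all)
  qed
qed

text \<open>Makes \<open>Rn n\<close> a subring of \<open>V\<close>; here it matters that the
  residue characteristic is not 2. If \<open>2 / 3\<close> were in \<open>V\<close>, so would be
  \<open>1 - 2 / 3 = 1 / 3\<close>.\<close>

lemma (in valuation_ring) half_in:
  assumes "l = 3" shows "1 / 2 \<in> V"
proof -
  have "3 / 2 \<in> V \<or> 2 / 3 \<in> V" using total[of "3 / 2"] by simp
  then show ?thesis
  proof
    assume "3 / 2 \<in> V"
    from in_ring(4)[OF this in_ring(1)] show ?thesis by simp
  next
    assume "2 / 3 \<in> V"
    from in_ring(4)[OF in_ring(1) this] show ?thesis using l(2) assms by simp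
  qed
qed

section \<open>Residues modulo 3 and the congruence subgroup\<close>

context gates begin

abbreviation "R \<equiv> Rn n"

lemma csubring_R: "csubring R" by (rule csubring_Rn)

text \<open>The ring of integer polynomials in \<open>\<zeta> n\<close>, written as combinations of
  finitely many roots of unity; this is what makes the residues modulo 3 finite in number.\<close>

definition zspan :: "complex set" where
  "zspan = {x. \<exists>a :: complex \<Rightarrow> int. x = (\<Sum>z\<in>mu n. of_int (a z) * z)}"

lemma zspanI: "x = (\<Sum>z\<in>mu n. of_int (a z) * z) \<Longrightarrow> x \<in> zspan"
  unfolding zspan_def by blast

lemma zspan_diff: "x \<in> zspan \<Longrightarrow> y \<in> zspan \<Longrightarrow> x - y \<in> zspan"
proof -
  assume "x \<in> zspan" "y \<in> zspan"
  then obtain a b where "x = (\<Sum>z\<in>mu n. of_int (a z) * z)" "y = (\<Sum>z\<in>mu n. of_int (b z) * z)"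
    unfolding zspan_def by blast
  then have "x - y = (\<Sum>z\<in>mu n. of_int (a z - b z) * z)" by (simp add: algebra_simps sum_subtractf)
  then show ?thesis by (rule zspanI)
qed

lemma zspan_0: "0 \<in> zspan" by (rule zspanI[of _ "\<lambda>_. 0"]) simp

lemma zspan_add: "x \<in> zspan \<Longrightarrow> y \<in> zspan \<Longrightarrow> x + y \<in> zspan"
  using zspan_diff[of x "0 - y"] zspan_diff[OF zspan_0, of y] by simp

lemma zspan_sum: "(\<And>i. i \<in> I \<Longrightarrow> f i \<in> zspan) \<Longrightarrow> sum f I \<in> zspan"
  by (induction I rule: infinite_finite_induct) (simp_all add: zspan_0 zspan_add)

lemma zspan_scale: "x \<in> zspan \<Longrightarrow> of_int k * x \<in> zspan"
proof -
  assume "x \<in> zspan"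
  then obtain a where "x = (\<Sum>z\<in>mu n. of_int (a z) * z)" unfolding zspan_def by blast
  then have "of_int k * x = (\<Sum>z\<in>mu n. of_int (k * a z) * z)" by (simp add: sum_distrib_left mult.assoc)
  then show ?thesis by (rule zspanI)
qed

lemma zspan_mu_mult:
  assumes w: "w \<in> mu n" and "x \<in> zspan"
  shows "w * x \<in> zspan"
proof -
  obtain a where a: "x = (\<Sum>z\<in>mu n. of_int (a z) * z)" using assms(2) unfolding zspan_def by blast
  have w0: "w \<noteq> 0" by (rule mu_nonzero[OF n(1) w])
  have bij: "bij_betw (\<lambda>z. w * z) (mu n) (mu n)"
    by (rule bij_betwI[of _ _ _ "\<lambda>z. z / w"]) (use w w0 mu_mult mu_divide in auto)
  have "w * x = (\<Sum>z\<in>mu n. of_int (a (w * z / w)) * (w * z))" unfolding a sum_distrib_left using w0 by (simp add: mult_ac)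
  also have "\<dots> = (\<Sum>z\<in>mu n. of_int (a (z / w)) * z)"
    using sum.reindex_bij_betw[OF bij, of "\<lambda>z. of_int (a (z / w)) * z"] by simp
  finally show ?thesis by (rule zspanI)
qed

lemma mu_zspan: assumes w: "w \<in> mu n" shows "w \<in> zspan"
proof (rule zspanI)
  have "(\<Sum>z\<in>mu n. of_int (if z = w then 1 else 0) * z) = (\<Sum>z\<in>mu n. if z = w then z else 0)"
    by (rule sum.cong) auto
  then show "w = (\<Sum>z\<in>mu n. of_int (if z = w then 1 else 0) * z)" using w finite_mu[OF n(1)] by simp
qed

lemma csubring_zspan: "csubring zspan"
  unfolding csubring_def
proof (intro conjI ballI)
  show "1 \<in> zspan" by (rule mu_zspan[OF mu_1])
  fix x y assume x: "x \<in> zspan" and y: "y \<in> zspan"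
  show "x - y \<in> zspan" by (rule zspan_diff[OF x y])
  obtain a where a: "x = (\<Sum>z\<in>mu n. of_int (a z) * z)" using x unfolding zspan_def by blast
  have "x * y = (\<Sum>z\<in>mu n. of_int (a z) * (z * y))" unfolding a sum_distrib_right by (simp add: mult.assoc)
  also have "\<dots> \<in> zspan" by (intro zspan_sum zspan_scale zspan_mu_mult y)
  finally show "x * y \<in> zspan" .
qed

lemma zspan_sub: "zspan \<subseteq> R"
proof
  fix x assume "x \<in> zspan"
  then obtain a where a: "x = (\<Sum>z\<in>mu n. of_int (a z) * z)" unfolding zspan_def by blast
  show "x \<in> R" unfolding a
    by (intro csubring_sum[OF csubring_R] csubring_mult[OF csubring_R] csubring_of_int[OF csubring_R])
      (use mu_subset_Rn[OF n(1)] in blast)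
qed

text \<open>Modulo 3 the generator \<open>1 / 2\<close> is congruent to 2, so inverting 2 adds no
  new residue classes.\<close>

lemma R_sub: "r \<in> R \<Longrightarrow> \<exists>x\<in>zspan. \<exists>s\<in>R. r = x + 3 * s"
proof -
  let ?S = "{r. \<exists>x\<in>zspan. \<exists>s\<in>R. r = x + 3 * s}"
  note rr = csubringD[OF csubring_R] and zz = csubringD[OF csubring_zspan]
  have "csubring ?S"
    unfolding csubring_def
  proof (intro conjI ballI)
    show "1 \<in> ?S" using zz(1) rr(2) by (intro CollectI bexI[of _ 1] bexI[of _ 0]) simp_all
    fix r r' assume "r \<in> ?S" "r' \<in> ?S"
    then obtain x s x' s' where x: "x \<in> zspan" "x' \<in> zspan" "s \<in> R" "s' \<in> R" "r = x + 3 * s" "r' = x' + 3 * s'" by blast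
    have xR: "x \<in> R" "x' \<in> R" using x zspan_sub by blast+
    have three: "3 \<in> R" using csubring_of_nat[OF csubring_R, of 3] by simp
    show "r - r' \<in> ?S"
      by (intro CollectI bexI[of _ "x - x'"] bexI[of _ "s - s'"]) (use x rr zz in \<open>simp_all add: algebra_simps\<close>)
    have "x * s' + s * x' + 3 * s * s' \<in> R" by (intro rr(6) rr(4) x xR three)
    moreover have "x * x' \<in> zspan" using x zz(4) by blast
    moreover have "r * r' = x * x' + 3 * (x * s' + s * x' + 3 * s * s')" using x by (simp add: algebra_simps)
    ultimately show "r * r' \<in> ?S" by blast
  qed
  moreover have "{\<zeta> n, 1 / 2} \<subseteq> ?S"
  proof -
    have "\<zeta> n \<in> ?S" using mu_zspan[OF zeta_in_mu[OF n(1)]] rr(2) by (intro CollectI bexI[of _ "\<zeta> n"] bexI[of _ 0]) simp_all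
    moreover have "1 / 2 \<in> ?S"
    proof -
      have h: "1 / 2 \<in> R" unfolding Rn_def by (rule subring_gen_incl) simp
      have "2 \<in> zspan" using csubring_of_nat[OF csubring_zspan, of 2] by simp
      moreover have "- (1 / 2) \<in> R" by (rule rr(5)[OF h])
      moreover have "1 / 2 = 2 + 3 * (- (1 / 2) :: complex)" by simp
      ultimately show ?thesis by blast
    qed
    ultimately show ?thesis by blast
  qed
  ultimately have "R \<subseteq> ?S" unfolding Rn_def by (rule subring_gen_minimal)
  then show "r \<in> R \<Longrightarrow> ?thesis" by blast
qed

text \<open>At most \<open>3 ^ n\<close> numbers, obtained by reducing the integer coefficients
  modulo 3.\<close>

definition residues3 :: "complex set" where
  "residues3 = (\<lambda>a. \<Sum>z\<in>mu n. of_int (a z) * z) ` (mu n \<rightarrow>\<^sub>E {0, 1, 2 :: int})"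

lemma finite_residues3: "finite residues3"
  unfolding residues3_def using finite_mu[OF n(1)] by (intro finite_imageI finite_PiE) auto

lemma residue_exists:
  assumes "r \<in> R"
  shows "\<exists>f\<in>residues3. \<exists>s\<in>R. r = f + 3 * s"
proof -
  obtain x s where x: "x \<in> zspan" "s \<in> R" "r = x + 3 * s" using R_sub[OF assms] by blast
  obtain a where a: "x = (\<Sum>z\<in>mu n. of_int (a z) * z)" using x(1) unfolding zspan_def by blast
  define b where "b = (\<lambda>z\<in>mu n. a z mod 3)"
  define t where "t = (\<Sum>z\<in>mu n. of_int (a z div 3) * z)"
  have tR: "t \<in> R" using zspan_sub zspanI[OF t_def] by blast
  have "b \<in> mu n \<rightarrow>\<^sub>E {0, 1, 2}"
  proof -
    have "a z mod 3 \<in> {0, 1, 2}" for z using pos_mod_bound[of 3 "a z"] pos_mod_sign[of 3 "a z"] by auto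
    then show ?thesis unfolding b_def by auto
  qed
  then have f: "(\<Sum>z\<in>mu n. of_int (b z) * z) \<in> residues3" unfolding residues3_def by (rule imageI)
  have "of_int (a z) * z = of_int (a z mod 3) * z + 3 * (of_int (a z div 3) * z)" for z :: complex
  proof -
    have "(of_int (a z) :: complex) = of_int (a z mod 3 + 3 * (a z div 3))" by simp
    also have "\<dots> = of_int (a z mod 3) + 3 * of_int (a z div 3)" by (simp only: of_int_add of_int_mult of_int_numeral)
    finally show ?thesis by (simp add: algebra_simps)
  qed
  then have "x = (\<Sum>z\<in>mu n. of_int (a z mod 3) * z + 3 * (of_int (a z div 3) * z))" unfolding a by (intro sum.cong refl)
  also have "\<dots> = (\<Sum>z\<in>mu n. of_int (b z) * z) + 3 * t"
    unfolding t_def by (simp add: sum.distrib sum_distrib_left b_def)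
  finally have "r = (\<Sum>z\<in>mu n. of_int (b z) * z) + 3 * (t + s)" using x(3) by (simp add: algebra_simps)
  moreover have "t + s \<in> R" by (rule csubring_add[OF csubring_R tR x(2)])
  ultimately show ?thesis using f by blast
qed

definition cong_subgroup :: "(complex^2^2) set" where "cong_subgroup = {g \<in> Gn n. cong3 R g (mat 1)}"

lemma Gn_U2: "g \<in> Gn n \<Longrightarrow> g \<in> carrier U" using subgroup.subset[OF subgroup_Gn] by blast

lemma Gn_entries: "g \<in> Gn n \<Longrightarrow> entries_in R g" "g \<in> Gn n \<Longrightarrow> entries_in R (dagger g)"
  using Gn_U2 U2_iff by blast+

lemma inv_G: "g \<in> Gn n \<Longrightarrow> inv\<^bsub>G\<^esub> g = dagger g"
  using group.m_inv_consistent[OF group_U subgroup_Gn] inv_U2[OF csubring_R] Gn_U2 by simp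

lemma subgroup_Kc: "subgroup cong_subgroup G"
proof (rule group.subgroupI[OF group_G])
  show "cong_subgroup \<subseteq> carrier G" unfolding cong_subgroup_def by auto
  have "mat 1 \<in> Gn n" using subgroup.one_closed[OF subgroup_Gn] by (simp add: U2_simps)
  then show "cong_subgroup \<noteq> {}" unfolding cong_subgroup_def using cong3_refl[OF csubring_R] by blast
  show "inv\<^bsub>G\<^esub> g \<in> cong_subgroup" if g: "g \<in> cong_subgroup" for g
  proof -
    have gG: "g \<in> Gn n" "cong3 R g (mat 1)" using g unfolding cong_subgroup_def by auto
    have "cong3 R (dagger g ** g) (dagger g ** mat 1)" by (rule cong3_mult(2)[OF csubring_R gG(2) Gn_entries(2)[OF gG(1)]])
    then have "cong3 R (dagger g) (mat 1)" using U2_unitary[OF Gn_U2[OF gG(1)]] cong3_sym[OF csubring_R] by simp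
    moreover have "dagger g \<in> Gn n" using group.inv_closed[OF group_G, of g] gG(1) inv_G[OF gG(1)] by simp
    ultimately show ?thesis unfolding cong_subgroup_def inv_G[OF gG(1)] by simp
  qed
  show "g \<otimes>\<^bsub>G\<^esub> h \<in> cong_subgroup" if "g \<in> cong_subgroup" "h \<in> cong_subgroup" for g h
  proof -
    have gh: "g \<in> Gn n" "h \<in> Gn n" "cong3 R g (mat 1)" "cong3 R h (mat 1)" using that unfolding cong_subgroup_def by auto
    have "cong3 R (g ** h) (mat 1 ** h)" by (rule cong3_mult(1)[OF csubring_R gh(3) Gn_entries(1)[OF gh(2)]])
    then have "cong3 R (g ** h) (mat 1)" using cong3_trans[OF csubring_R _ gh(4)] by simp
    moreover have "g ** h \<in> Gn n" using subgroup.m_closed[OF subgroup_Gn gh(1,2)] by (simp add: U2_simps)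
    ultimately show ?thesis unfolding cong_subgroup_def by (simp add: U2_simps)
  qed
qed

text \<open>A coset is sent to the residues of the entries of a chosen representative. If
  \<open>g\<close> and \<open>h\<close> have equal residues, then \<open>g ** dagger h\<close> is
  congruent to 1, so this map is injective.\<close>

lemma finite_index_Kc: "finite (rcosets\<^bsub>G\<^esub> cong_subgroup)"
proof -
  interpret G: group G by (rule group_G)
  define res where "res r = (SOME f. f \<in> residues3 \<and> (\<exists>s\<in>R. r = f + 3 * s))" for r
  have res: "res r \<in> residues3 \<and> (\<exists>s\<in>R. r = res r + 3 * s)" if "r \<in> R" for r
    unfolding res_def by (rule someI_ex) (use residue_exists[OF that] in blast)
  define \<rho> where "\<rho> g = (res (g $ 1 $ 1), res (g $ 1 $ 2), res (g $ 2 $ 1), res (g $ 2 $ 2))" for g :: "complex^2^2"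
  have \<rho>in: "\<rho> g \<in> residues3 \<times> residues3 \<times> residues3 \<times> residues3" if "g \<in> Gn n" for g
    unfolding \<rho>_def using res Gn_entries(1)[OF that] unfolding entries_in_def by blast
  have diff: "\<exists>s\<in>R. r = r' + 3 * s" if r: "r \<in> R" "r' \<in> R" "res r = res r'" for r r'
  proof -
    obtain s where s: "s \<in> R" "r = res r + 3 * s" using res r(1) by blast
    obtain s' where s': "s' \<in> R" "r' = res r' + 3 * s'" using res r(2) by blast
    have "r = r' + 3 * (s - s')" using s(2) s'(2) r(3) by (simp add: algebra_simps)
    then show ?thesis using csubring_diff[OF csubring_R s(1) s'(1)] by blast
  qed
  have \<rho>inj: "cong3 R g h" if gh: "g \<in> Gn n" "h \<in> Gn n" "\<rho> g = \<rho> h" for g h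
  proof -
    have e: "g $ i $ j \<in> R" "h $ i $ j \<in> R" for i j using gh Gn_entries(1) unfolding entries_in_def by blast+
    obtain a where a: "a \<in> R" "g $ 1 $ 1 = h $ 1 $ 1 + 3 * a" using diff[OF e(1)[of 1 1] e(2)[of 1 1]] gh(3) unfolding \<rho>_def by blast
    obtain b where b: "b \<in> R" "g $ 1 $ 2 = h $ 1 $ 2 + 3 * b" using diff[OF e(1)[of 1 2] e(2)[of 1 2]] gh(3) unfolding \<rho>_def by blast
    obtain c where c: "c \<in> R" "g $ 2 $ 1 = h $ 2 $ 1 + 3 * c" using diff[OF e(1)[of 2 1] e(2)[of 2 1]] gh(3) unfolding \<rho>_def by blast
    obtain d where d: "d \<in> R" "g $ 2 $ 2 = h $ 2 $ 2 + 3 * d" using diff[OF e(1)[of 2 2] e(2)[of 2 2]] gh(3) unfolding \<rho>_def by blast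
    have "g = h + mat 3 ** mat2 a b c d"
      by (rule mat2_eqI) (simp_all add: mat_mat2 mat2_mult a(2) b(2) c(2) d(2))
    moreover have "entries_in R (mat2 a b c d)" using a b c d by (simp add: entries_in_mat2)
    ultimately show ?thesis unfolding cong3_def by blast
  qed
  define s where "s C = (SOME g. g \<in> C)" for C :: "(complex^2^2) set"
  have s: "s C \<in> Gn n \<and> C = cong_subgroup #>\<^bsub>G\<^esub> s C" if C: "C \<in> rcosets\<^bsub>G\<^esub> cong_subgroup" for C
  proof -
    obtain g where g: "g \<in> carrier G" "C = cong_subgroup #>\<^bsub>G\<^esub> g" using C unfolding RCOSETS_def by blast
    have "g \<in> C" unfolding g(2) by (rule G.rcos_self[OF g(1) subgroup_Kc])
    then have sC: "s C \<in> C" unfolding s_def by (rule someI)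
    have "C \<subseteq> carrier G" unfolding g(2) by (rule G.r_coset_subset_G[OF subgroup.subset[OF subgroup_Kc] g(1)])
    then have "s C \<in> Gn n" using sC by auto
    moreover have "C = cong_subgroup #>\<^bsub>G\<^esub> s C" using G.repr_independence[OF _ g(1) subgroup_Kc, of "s C"] sC unfolding g(2) by simp
    ultimately show ?thesis by blast
  qed
  have "inj_on (\<lambda>C. \<rho> (s C)) (rcosets\<^bsub>G\<^esub> cong_subgroup)"
  proof (rule inj_onI)
    fix C D assume C: "C \<in> rcosets\<^bsub>G\<^esub> cong_subgroup" and D: "D \<in> rcosets\<^bsub>G\<^esub> cong_subgroup" and e: "\<rho> (s C) = \<rho> (s D)"
    let ?g = "s C" and ?h = "s D"
    have gh: "?g \<in> Gn n" "?h \<in> Gn n" using s[OF C] s[OF D] by blast+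
    have "cong3 R (?g ** dagger ?h) (?h ** dagger ?h)"
      by (rule cong3_mult(1)[OF csubring_R \<rho>inj[OF gh e] Gn_entries(2)[OF gh(2)]])
    then have c1: "cong3 R (?g ** dagger ?h) (mat 1)" using U2_unitary[OF Gn_U2[OF gh(2)]] by simp
    have "dagger ?h \<in> Gn n" using G.inv_closed[of ?h] gh(2) inv_G[OF gh(2)] by simp
    then have "?g ** dagger ?h \<in> Gn n" using subgroup.m_closed[OF subgroup_Gn gh(1)] by (simp add: U2_simps)
    then have K: "?g ** dagger ?h \<in> cong_subgroup" using c1 unfolding cong_subgroup_def by blast
    have "?g = (?g ** dagger ?h) \<otimes>\<^bsub>G\<^esub> ?h"
      using U2_unitary[OF Gn_U2[OF gh(2)]] by (simp add: U2_simps matrix_mul_assoc[symmetric])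
    then have "?g \<in> cong_subgroup #>\<^bsub>G\<^esub> ?h" using K unfolding r_coset_def by blast
    then have "cong_subgroup #>\<^bsub>G\<^esub> ?h = cong_subgroup #>\<^bsub>G\<^esub> ?g" using G.repr_independence[OF _ _ subgroup_Kc, of ?g ?h] gh(2) by simp
    then show "C = D" using s[OF C] s[OF D] by simp
  qed
  moreover have "(\<lambda>C. \<rho> (s C)) ` (rcosets\<^bsub>G\<^esub> cong_subgroup) \<subseteq> residues3 \<times> residues3 \<times> residues3 \<times> residues3"
    using \<rho>in s by blast
  ultimately show ?thesis using finite_residues3 finite_subset[OF _ finite_cartesian_product]
    by (metis finite_SigmaI finite_imageD finite_subset)
qed

text \<open>An eigenvalue of a torsion element congruent to 1 modulo 3 is a root of unity with the same
  property, hence 1; a unitary matrix of trace 2 is the identity.\<close>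

lemma torsion_free_Kc: "torsion_free (G\<lparr>carrier := cong_subgroup\<rparr>)"
  unfolding torsion_free_def
proof (intro ballI allI impI)
  fix g and k :: nat
  assume "g \<in> carrier (G\<lparr>carrier := cong_subgroup\<rparr>)" and "0 < k \<and> g [^]\<^bsub>G\<lparr>carrier := cong_subgroup\<rparr>\<^esub> k = \<one>\<^bsub>G\<lparr>carrier := cong_subgroup\<rparr>\<^esub>"
  then have g: "g \<in> Gn n" "cong3 R g (mat 1)" and k: "k > 0" "g [^]\<^bsub>U\<^esub> k = mat 1"
    by (auto simp: cong_subgroup_def nat_pow_def U2_simps)
  obtain x where x: "entries_in R x" "g = mat 1 + mat 3 ** x" using g(2) unfolding cong3_def by blast
  obtain a b c d where x': "x = mat2 a b c d" by (rule mat2_cases)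
  have g': "g = mat2 (1 + 3 * a) (3 * b) (3 * c) (1 + 3 * d)"
    unfolding x(2) x' by (simp add: mat_mat2 mat2_mult mat2_add)
  obtain V where V: "valuation_ring V 3" using valuation_ring_exists[of 3] by auto
  then interpret V: valuation_ring V 3 .
  have "R \<subseteq> V" unfolding Rn_def
  proof (rule subring_gen_minimal[OF V.sub])
    have "\<zeta> n \<in> V" using V.root_of_unity_in(1)[OF _ n(1)] zeta_in_mu[OF n(1)] unfolding mu_def by blast
    then show "{\<zeta> n, 1 / 2} \<subseteq> V" using V.half_in by simp
  qed
  then have abcd: "a \<in> V" "b \<in> V" "c \<in> V" "d \<in> V" using x(1) unfolding x' entries_in_mat2 by blast+
  \<comment> \<open>\<open>1 + 3 * \<mu>\<close> is an eigenvalue of \<open>g\<close> whenever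
    \<open>\<mu>\<close> is one of \<open>x\<close>, and \<open>\<mu>\<close> lies in
    \<open>V\<close> because it is integral over it.\<close>
  have ev: "\<mu> = 0" if \<mu>: "\<mu> * \<mu> = (a + d) * \<mu> - (a * d - b * c)" for \<mu>
  proof -
    have \<mu>V: "\<mu> \<in> V" by (rule V.quadratic_in[OF \<mu>]) (intro V.in_ring abcd)+
    have "(1 + 3 * \<mu>) * (1 + 3 * \<mu>) = ((1 + 3 * a) + (1 + 3 * d)) * (1 + 3 * \<mu>) - ((1 + 3 * a) * (1 + 3 * d) - (3 * b) * (3 * c))"
    proof -
      have "(1 + 3 * \<mu>) * (1 + 3 * \<mu>) - (((1 + 3 * a) + (1 + 3 * d)) * (1 + 3 * \<mu>) - ((1 + 3 * a) * (1 + 3 * d) - (3 * b) * (3 * c)))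
        = 9 * (\<mu> * \<mu> - ((a + d) * \<mu> - (a * d - b * c)))" by (simp add: algebra_simps)
      then show ?thesis unfolding \<mu> by simp
    qed
    from eigenvector_exists[OF this] obtain p q where pq: "p \<noteq> 0 \<or> q \<noteq> 0"
      "g ** mat2 p 0 q 0 = mat (1 + 3 * \<mu>) ** mat2 p 0 q 0" unfolding g' by blast
    have "(g [^]\<^bsub>U\<^esub> m) ** mat2 p 0 q 0 = mat ((1 + 3 * \<mu>) ^ m) ** mat2 p 0 q 0" for m :: nat
    proof (induction m)
      case 0 then show ?case by (simp add: nat_pow_def U2_simps)
    next
      case (Suc m)
      have "(g [^]\<^bsub>U\<^esub> Suc m) ** mat2 p 0 q 0 = (g [^]\<^bsub>U\<^esub> m) ** (g ** mat2 p 0 q 0)"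
        by (simp add: nat_pow_def U2_simps matrix_mul_assoc)
      also have "\<dots> = ((g [^]\<^bsub>U\<^esub> m) ** mat (1 + 3 * \<mu>)) ** mat2 p 0 q 0" unfolding pq(2) by (simp add: matrix_mul_assoc)
      also have "\<dots> = mat (1 + 3 * \<mu>) ** ((g [^]\<^bsub>U\<^esub> m) ** mat2 p 0 q 0)"
        unfolding mat_commute[symmetric] by (simp add: matrix_mul_assoc)
      also have "\<dots> = mat ((1 + 3 * \<mu>) ^ Suc m) ** mat2 p 0 q 0"
        unfolding Suc by (simp add: mat_mat2 mat2_mult mult.assoc)
      finally show ?case .
    qed
    from this[of k] have "mat2 p 0 q 0 = mat ((1 + 3 * \<mu>) ^ k) ** mat2 p 0 q 0" unfolding k(2) by simp
    then have "(1 + 3 * \<mu>) ^ k = 1" using pq(1) by (auto simp: mat_mat2 mat2_mult mat2_eq_iff)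
    then have "3 * \<mu> = 0" using V.root_of_unity_congruent[of 3 \<mu> k] \<mu>V k(1) by simp
    then show ?thesis by simp
  qed
  \<comment> \<open>A square root of the discriminant of the characteristic polynomial of
    \<open>x\<close>; both roots vanish by \<open>ev\<close>, and so does the trace of
    \<open>x\<close>.\<close>
  define D where "D = csqrt ((a + d)\<^sup>2 - 4 * (a * d - b * c))"
  have D: "D * D = (a + d)\<^sup>2 - 4 * (a * d - b * c)" unfolding D_def using power2_csqrt by (simp add: power2_eq_square[symmetric])
  have quad: "((a + d + y) / 2) * ((a + d + y) / 2) = (a + d) * ((a + d + y) / 2) - (a * d - b * c)"
    if y: "y * y = (a + d)\<^sup>2 - 4 * (a * d - b * c)" for y
  proof -
    have "((a + d + y) / 2) * ((a + d + y) / 2) = ((a + d)\<^sup>2 + 2 * (a + d) * y + y * y) / 4"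
      by (simp add: field_simps power2_eq_square)
    also have "\<dots> = (a + d) * ((a + d + y) / 2) - (a * d - b * c)"
      unfolding y by (simp add: field_simps power2_eq_square)
    finally show ?thesis .
  qed
  have r1: "((a + d + D) / 2) * ((a + d + D) / 2) = (a + d) * ((a + d + D) / 2) - (a * d - b * c)"
    by (rule quad[OF D])
  have r2: "((a + d - D) / 2) * ((a + d - D) / 2) = (a + d) * ((a + d - D) / 2) - (a * d - b * c)"
    using quad[of "- D"] D by simp
  have "a + d = (a + d + D) / 2 + (a + d - D) / 2" by (simp add: field_simps)
  then have antidiag2: "a + d = 0" unfolding ev[OF r1] ev[OF r2] by simp
  define A where "A = 1 + 3 * a"
  define E where "E = 1 + 3 * d"
  have "A + E = 2 + 3 * (a + d)" unfolding A_def E_def by (simp add: algebra_simps)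
  then have AE: "A + E = 2" unfolding antidiag2 by simp
  have un: "g ** dagger g = mat 1" using U2_unitary[OF Gn_U2[OF g(1)]] by blast
  have rows: "A * cnj A + (3 * b) * cnj (3 * b) = 1" "(3 * c) * cnj (3 * c) + E * cnj E = 1"
    using un unfolding g' dagger_mat2 mat2_mult mat_mat2 mat2_eq_iff A_def[symmetric] E_def[symmetric] by blast+
  have nA: "(norm A)\<^sup>2 + (norm (3 * b))\<^sup>2 = 1" "(norm (3 * c))\<^sup>2 + (norm E)\<^sup>2 = 1"
    using rows unfolding complex_norm_square[symmetric] by (metis of_real_add of_real_eq_1_iff)+
  then have le1: "(norm A)\<^sup>2 \<le> 1" "(norm E)\<^sup>2 \<le> 1" using zero_le_power2[of "norm (3 * b)"] zero_le_power2[of "norm (3 * c)"] by linarith+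
  \<comment> \<open>Diagonal entries of a unitary matrix have modulus at most 1, so a sum of 2
    forces both to be 1.\<close>
  have n1: "norm A \<le> 1" "norm E \<le> 1" using le1 by (simp_all add: power_le_one_iff abs_square_le_1)
  have "Re A + Re E = 2" using AE by (simp add: complex_eq_iff)
  then have re: "Re A = 1" "Re E = 1" using complex_Re_le_cmod[of A] complex_Re_le_cmod[of E] n1 by linarith+
  have im: "Im A = 0" "Im E = 0" using le1 re unfolding cmod_power2 by simp_all
  have A1: "A = 1" "E = 1" using re im by (simp_all add: complex_eq_iff)
  then have "b = 0" "c = 0" using nA by simp_all
  then show "g = \<one>\<^bsub>G\<lparr>carrier := cong_subgroup\<rparr>\<^esub>" unfolding g' A_def[symmetric] E_def[symmetric] A1 by (simp add: U2_simps mat_mat2)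
qed

section \<open>Characteristics of the group, of its determinant-one subgroup and of its projective
  image\<close>

lemma euler_G:
  shows "euler_subgroup cong_subgroup G"
    "euler_char G = 1 / of_nat (24 * n) + 1 / of_nat (2 * n * n) - 1 / of_nat (8 * n)"
proof -
  interpret A: reduced_amalgam G cliff_part mono_part by (rule amalgam)
  note E = A.euler_char_amalgam[OF finite_At finite_Bt subgroup_Kc finite_index_Kc torsion_free_Kc]
  show "euler_subgroup cong_subgroup G" by (rule E(1))
  show "euler_char G = 1 / of_nat (24 * n) + 1 / of_nat (2 * n * n) - 1 / of_nat (8 * n)"
    using E(2) unfolding card_At card_Bt card_AB .
qed

text \<open>The constant arises as \<open>1 / 24 - 1 / 8\<close>.\<close>

lemma euler_G_eq: "of_nat n * euler_char G = - (1 / 12) + 1 / (2 * of_nat n)"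
  unfolding euler_G(2) using n(1) by (simp add: field_simps)

text \<open>The determinant of \<open>hmat u p q\<close> contains a factor \<open>\<i>\<close>;
  since 4 divides \<open>n\<close>, it stays in \<open>mu n\<close>.\<close>

lemma det_Gn: "g \<in> Gn n \<Longrightarrow> det g \<in> mu n"
proof -
  let ?D = "{g \<in> carrier U. det g \<in> mu n}"
  have i: "-1 \<in> mu n" "\<i> \<in> mu n" using mu4_sub unfolding mu_4 by auto
  have "subgroup ?D U"
  proof (rule group.subgroupI[OF group_U])
    have "mat 1 \<in> carrier U" using mat_in_U[OF mu_1] .
    then show "?D \<noteq> {}" using mu_1 by (intro notI) (auto simp: det_I dest!: equalityD1)
    show "inv\<^bsub>U\<^esub> g \<in> ?D" if g: "g \<in> ?D" for g
    proof -
      have gU: "g \<in> carrier U" using g by simp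
      have "det g * det (dagger g) = 1" using U2_unitary[OF gU] det_mul[of g "dagger g"] by (simp add: det_I)
      moreover have "det g \<noteq> 0" using mu_nonzero[OF n(1)] g by blast
      ultimately have "det (dagger g) = 1 / det g" by (simp add: field_simps)
      then show ?thesis using group.inv_closed[OF group_U gU] g mu_inverse inv_U2[OF csubring_R gU] by simp
    qed
    show "g \<otimes>\<^bsub>U\<^esub> h \<in> ?D" if "g \<in> ?D" "h \<in> ?D" for g h
      using that monoid.m_closed[OF group.is_monoid[OF group_U], of g h] mu_mult by (simp add: U2_simps det_mul)
  qed auto
  moreover have "cliff_part \<union> mono_part \<subseteq> ?D"
  proof -
    have d: "det (diag2 u v) \<in> mu n" "det (antidiag2 u v) \<in> mu n" if "u \<in> mu n" "v \<in> mu n" for u v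
      using mu_mult[OF that] mu_mult[OF i(1) mu_mult[OF that]] unfolding diag2_def antidiag2_def det_mat2 by simp_all
    have "det (hmat u p q) \<in> mu n" if "u \<in> mu n" "p \<in> mu 4" "q \<in> mu 4" for u p q
    proof -
      have "det (hmat u p q) = \<i> * (u * u * (p * q))"
        unfolding hmat_def det_mat2 rho_def by (simp add: field_simps)
      then show ?thesis using that mu4_sub i(2) mu_mult by (simp add: subset_iff)
    qed
    note dn = this
    have "det g \<in> mu n" if "g \<in> cliff_part" for g
      using that unfolding At_iff
    proof (elim disjE bexE)
      fix u w assume "u \<in> mu n" "w \<in> mu 4" "g = diag2 u (u * w)"
      then show ?thesis using d(1) mu_mult mu4_sub by blast
    next
      fix u w assume "u \<in> mu n" "w \<in> mu 4" "g = antidiag2 u (u * w)"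
      then show ?thesis using d(2) mu_mult mu4_sub by blast
    next
      fix u p q assume "u \<in> mu n" "p \<in> mu 4" "q \<in> mu 4" "g = hmat u p q"
      then show ?thesis using dn by simp
    qed
    moreover have "det g \<in> mu n" if "g \<in> mono_part" for g using that d by (elim Bt_cases) auto
    ultimately show ?thesis using subgroup.subset[OF subgroup_At] Bt_sub by blast
  qed
  ultimately have "Gn n \<subseteq> ?D" unfolding Gn_eq by (intro group.generate_subgroup_incl[OF group_U])
  then show "g \<in> Gn n \<Longrightarrow> ?thesis" by blast
qed

lemma SG_euler: "virtually_FL (SG n)" "euler_char (SG n) = of_nat n * euler_char G"
proof -
  interpret G: group G by (rule group_G)
  define S where "S = Gn n \<inter> SU2_carrier (Rn n)"
  have S_iff: "g \<in> S \<longleftrightarrow> g \<in> Gn n \<and> det g = 1" for g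
    unfolding S_def SU2_carrier_def using Gn_U2 by blast
  have sub: "subgroup S G"
  proof (rule G.subgroupI)
    show "S \<subseteq> carrier G" unfolding S_def by auto
    have "mat 1 \<in> S" unfolding S_iff using subgroup.one_closed[OF subgroup_Gn] by (simp add: U2_simps det_I)
    then show "S \<noteq> {}" by blast
    show "inv\<^bsub>G\<^esub> g \<in> S" if g: "g \<in> S" for g
    proof -
      have gG: "g \<in> Gn n" "det g = 1" using g S_iff by auto
      have "det g * det (dagger g) = 1" using U2_unitary[OF Gn_U2[OF gG(1)]] det_mul[of g "dagger g"] by (simp add: det_I)
      then show ?thesis using G.inv_closed[of g] gG inv_G[OF gG(1)] unfolding S_iff by simp
    qed
    show "g \<otimes>\<^bsub>G\<^esub> h \<in> S" if "g \<in> S" "h \<in> S" for g h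
      using that G.m_closed[of g h] unfolding S_iff by (simp add: U2_simps det_mul)
  qed
  have dG: "diag2 1 z \<in> Gn n" if "z \<in> mu n" for z using Bt_mem(1)[OF mu_1 that] AB_sub by blast
  have det1: "det (diag2 1 z) = z" for z by (simp add: diag2_def det_mat2)
  \<comment> \<open>The matrices \<open>diag2 1 z\<close> form a transversal because their
    determinants run through \<open>mu n\<close> once.\<close>
  have bij: "bij_betw (\<lambda>(s, z). s \<otimes>\<^bsub>G\<^esub> diag2 1 z) (S \<times> mu n) (carrier G)"
  proof (rule bij_betwI[of _ _ _ "\<lambda>g. (g ** diag2 1 (1 / det g), det g)"])
    show "(\<lambda>(s, z). s \<otimes>\<^bsub>G\<^esub> diag2 1 z) \<in> S \<times> mu n \<rightarrow> carrier G"
      using G.m_closed dG S_iff by auto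
    show "(\<lambda>g. (g ** diag2 1 (1 / det g), det g)) \<in> carrier G \<rightarrow> S \<times> mu n"
    proof
      fix g assume g: "g \<in> carrier G"
      have d: "det g \<in> mu n" "det g \<noteq> 0" using det_Gn[of g] mu_nonzero[OF n(1)] g by auto
      have "g ** diag2 1 (1 / det g) \<in> Gn n" using G.m_closed[of g "diag2 1 (1 / det g)"] g dG mu_inverse d by (simp add: U2_simps)
      then show "(g ** diag2 1 (1 / det g), det g) \<in> S \<times> mu n" using d by (simp add: S_iff det_mul det1)
    qed
    show "(\<lambda>g. (g ** diag2 1 (1 / det g), det g)) (case p of (s, z) \<Rightarrow> s \<otimes>\<^bsub>G\<^esub> diag2 1 z) = p" if p: "p \<in> S \<times> mu n" for p
    proof -
      obtain s z where sz: "p = (s, z)" "s \<in> S" "z \<in> mu n" using p by auto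
      have "det (s ** diag2 1 z) = z" using sz(2) by (simp add: det_mul det1 S_iff)
      moreover have "(s ** diag2 1 z) ** diag2 1 (1 / z) = s"
        using mu_nonzero[OF n(1) sz(3)] by (simp add: matrix_mul_assoc[symmetric] dg_mult) (simp add: mat_eq_dg[symmetric])
      ultimately show ?thesis by (simp add: sz(1) U2_simps)
    qed
    show "(case (g ** diag2 1 (1 / det g), det g) of (s, z) \<Rightarrow> s \<otimes>\<^bsub>G\<^esub> diag2 1 z) = g" if g: "g \<in> carrier G" for g
    proof -
      have "det g \<noteq> 0" using det_Gn[of g] mu_nonzero[OF n(1)] g by auto
      then show ?thesis by (simp add: U2_simps matrix_mul_assoc[symmetric] dg_mult) (simp add: mat_eq_dg[symmetric])
    qed
  qed
  have dG': "diag2 1 z \<in> carrier G" if "z \<in> mu n" for z using dG that by simp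
  note I = G.index_of_transversal[OF sub finite_mu[OF n(1)] dG' bij, unfolded card_mu[OF n(1)]]
  have e: "SG n = G\<lparr>carrier := S\<rparr>" unfolding SG_def S_def by simp
  note F = G.euler_char_finite_index[OF euler_G(1) sub I(1)]
  show "virtually_FL (SG n)" unfolding e by (rule F(1))
  show "euler_char (SG n) = of_nat n * euler_char G" using F(2) I(2) unfolding e by simp
qed

lemma card_scalars: "finite (mat ` mu n :: (complex^2^2) set)" "card (mat ` mu n :: (complex^2^2) set) = n"
proof -
  have "inj_on (mat :: complex \<Rightarrow> complex^2^2) (mu n)" by (auto simp: inj_on_def mat_mat2 mat2_eq_iff)
  then show "card (mat ` mu n :: (complex^2^2) set) = n" by (simp add: card_image card_mu[OF n(1)])
  show "finite (mat ` mu n :: (complex^2^2) set)" using finite_mu[OF n(1)] by simp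
qed

lemma PG_euler: "virtually_FL (PG n)" "euler_char (PG n) = of_nat n * euler_char G"
proof -
  interpret U: group U by (rule group_U)
  interpret G: group G by (rule group_G)
  let ?Z = "U2_scalars (Rn n)"
  have sZ: "subgroup ?Z U"
  proof (rule U.subgroupI)
    show "?Z \<subseteq> carrier U" unfolding U2_scalars_def by auto
    show "?Z \<noteq> {}" unfolding U2_scalars_def using mat_in_U[OF mu_1] by blast
    show "inv\<^bsub>U\<^esub> g \<in> ?Z" if g: "g \<in> ?Z" for g
    proof -
      obtain c where c: "g \<in> carrier U" "g = mat c" using g unfolding U2_scalars_def by blast
      have "dagger g = mat (cnj c)" unfolding c(2) mat_mat2 dagger_mat2 by simp
      then show ?thesis using U.inv_closed[OF c(1)] inv_U2[OF csubring_R c(1)] unfolding U2_scalars_def by auto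
    qed
    show "g \<otimes>\<^bsub>U\<^esub> h \<in> ?Z" if gh: "g \<in> ?Z" "h \<in> ?Z" for g h
    proof -
      obtain c where c: "g \<in> carrier U" "g = mat c" using gh(1) unfolding U2_scalars_def by blast
      obtain d where d: "h \<in> carrier U" "h = mat d" using gh(2) unfolding U2_scalars_def by blast
      have "g \<otimes>\<^bsub>U\<^esub> h = mat (c * d)" unfolding c(2) d(2) U2_simps by (simp add: mat_mat2 mat2_mult)
      then show ?thesis using U.m_closed[OF c(1) d(1)] unfolding U2_scalars_def by auto
    qed
  qed
  have comm: "z ** g = g ** z" if "z \<in> ?Z" for z g using that mat_commute unfolding U2_scalars_def by auto
  have nZ: "?Z \<lhd> U"
  proof (rule U.normalI[OF sZ], rule ballI)
    fix x show "?Z #>\<^bsub>U\<^esub> x = x <#\<^bsub>U\<^esub> ?Z"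
      unfolding r_coset_def l_coset_def U2_simps
      by (rule arg_cong[where f = Union], rule image_cong) (rule refl, drule comm[of _ x], simp only:)
  qed
  define \<pi> where "\<pi> g = ?Z #>\<^bsub>U\<^esub> g" for g
  have hom: "\<pi> \<in> hom U (PU2 (Rn n))" unfolding \<pi>_def PU2_def using normal.r_coset_hom_Mod[OF nZ] .
  have gP: "group (PU2 (Rn n))" unfolding PU2_def by (rule normal.factorgroup_is_group[OF nZ])
  interpret \<pi>: group_hom U "PU2 (Rn n)" \<pi>
    by (intro group_hom.intro group_hom_axioms.intro U.is_group gP hom)
  have PG: "PG n = (PU2 (Rn n))\<lparr>carrier := \<pi> ` Gn n\<rparr>" unfolding PG_def \<pi>_def ..
  have gPG: "group (PG n)" unfolding PG
    by (rule group.subgroup_imp_group[OF gP \<pi>.subgroup_img_is_subgroup[OF subgroup_Gn]])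
  have hom': "\<pi> \<in> hom G (PG n)"
    using hom Gn_U2 unfolding PG hom_def by auto
  have surj: "\<pi> ` carrier G = carrier (PG n)" unfolding PG by simp
  \<comment> \<open>The quotient is by all scalars in \<open>U2 (Rn n)\<close>, but only those in
    \<open>Gn n\<close> enter the kernel of the restriction.\<close>
  have ker: "kernel G (PG n) \<pi> = mat ` mu n"
  proof (rule Set.set_eqI)
    fix g
    have one: "\<one>\<^bsub>PG n\<^esub> = ?Z" unfolding PG PU2_def by simp
    have "g \<in> kernel G (PG n) \<pi> \<longleftrightarrow> g \<in> Gn n \<and> \<pi> g = ?Z" unfolding kernel_def one by auto
    also have "\<dots> \<longleftrightarrow> g \<in> Gn n \<and> g \<in> ?Z"
      unfolding \<pi>_def using U.coset_join1[OF _ _ sZ, of g] U.coset_join2[OF _ sZ, of g] Gn_U2 by blast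
    also have "\<dots> \<longleftrightarrow> g \<in> mat ` mu n"
    proof
      assume "g \<in> Gn n \<and> g \<in> ?Z"
      then show "g \<in> mat ` mu n" using scalar_in_Gn_iff unfolding U2_scalars_def by auto
    next
      assume "g \<in> mat ` mu n"
      then show "g \<in> Gn n \<and> g \<in> ?Z" using scalar_in_Gn_iff mat_in_U unfolding U2_scalars_def by auto
    qed
    finally show "g \<in> kernel G (PG n) \<pi> \<longleftrightarrow> g \<in> mat ` mu n" .
  qed
  note Q = G.euler_char_quotient[OF gPG hom' surj _ euler_G(1), unfolded ker card_scalars(2), OF card_scalars(1)]
  show "virtually_FL (PG n)" "euler_char (PG n) = of_nat n * euler_char G" using Q by blast+
qed

end

section \<open>The adjoint representation\<close>

text \<open>The usual identification of real 3-space with the traceless Hermitian matrices by the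
  Pauli matrices; \<open>bloch\<close> recovers the vector from the first column.\<close>

definition pauli :: "real^3 \<Rightarrow> complex^2^2" where
  "pauli v = mat2 (of_real (v $ 3)) (Complex (v $ 1) (- (v $ 2))) (Complex (v $ 1) (v $ 2)) (- of_real (v $ 3))"

definition bloch :: "complex^2^2 \<Rightarrow> real^3" where
  "bloch M = vector [Re (M $ 2 $ 1), Im (M $ 2 $ 1), Re (M $ 1 $ 1)]"

definition Ad :: "complex^2^2 \<Rightarrow> real^3^3" where
  "Ad g = matrix (\<lambda>v. bloch (conjm g (pauli v)))"

lemma bloch_nth [simp]:
  "bloch M $ 1 = Re (M $ 2 $ 1)" "bloch M $ 2 = Im (M $ 2 $ 1)" "bloch M $ 3 = Re (M $ 1 $ 1)"
  by (simp_all add: bloch_def vector_3)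

lemma vec3_eqI: "(v :: real^3) $ 1 = w $ 1 \<Longrightarrow> v $ 2 = w $ 2 \<Longrightarrow> v $ 3 = w $ 3 \<Longrightarrow> v = w"
  by (simp add: vec_eq_iff forall_3)

lemma bloch_pauli: "bloch (pauli v) = v"
  by (rule vec3_eqI) (simp_all add: pauli_def)

lemma pauli_inj: "pauli v = pauli w \<longleftrightarrow> v = w"
  using bloch_pauli by metis

lemma pauli_add: "pauli (v + w) = pauli v + pauli w"
  by (rule mat2_eqI) (simp_all add: pauli_def complex_eq_iff)

lemma pauli_scale: "pauli (r *\<^sub>R v) = mat (of_real r) ** pauli v"
  unfolding pauli_def mat_mat2 mat2_mult mat2_eq_iff by (simp add: complex_eq_iff)

lemma conjm_add: "conjm g (M + N) = conjm g M + conjm g N"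
  unfolding conjm_def
  by (simp add: vec_eq_iff matrix_matrix_mult_def sum_2 forall_2 algebra_simps)

lemma conjm_scale: "conjm g (mat c ** M) = mat c ** conjm g M"
  unfolding conjm_def by (simp only: matrix_mul_assoc mat_commute[of c g])

lemma bloch_linear: "bloch (M + N) = bloch M + bloch N" "bloch (mat (of_real r) ** M) = r *\<^sub>R bloch M"
  by (rule vec3_eqI; simp add: matrix_mult_2 mat_def)+

lemma linear_Ad: "linear (\<lambda>v. bloch (conjm g (pauli v)))"
  by (rule linearI) (simp_all add: pauli_add pauli_scale conjm_add conjm_scale bloch_linear)

lemma Ad_apply: "Ad g *v v = bloch (conjm g (pauli v))"
  unfolding Ad_def using matrix_works[of "\<lambda>v. bloch (conjm g (pauli v))" v] linear_Ad[of g]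
  by (simp add: scalar_mult_eq_scaleR[abs_def])

definition tr2 :: "complex^2^2 \<Rightarrow> complex" where "tr2 M = M $ 1 $ 1 + M $ 2 $ 2"

lemma tr2_commute: "tr2 (A ** B) = tr2 (B ** A)"
  by (simp add: tr2_def matrix_mult_2)

lemma pauli_bloch:
  assumes "dagger M = M" "tr2 M = 0"
  shows "pauli (bloch M) = M"
proof -
  obtain a b c d where M: "M = mat2 a b c d" by (rule mat2_cases)
  have e: "cnj a = a" "cnj c = b" "a + d = 0" using assms unfolding M dagger_mat2 mat2_eq_iff tr2_def by simp_all
  have a: "of_real (Re a) = a" using e(1) by (simp add: complex_eq_iff)
  have d: "d = - a" using e(3) by (simp add: eq_neg_iff_add_eq_0 add.commute)
  have c: "Complex (Re c) (Im c) = c" "Complex (Re c) (- Im c) = b" using e(2) by (auto simp: complex_eq_iff)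
  show ?thesis unfolding M pauli_def bloch_nth mat2_nth mat2_eq_iff a c d by simp
qed

text \<open>Conjugation by a unitary matrix preserves traceless Hermitian matrices, so
  \<open>bloch\<close> loses no information there. Multiplicativity of \<open>Ad\<close> follows
  from this.\<close>

lemma pauli_Ad:
  assumes g: "dagger g ** g = mat 1"
  shows "pauli (Ad g *v v) = conjm g (pauli v)"
  unfolding Ad_apply
proof (rule pauli_bloch)
  have h: "dagger (pauli v) = pauli v"
    unfolding pauli_def dagger_mat2 mat2_eq_iff by (simp add: complex_eq_iff)
  show "dagger (conjm g (pauli v)) = conjm g (pauli v)"
    unfolding conjm_def dagger_mult dagger_dagger h by (simp add: matrix_mul_assoc)
  have "tr2 (conjm g (pauli v)) = tr2 ((dagger g ** g) ** pauli v)"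
    unfolding conjm_def tr2_commute[of "g ** pauli v"] by (simp add: matrix_mul_assoc)
  then show "tr2 (conjm g (pauli v)) = 0" unfolding g by (simp add: tr2_def pauli_def)
qed

lemma Ad_mult:
  assumes g: "dagger g ** g = mat 1" and h: "dagger h ** h = mat 1"
  shows "Ad (g ** h) = Ad g ** Ad h"
proof -
  have gh: "dagger (g ** h) ** (g ** h) = mat 1"
  proof -
    have "dagger (g ** h) ** (g ** h) = dagger h ** ((dagger g ** g) ** h)"
      by (simp add: dagger_mult matrix_mul_assoc)
    then show ?thesis using g h by simp
  qed
  have "Ad (g ** h) *v v = (Ad g ** Ad h) *v v" for v
  proof -
    have "pauli (Ad (g ** h) *v v) = pauli (Ad g *v (Ad h *v v))"
      by (simp add: pauli_Ad[OF gh] pauli_Ad[OF g] pauli_Ad[OF h] conjm_mult)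
    then show ?thesis unfolding pauli_inj by (simp add: matrix_vector_mul_assoc)
  qed
  then show ?thesis by (simp add: matrix_eq)
qed

lemma Ad_scalar:
  assumes "c * cnj c = 1"
  shows "Ad (mat c) = mat 1"
proof -
  have "conjm (mat c) (pauli v) = pauli v" for v
  proof -
    have "conjm (mat c) (pauli v) = mat (c * cnj c) ** pauli v"
      unfolding conjm_def mat_mat2 dagger_mat2
      by (cases "pauli v" rule: mat2_cases) (simp add: mat2_mult mult_ac)
    then show ?thesis using assms by simp
  qed
  then have "Ad (mat c) *v v = mat 1 *v v" for v by (simp add: Ad_apply bloch_pauli)
  then show ?thesis by (simp add: matrix_eq)
qed

text \<open>Such a \<open>g\<close> commutes with the Pauli matrices: the third one makes it
  diagonal, and the first one makes its diagonal entries equal.\<close>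

lemma Ad_eq_1_imp_scalar:
  assumes g: "dagger g ** g = mat 1" and "Ad g = mat 1"
  shows "\<exists>c. g = mat c"
proof -
  have comm: "g ** pauli v = pauli v ** g" for v
  proof -
    have "conjm g (pauli v) = pauli v" using pauli_Ad[OF g, of v] assms(2) by simp
    then have "conjm g (pauli v) ** g = pauli v ** g" by simp
    moreover have "conjm g (pauli v) ** g = g ** pauli v ** (dagger g ** g)"
      unfolding conjm_def by (simp add: matrix_mul_assoc)
    ultimately show ?thesis using g by simp
  qed
  obtain a b c d where G: "g = mat2 a b c d" by (rule mat2_cases)
  have "pauli (vector [0, 0, 1]) = mat2 1 0 0 (-1)" "pauli (vector [1, 0, 0]) = mat2 0 1 1 0"
    unfolding pauli_def mat2_eq_iff by (simp_all add: vector_3 complex_eq_iff)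
  then have z: "mat2 a b c d ** mat2 1 0 0 (-1) = mat2 1 0 0 (-1) ** mat2 a b c d"
    and x: "mat2 a b c d ** mat2 0 1 1 0 = mat2 0 1 1 0 ** mat2 a b c d"
    using comm unfolding G by metis+
  have "- b = b" using arg_cong[OF z, of "\<lambda>M. M $ 1 $ 2"] by (simp add: mat2_mult)
  then have b: "b = 0" by (simp add: complex_eq_iff)
  have "- c = c" using arg_cong[OF z, of "\<lambda>M. M $ 2 $ 1", symmetric] by (simp add: mat2_mult)
  then have c: "c = 0" by (simp add: complex_eq_iff)
  have "a = d" using arg_cong[OF x, of "\<lambda>M. M $ 1 $ 2"] by (simp add: mat2_mult)
  note b c this
  then have "g = mat a" unfolding G mat_mat2 by (simp only:)
  then show ?thesis ..
qed

lemma group_SO3: "group SO3"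
proof (rule groupI)
  fix x y assume "x \<in> carrier SO3" "y \<in> carrier SO3"
  then show "x \<otimes>\<^bsub>SO3\<^esub> y \<in> carrier SO3"
    by (simp add: SO3_def rotation_matrix_def orthogonal_matrix_mul det_mul)
next
  fix x assume x: "x \<in> carrier SO3"
  then have "transpose x \<in> carrier SO3" "transpose x ** x = mat 1"
    by (auto simp: SO3_def rotation_matrix_def orthogonal_matrix_def det_transpose transpose_transpose)
  then show "\<exists>y\<in>carrier SO3. y \<otimes>\<^bsub>SO3\<^esub> x = \<one>\<^bsub>SO3\<^esub>" by (auto simp: SO3_def)
qed (simp_all add: SO3_def rotation_matrix_def orthogonal_matrix_id det_I matrix_mul_assoc)

lemma rot_z_mult: "rot_z s ** rot_z t = rot_z (s + t)"
  unfolding rot_z_def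
  by (simp add: vec_eq_iff forall_3 matrix_matrix_mult_def sum_3 vector_3 cos_add sin_add algebra_simps)

lemma rot_z_power: "rot_z t [^]\<^bsub>SO3\<^esub> k = rot_z (real k * t)"
proof (induction k)
  case 0
  show ?case by (simp add: nat_pow_def SO3_def rot_z_def vec_eq_iff forall_3 vector_3 mat_def)
next
  case (Suc k)
  then show ?case by (simp add: nat_pow_def SO3_def rot_z_mult algebra_simps)
qed

lemma sin_cos_sq: "cos t * cos t + sin t * sin t = (1 :: real)" "sin t * sin t + cos t * cos t = (1 :: real)"
  using sin_cos_squared_add[of t] by (simp_all add: power2_eq_square add.commute)

lemma rot_in_SO3: "rot_y t \<in> carrier SO3" "rot_z t \<in> carrier SO3"
proof -
  have "transpose (rot_y t) ** rot_y t = mat 1" "transpose (rot_z t) ** rot_z t = mat 1"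
    unfolding rot_y_def rot_z_def
    by (simp_all add: vec_eq_iff forall_3 matrix_matrix_mult_def sum_3 vector_3 transpose_def mat_def sin_cos_sq algebra_simps)
  moreover have "det (rot_y t) = 1" "det (rot_z t) = 1"
    unfolding rot_y_def rot_z_def by (simp_all add: det_3 vector_3 sin_cos_sq)
  ultimately show "rot_y t \<in> carrier SO3" "rot_z t \<in> carrier SO3"
    by (simp_all add: SO3_def rotation_matrix_def orthogonal_matrix)
qed

lemma Ad_dg:
  assumes "v * cnj u = cis t" "u * cnj u = 1"
  shows "Ad (diag2 u v) = rot_z t"
proof -
  have "bloch (conjm (diag2 u v) (pauli w)) = rot_z t *v w" for w
  proof -
    have "(conjm (diag2 u v) (pauli w)) $ 2 $ 1 = (v * cnj u) * Complex (w $ 1) (w $ 2)"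
      "(conjm (diag2 u v) (pauli w)) $ 1 $ 1 = (u * cnj u) * of_real (w $ 3)"
      unfolding conjm_def diag2_def pauli_def dagger_mat2 mat2_mult mat2_nth by simp_all
    then show ?thesis unfolding assms
      by (intro vec3_eqI) (simp_all add: rot_z_def matrix_vector_mult_def sum_3 vector_3)
  qed
  then have "Ad (diag2 u v) *v w = rot_z t *v w" for w by (simp add: Ad_apply)
  then show ?thesis by (simp add: matrix_eq)
qed

text \<open>The Hadamard matrix acts as the half turn about the bisector of the first and third
  axes, which factors in this way.\<close>

lemma Ad_nn: "Ad (hmat 1 1 1) = rot_y (pi / 2) ** rot_z pi"
proof -
  have "bloch (conjm (hmat 1 1 1) (pauli w)) = (rot_y (pi / 2) ** rot_z pi) *v w" for w
  proof -
    show ?thesis unfolding pauli_def conjm_nn rho_cnj(1)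
      by (intro vec3_eqI) (simp_all add: rot_y_def rot_z_def matrix_vector_mult_def matrix_matrix_mult_def sum_3 vector_3)
  qed
  then have "Ad (hmat 1 1 1) *v w = (rot_y (pi / 2) ** rot_z pi) *v w" for w by (simp add: Ad_apply)
  then show ?thesis by (simp add: matrix_eq)
qed

context gates begin

abbreviation "gens \<equiv> {rot_y (2 * pi / of_nat 4), rot_z (2 * pi / of_nat n)}"

lemma gens_sub: "gens \<subseteq> carrier SO3" using rot_in_SO3 by simp

lemma Grot_sub: "subgroup (generate SO3 gens) SO3"
  by (rule group.generate_is_subgroup[OF group_SO3 gens_sub])

lemma unitary_Gn: "g \<in> carrier U \<Longrightarrow> dagger g ** g = mat 1" using U2_unitary by blast

lemma Ad_dagger:
  assumes g: "g \<in> carrier U" and Ag: "Ad g \<in> carrier SO3"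
  shows "Ad (dagger g) = inv\<^bsub>SO3\<^esub> (Ad g)"
proof -
  have diag2: "dagger (dagger g) ** dagger g = mat 1" using U2_unitary[OF g] by (simp add: dagger_dagger)
  have "Ad (dagger g) ** Ad g = Ad (mat 1)" unfolding Ad_mult[OF diag2 unitary_Gn[OF g], symmetric] using unitary_Gn[OF g] by simp
  then have l: "Ad (dagger g) ** Ad g = mat 1" using Ad_scalar[of 1] by simp
  have i: "inv\<^bsub>SO3\<^esub> (Ad g) \<in> carrier SO3" by (rule group.inv_closed[OF group_SO3 Ag])
  have r: "Ad g ** inv\<^bsub>SO3\<^esub> (Ad g) = mat 1" using group.r_inv[OF group_SO3 Ag] by (simp add: SO3_def)
  have "Ad (dagger g) = Ad (dagger g) ** (Ad g ** inv\<^bsub>SO3\<^esub> (Ad g))" unfolding r by simp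
  also have "\<dots> = inv\<^bsub>SO3\<^esub> (Ad g)" using l by (simp add: matrix_mul_assoc)
  finally show ?thesis .
qed

lemma Ad_dg_in: assumes u: "u \<in> mu n" "v \<in> mu n" shows "Ad (diag2 u v) \<in> generate SO3 gens"
proof -
  have "v / u \<in> mu n" by (rule mu_divide[OF u(2,1)])
  then obtain k where k: "v / u = \<zeta> n ^ k" unfolding mu_eq_powers[OF n(1)] by blast
  have "v * cnj u = cis (2 * pi * real k / real n)"
    using k unfolding zeta_power mu_cnj[OF n(1) u(1)] by simp
  moreover have "u * cnj u = 1" unfolding mu_cnj[OF n(1) u(1)] using mu_nonzero[OF n(1) u(1)] by simp
  ultimately have "Ad (diag2 u v) = rot_z (2 * pi * real k / real n)" by (rule Ad_dg)
  also have "\<dots> = rot_z (2 * pi / real n) [^]\<^bsub>SO3\<^esub> k" unfolding rot_z_power by (simp add: mult_ac)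
  also have "\<dots> \<in> generate SO3 gens"
  proof -
    have z: "rot_z (2 * pi / real n) \<in> generate SO3 gens" by (rule generate.incl) simp
    show ?thesis
    proof (induction k)
      case 0 show ?case using generate.one[of SO3 gens] by (simp add: nat_pow_def)
    next
      case (Suc k) then show ?case using generate.eng[OF Suc z] by (simp add: nat_pow_def)
    qed
  qed
  finally show ?thesis .
qed

lemma nn_in: "hmat 1 1 1 \<in> Gn n" "diag2 1 (-1) \<in> Gn n"
proof -
  have "hmat 1 1 1 \<in> cliff_part" unfolding At_iff using mu_1 by blast
  then show "hmat 1 1 1 \<in> Gn n" using AB_sub by blast
  have "-1 \<in> mu n" using mu4_sub unfolding mu_4 by blast
  then show "diag2 1 (-1) \<in> Gn n" using Bt_mem(1)[OF mu_1] AB_sub by blast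
qed

lemma Ad_dg_m1: "Ad (diag2 1 (-1)) = rot_z pi"
  by (rule Ad_dg) (simp_all add: complex_eq_iff)

text \<open>The half turn about the third axis cancels the one in \<open>Ad_nn\<close>, which
  exhibits the first generating rotation as an image.\<close>

lemma Ad_y: "Ad (hmat 1 1 1 ** diag2 1 (-1)) = rot_y (pi / 2)"
proof -
  have "Ad (hmat 1 1 1 ** diag2 1 (-1)) = rot_y (pi / 2) ** (rot_z pi ** rot_z pi)"
    unfolding Ad_mult[OF unitary_Gn[OF Gn_U2[OF nn_in(1)]] unitary_Gn[OF Gn_U2[OF nn_in(2)]]] Ad_nn Ad_dg_m1
    by (simp add: matrix_mul_assoc)
  also have "rot_z pi ** rot_z pi = mat 1"
    unfolding rot_z_mult by (simp add: rot_z_def vec_eq_iff forall_3 vector_3 mat_def)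
  finally show ?thesis by simp
qed

text \<open>Membership in \<open>SO3\<close> is obtained along with membership in the rotation
  group, generator by generator, from images of diagonal matrices and of the Hadamard
  matrix.\<close>

lemma Ad_in_Grot: "g \<in> Gn n \<Longrightarrow> Ad g \<in> generate SO3 gens"
proof -
  let ?L = "generate SO3 gens" and ?D = "{g \<in> carrier U. Ad g \<in> generate SO3 gens}"
  have LS: "?L \<subseteq> carrier SO3" by (rule subgroup.subset[OF Grot_sub])
  have m: "g ** h \<in> ?D" if "g \<in> ?D" "h \<in> ?D" for g h
  proof -
    have "Ad (g ** h) = Ad g ** Ad h" using Ad_mult unitary_Gn that by blast
    then have "Ad (g ** h) \<in> ?L" using generate.eng[of "Ad g" SO3 gens "Ad h"] that by (simp add: SO3_def)
    moreover have "g ** h \<in> carrier U" using monoid.m_closed[OF group.is_monoid[OF group_U], of g h] that by (simp add: U2_simps)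
    ultimately show ?thesis by blast
  qed
  have d: "diag2 u v \<in> ?D" if "u \<in> mu n" "v \<in> mu n" for u v
    using Ad_dg_in[OF that] Bt_mem(1)[OF that] Bt_sub by blast
  have "subgroup ?D U"
  proof (rule group.subgroupI[OF group_U])
    show "?D \<noteq> {}" using d[OF mu_1 mu_1] by blast
    show "inv\<^bsub>U\<^esub> g \<in> ?D" if g: "g \<in> ?D" for g
    proof -
      have gU: "g \<in> carrier U" "Ad g \<in> ?L" using g by auto
      have "Ad (dagger g) = inv\<^bsub>SO3\<^esub> (Ad g)" using Ad_dagger[OF gU(1)] gU(2) LS by blast
      then have "Ad (dagger g) \<in> ?L" using subgroup.m_inv_closed[OF Grot_sub gU(2)] by simp
      then show ?thesis using group.inv_closed[OF group_U gU(1)] inv_U2[OF csubring_R gU(1)] by simp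
    qed
    show "g \<otimes>\<^bsub>U\<^esub> h \<in> ?D" if "g \<in> ?D" "h \<in> ?D" for g h using m[OF that] by (simp only: U2_simps)
  qed auto
  moreover have "cliff_part \<union> mono_part \<subseteq> ?D"
  proof -
    have i: "\<i> \<in> mu n" "-1 \<in> mu n" using mu4_sub unfolding mu_4 by auto
    have y: "rot_y (pi / 2) \<in> ?L" using generate.incl[of "rot_y (2 * pi / of_nat 4)" gens SO3] by simp
    have "Ad (diag2 1 (-1)) \<in> ?L" using d[OF mu_1 i(2)] by blast
    then have "Ad (hmat 1 1 1) \<in> ?L" unfolding Ad_nn Ad_dg_m1 using generate.eng[OF y, of "rot_z pi"] by (simp add: SO3_def)
    then have nn1: "hmat 1 1 1 \<in> ?D" using Gn_U2[OF nn_in(1)] by blast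
    \<comment> \<open>The Hadamard matrix conjugates the third Pauli matrix into the first; the
      scalar \<open>\<i>\<close> compensates for \<open>2 * rho ^ 2 = - \<i>\<close>.\<close>
    have "antidiag2 1 1 = diag2 \<i> \<i> ** (hmat 1 1 1 ** (diag2 1 (-1) ** hmat 1 1 1))"
      unfolding antidiag2_def diag2_def hmat_def mat2_mult mat2_eq_iff rho_def by (simp add: complex_eq_iff)
    then have ad1: "antidiag2 1 1 \<in> ?D" using m[OF d[OF i(1) i(1)] m[OF nn1 m[OF d[OF mu_1 i(2)] nn1]]] by (simp only:)
    have a: "antidiag2 u v \<in> ?D" if "u \<in> mu n" "v \<in> mu n" for u v
      using m[OF d[OF that] ad1] by (simp only: dg_mult mult_1_right)
    have nnD: "hmat u p q \<in> ?D" if "u \<in> mu n" "p \<in> mu n" "q \<in> mu n" for u p q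
      unfolding nn_decomp[of u p q] by (intro m d nn1 mu_1 that)
    have "g \<in> ?D" if "g \<in> cliff_part" for g
      using that unfolding At_iff
    proof (elim disjE bexE)
      fix u w assume "u \<in> mu n" "w \<in> mu 4" "g = diag2 u (u * w)"
      then show ?thesis using d mu_mult subsetD[OF mu4_sub] by (simp only:)
    next
      fix u w assume "u \<in> mu n" "w \<in> mu 4" "g = antidiag2 u (u * w)"
      then show ?thesis using a mu_mult subsetD[OF mu4_sub] by (simp only:)
    next
      fix u p q assume "u \<in> mu n" "p \<in> mu 4" "q \<in> mu 4" "g = hmat u p q"
      then show ?thesis using nnD subsetD[OF mu4_sub] by (simp only:)
    qed
    moreover have "g \<in> ?D" if "g \<in> mono_part" for g
      using that by (cases rule: Bt_cases) (simp_all only: d a)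
    ultimately show ?thesis by blast
  qed
  ultimately have "Gn n \<subseteq> ?D" unfolding Gn_eq by (intro group.generate_subgroup_incl[OF group_U])
  then show "g \<in> Gn n \<Longrightarrow> ?thesis" by blast
qed

text \<open>The generating rotations come from the product in \<open>Ad_y\<close> and from
  \<open>T_gate n\<close>, written as \<open>diag2 1 (\<zeta> n)\<close>.\<close>

lemma Ad_surj: "Ad ` Gn n = generate SO3 gens"
proof (rule equalityI)
  show "Ad ` Gn n \<subseteq> generate SO3 gens" using Ad_in_Grot by blast
  have LS: "generate SO3 gens \<subseteq> carrier SO3" by (rule subgroup.subset[OF Grot_sub])
  have m: "g ** h \<in> Gn n" if "g \<in> Gn n" "h \<in> Gn n" for g h
    using subgroup.m_closed[OF subgroup_Gn that] by (simp add: U2_simps)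
  have base: "\<exists>g\<in>Gn n. x = Ad g" if "x \<in> gens" for x
  proof -
    have "x = rot_y (pi / 2) \<or> x = rot_z (2 * pi / real n)" using that by auto
    then show ?thesis
    proof
      assume "x = rot_y (pi / 2)"
      then show ?thesis using Ad_y m[OF nn_in] by metis
    next
      assume x: "x = rot_z (2 * pi / real n)"
      have "\<zeta> n * cnj 1 = cis (2 * pi / real n)" using zeta_power[of n 1] by simp
      then have "Ad (diag2 1 (\<zeta> n)) = x" unfolding x by (rule Ad_dg) simp
      moreover have "diag2 1 (\<zeta> n) \<in> Gn n" using Bt_mem(1)[OF mu_1 zeta_in_mu[OF n(1)]] AB_sub by blast
      ultimately show ?thesis by blast
    qed
  qed
  have "\<exists>g\<in>Gn n. x = Ad g" if "x \<in> generate SO3 gens" for x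
    using that
  proof (induction rule: generate.induct)
    case one
    have "mat 1 \<in> Gn n" using subgroup.one_closed[OF subgroup_Gn] by (simp add: U2_simps)
    moreover have "\<one>\<^bsub>SO3\<^esub> = Ad (mat 1)" using Ad_scalar[of 1] by (simp add: SO3_def)
    ultimately show ?case by blast
  next
    case (incl h) then show ?case by (rule base)
  next
    case (inv h)
    then obtain g where g: "g \<in> Gn n" "h = Ad g" using base by blast
    have "inv\<^bsub>SO3\<^esub> h = Ad (dagger g)" using Ad_dagger[OF Gn_U2[OF g(1)]] Ad_in_Grot[OF g(1)] LS g(2) by auto
    moreover have "dagger g \<in> Gn n" using group.inv_closed[OF group_G, of g] g(1) inv_G[OF g(1)] by simp
    ultimately show ?case by blast
  next
    case (eng h1 h2)
    then obtain g1 g2 where g: "g1 \<in> Gn n" "h1 = Ad g1" "g2 \<in> Gn n" "h2 = Ad g2" by blast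
    have "h1 \<otimes>\<^bsub>SO3\<^esub> h2 = Ad (g1 ** g2)" unfolding g Ad_mult[OF unitary_Gn[OF Gn_U2[OF g(1)]] unitary_Gn[OF Gn_U2[OF g(3)]]]
      by (simp add: SO3_def)
    then show ?case using m[OF g(1,3)] by blast
  qed
  then show "generate SO3 gens \<subseteq> Ad ` Gn n" by blast
qed

lemma Grot_euler: "virtually_FL (Grot 4 n)" "euler_char (Grot 4 n) = of_nat n * euler_char G"
proof -
  interpret G: group G by (rule group_G)
  have Gr: "Grot 4 n = SO3\<lparr>carrier := generate SO3 gens\<rparr>" unfolding Grot_def by simp
  have gGr: "group (Grot 4 n)" unfolding Gr by (rule group.subgroup_imp_group[OF group_SO3 Grot_sub])
  have hom: "Ad \<in> hom G (Grot 4 n)"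
  proof (rule homI)
    show "Ad x \<in> carrier (Grot 4 n)" if "x \<in> carrier G" for x using that Ad_in_Grot unfolding Gr by simp
    show "Ad (x \<otimes>\<^bsub>G\<^esub> y) = Ad x \<otimes>\<^bsub>Grot 4 n\<^esub> Ad y" if "x \<in> carrier G" "y \<in> carrier G" for x y
    proof -
      have "Ad (x ** y) = Ad x ** Ad y" using Ad_mult unitary_Gn Gn_U2 that by simp
      then show ?thesis unfolding Gr by (simp add: U2_simps SO3_def)
    qed
  qed
  have surj: "Ad ` carrier G = carrier (Grot 4 n)" unfolding Gr by (simp add: Ad_surj)
  have ker: "kernel G (Grot 4 n) Ad = mat ` mu n"
  proof (rule Set.set_eqI)
    fix g
    have "\<one>\<^bsub>Grot 4 n\<^esub> = mat 1" unfolding Gr by (simp add: SO3_def)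
    then have "g \<in> kernel G (Grot 4 n) Ad \<longleftrightarrow> g \<in> Gn n \<and> Ad g = mat 1" by (simp add: kernel_def)
    also have "\<dots> \<longleftrightarrow> g \<in> mat ` mu n"
    proof
      assume g: "g \<in> Gn n \<and> Ad g = mat 1"
      then obtain c where "g = mat c" using Ad_eq_1_imp_scalar unitary_Gn Gn_U2 by blast
      then show "g \<in> mat ` mu n" using g scalar_in_Gn_iff by blast
    next
      assume "g \<in> mat ` mu n"
      then obtain c where c: "c \<in> mu n" "g = mat c" by blast
      have "c * cnj c = 1" unfolding mu_cnj[OF n(1) c(1)] using mu_nonzero[OF n(1) c(1)] by simp
      then show "g \<in> Gn n \<and> Ad g = mat 1" using c scalar_in_Gn_iff Ad_scalar by simp
    qed
    finally show "g \<in> kernel G (Grot 4 n) Ad \<longleftrightarrow> g \<in> mat ` mu n" .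
  qed
  note Q = G.euler_char_quotient[OF gGr hom surj _ euler_G(1), unfolded ker card_scalars(2), OF card_scalars(1)]
  show "virtually_FL (Grot 4 n)" "euler_char (Grot 4 n) = of_nat n * euler_char G" using Q by blast+
qed

end

theorem theorem6p3:
  fixes n :: nat
  assumes "n > 0" and "4 dvd n"
  shows "virtually_FL (SG n) \<and> virtually_FL (Grot 4 n) \<and> virtually_FL (PG n) \<and>
         euler_char (SG n) = euler_char (Grot 4 n) \<and>
         euler_char (Grot 4 n) = euler_char (PG n) \<and>
         euler_char (PG n) = - (1 / 12) + 1 / (2 * of_nat n)"
proof -
  interpret gates n by unfold_locales (fact assms)+
  show ?thesis
    using SG_euler PG_euler Grot_euler euler_G_eq by simp
qed

end
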